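(* Let $\sigma$ be a braid on $n+1$ strands, let $\sigma^2$ be its square as a braid, and let $\widehat{\sigma},\widehat{\sigma^2}\subset A\times I$ be the annular closures of $\sigma$ and $\sigma^2$. Then, as Laurent polynomials in $y$ with integer coefficients, $$y^{n-1}\,q_{\widehat{\sigma^2},\,n-1}\equiv q_{\widehat{\sigma},\,n-1}^2 \pmod 2.$$
   Context: For an oriented link $L$ in the thickened annulus $A\times I$ ($A$ an annulus, $I=[0,1]$) and an integer $k$, $$q_{L,k}=\sum_{i,j}(-1)^i y^j\,\mathrm{rk}\big(SKh^{i,j}(L;k)\big).$$ The annular closure of a braid is its closure around the core of the annulus, with all strands oriented coherently. Sutured annular Khovanov homology $SKh$ (coefficients in $\mathbb{F}_2$). Let $L\subset A\times I$ be an oriented link with diagram $D\subset A$ having $n_+$ positive and $n_-$ negative crossings. Each crossing has a $0$-resolution and a $1$-resolution; for a positive crossing the $0$-resolution is the orientation-respecting one, and for a negative crossing the $1$-resolution is the orientation-respecting one. For each choice of resolution at every crossing one gets disjoint circles in $A$; the Khovanov chain complex over $\mathbb{F}_2$ has as basis all labelings by $v_+$ or $v_-$ of the circles of all complete resolutions. The Khovanov differential is the sum over changing one $0$-resolution to a $1$-resolution, given by the merge map $v_+\otimes v_+\mapsto v_+$, $v_+\otimes v_-,\,v_-\otimes v_+\mapsto v_-$, $v_-\otimes v_-\mapsto 0$ and the split map $v_+\mapsto v_+\otimes v_-+v_-\otimes v_+$, $v_-\mapsto v_-\otimes v_-$. For a generator with $r$ crossings $1$-resolved, the homological grading is $i=r-n_-$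 and the quantum grading is $j=\#v_+-\#v_-+r+n_+-2n_-$. The winding number grading $k$ is (number of homologically nontrivial circles in $A$ labeled $v_+$) minus (number of homologically nontrivial circles in $A$ labeled $v_-$). The Khovanov differential does not increase $k$; $SKh^{i,j}(L;k)$ is the homology of the part of the differential preserving $k$, in homological grading $i$, quantum grading $j$ and winding number grading $k$. *)

theory Defs
  imports "HOL-Library.Z2" "HOL-Library.Poly_Mapping" "HOL-Library.FuncSet"
    "HOL-Algebra.AbelCoset" "Jordan_Normal_Form.VS_Connect"
begin

section \<open>Braid groups\<close>

text \<open>The letter \<open>(i, True)\<close> is the Artin generator exchanging the strands in positions
  \<open>i\<close> and \<open>i + 1\<close> (positions count from 0) by a positive crossing; \<open>(i, False)\<close> is its inverse.\<close>

type_synonym braid_word = "(nat \<times> bool) list"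

definition braid_words :: "nat \<Rightarrow> braid_word set" where
  "braid_words m = {w. \<forall>(i, b) \<in> set w. Suc i < m}"

inductive braid_equiv :: "nat \<Rightarrow> braid_word \<Rightarrow> braid_word \<Rightarrow> bool" for m :: nat where
  refl: "w \<in> braid_words m \<Longrightarrow> braid_equiv m w w"
| sym: "braid_equiv m u v \<Longrightarrow> braid_equiv m v u"
| trans: "braid_equiv m u v \<Longrightarrow> braid_equiv m v w \<Longrightarrow> braid_equiv m u w"
| append: "braid_equiv m u u' \<Longrightarrow> braid_equiv m v v' \<Longrightarrow> braid_equiv m (u @ v) (u' @ v')"
| cancel: "Suc i < m \<Longrightarrow> braid_equiv m [(i, b), (i, \<not> b)] []"
| far: "Suc i < j \<Longrightarrow> Suc j < m \<Longrightarrow>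
    braid_equiv m [(i, True), (j, True)] [(j, True), (i, True)]"
| braid: "Suc (Suc i) < m \<Longrightarrow>
    braid_equiv m [(i, True), (Suc i, True), (i, True)] [(Suc i, True), (i, True), (Suc i, True)]"

definition braid_rel :: "nat \<Rightarrow> (braid_word \<times> braid_word) set" where
  "braid_rel m = {(u, v). braid_equiv m u v}"

definition braid_group :: "nat \<Rightarrow> braid_word set monoid" where
  "braid_group m = \<lparr>carrier = braid_words m // braid_rel m,
     mult = (\<lambda>\<sigma> \<tau>. \<Union>u\<in>\<sigma>. \<Union>v\<in>\<tau>. braid_rel m `` {u @ v}),
     one = braid_rel m `` {[]}\<rparr>"


section \<open>Resolutions of the annular closure of a braid word\<close>

text \<open>The word \<open>w\<close> on \<open>m\<close> strands is drawn with its \<open>t\<close>-th letter in the slab between levels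
  \<open>t\<close> and \<open>t + 1\<close>, all strands being oriented from level 0 to level \<open>length w\<close>; the point \<open>(t, p)\<close>
  is strand position \<open>p\<close> at level \<open>t\<close>. The closing arcs run around the core from
  level \<open>length w\<close> back to level 0. A complete resolution is given by its set \<open>R\<close>
  of 1-resolved crossings.\<close>

type_synonym point = "nat \<times> nat"

definition n_pos :: "braid_word \<Rightarrow> nat" where
  "n_pos w = length (filter snd w)"

definition n_neg :: "braid_word \<Rightarrow> nat" where
  "n_neg w = length (filter (\<lambda>x. \<not> snd x) w)"

definition resolutions :: "braid_word \<Rightarrow> nat set set" where
  "resolutions w = Pow {..<length w}"

text \<open>The orientation-respecting resolution of a crossing is the 0-resolution if the crossing is
  positive and the 1-resolution if it is negative.\<close>

definition oriented_at :: "braid_word \<Rightarrow> nat set \<Rightarrow> nat \<Rightarrow> bool" where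
  "oriented_at w R t \<longleftrightarrow> (if snd (w ! t) then t \<notin> R else t \<in> R)"

inductive_set arcs :: "nat \<Rightarrow> braid_word \<Rightarrow> nat set \<Rightarrow> (point \<times> point) set"
  for m :: nat and w :: braid_word and R :: "nat set" where
  closing: "p < m \<Longrightarrow> ((length w, p), (0, p)) \<in> arcs m w R"
| strand: "t < length w \<Longrightarrow> p < m \<Longrightarrow> p \<noteq> fst (w ! t) \<Longrightarrow> p \<noteq> Suc (fst (w ! t)) \<Longrightarrow>
    ((t, p), (Suc t, p)) \<in> arcs m w R"
| oriented_left: "t < length w \<Longrightarrow> oriented_at w R t \<Longrightarrow>
    ((t, fst (w ! t)), (Suc t, fst (w ! t))) \<in> arcs m w R"
| oriented_right: "t < length w \<Longrightarrow> oriented_at w R t \<Longrightarrow>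
    ((t, Suc (fst (w ! t))), (Suc t, Suc (fst (w ! t)))) \<in> arcs m w R"
| cap: "t < length w \<Longrightarrow> \<not> oriented_at w R t \<Longrightarrow>
    ((t, fst (w ! t)), (t, Suc (fst (w ! t)))) \<in> arcs m w R"
| cup: "t < length w \<Longrightarrow> \<not> oriented_at w R t \<Longrightarrow>
    ((Suc t, fst (w ! t)), (Suc t, Suc (fst (w ! t)))) \<in> arcs m w R"

text \<open>A circle of a resolution is represented by the set of points that it passes through.\<close>

definition circles :: "nat \<Rightarrow> braid_word \<Rightarrow> nat set \<Rightarrow> point set set" where
  "circles m w R = ({..length w} \<times> {..<m}) // (arcs m w R \<union> (arcs m w R)\<inverse>)\<^sup>*"

text \<open>The closing arcs are the only arcs that meet a radial cut of the annulus, and each meets it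
  once. So a circle \<open>C\<close> meets the cut as often as it has points at level 0. Since an embedded
  circle represents 0 or a generator in the first homology of the annulus, it is
  homologically nontrivial iff this number is odd.\<close>

definition nontrivial :: "point set \<Rightarrow> bool" where
  "nontrivial C \<longleftrightarrow> odd (card {p. (0, p) \<in> C})"


section \<open>The annular Khovanov complex\<close>

datatype label = Vplus | Vminus

type_synonym generator = "nat set \<times> (point set \<Rightarrow> label)"

definition generators :: "nat \<Rightarrow> braid_word \<Rightarrow> generator set" where
  "generators m w = (SIGMA R : resolutions w. circles m w R \<rightarrow>\<^sub>E UNIV)"

definition hom_deg :: "braid_word \<Rightarrow> generator \<Rightarrow> int" where
  "hom_deg w = (\<lambda>(R, l). int (card R) - int (n_neg w))"

definition q_deg :: "nat \<Rightarrow> braid_word \<Rightarrow> generator \<Rightarrow> int" where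
  "q_deg m w = (\<lambda>(R, l).
     int (card {C \<in> circles m w R. l C = Vplus}) - int (card {C \<in> circles m w R. l C = Vminus})
     + int (card R) + int (n_pos w) - 2 * int (n_neg w))"

definition wind_deg :: "nat \<Rightarrow> braid_word \<Rightarrow> generator \<Rightarrow> int" where
  "wind_deg m w = (\<lambda>(R, l).
     int (card {C \<in> circles m w R. nontrivial C \<and> l C = Vplus})
     - int (card {C \<in> circles m w R. nontrivial C \<and> l C = Vminus}))"

text \<open>All coefficients being in \<open>\<F>\<^sub>2\<close>, the value of the merge (split) map on a basis element is given
  as the set of basis elements that occur in it.\<close>

fun merge_map :: "label \<Rightarrow> label \<Rightarrow> label set" where
  "merge_map Vplus Vplus = {Vplus}"
| "merge_map Vplus Vminus = {Vminus}"
| "merge_map Vminus Vplus = {Vminus}"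
| "merge_map Vminus Vminus = {}"

fun split_map :: "label \<Rightarrow> (label \<times> label) set" where
  "split_map Vplus = {(Vplus, Vminus), (Vminus, Vplus)}"
| "split_map Vminus = {(Vminus, Vminus)}"

text \<open>\<open>kh_term m w g h\<close>: the generator \<open>h\<close> occurs in the Khovanov differential of \<open>g\<close>. Circles that do
  not meet the crossing whose resolution changes have the same points before and after.\<close>

definition kh_term :: "nat \<Rightarrow> braid_word \<Rightarrow> generator \<Rightarrow> generator \<Rightarrow> bool" where
  "kh_term m w = (\<lambda>(R, l) (R', l').
     (\<exists>t < length w. t \<notin> R \<and> R' = insert t R) \<and>
     (\<forall>C \<in> circles m w R \<inter> circles m w R'. l' C = l C) \<and>
     ((\<exists>C\<^sub>1 C\<^sub>2 C. C\<^sub>1 \<noteq> C\<^sub>2 \<and> circles m w R - circles m w R' = {C\<^sub>1, C\<^sub>2} \<and>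
         circles m w R' - circles m w R = {C} \<and> l' C \<in> merge_map (l C\<^sub>1) (l C\<^sub>2)) \<or>
      (\<exists>C C\<^sub>1 C\<^sub>2. C\<^sub>1 \<noteq> C\<^sub>2 \<and> circles m w R - circles m w R' = {C} \<and>
         circles m w R' - circles m w R = {C\<^sub>1, C\<^sub>2} \<and> (l' C\<^sub>1, l' C\<^sub>2) \<in> split_map (l C))))"

text \<open>A chain assigns to each generator its coefficient in \<open>\<F>\<^sub>2\<close>.\<close>

type_synonym chain = "generator \<Rightarrow> bit"

definition annular_diff :: "nat \<Rightarrow> braid_word \<Rightarrow> chain \<Rightarrow> chain" where
  "annular_diff m w c = (\<lambda>h. if h \<in> generators m w
     then (\<Sum>g | g \<in> generators m w \<and> kh_term m w g h \<and> wind_deg m w g = wind_deg m w h. c g)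
     else 0)"

definition chain_space :: "nat \<Rightarrow> braid_word \<Rightarrow> int \<Rightarrow> int \<Rightarrow> int \<Rightarrow> (bit, chain) module" where
  "chain_space m w i j k = \<lparr>
     carrier = {c. \<forall>g. c g \<noteq> 0 \<longrightarrow>
       g \<in> generators m w \<and> hom_deg w g = i \<and> q_deg m w g = j \<and> wind_deg m w g = k},
     mult = undefined, one = undefined,
     zero = (\<lambda>g. 0), add = (\<lambda>c d g. c g + d g), smult = (\<lambda>a c g. a * c g)\<rparr>"


section \<open>Sutured annular Khovanov homology\<close>

definition quotient_space :: "('a, 'v) module \<Rightarrow> 'v set \<Rightarrow> ('a, 'v set) module" where
  "quotient_space V W = \<lparr>
     carrier = a_rcosets\<^bsub>V\<^esub> W,
     mult = undefined, one = undefined,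
     zero = W, add = set_add V, smult = (\<lambda>a X. \<Union>x\<in>X. W +>\<^bsub>V\<^esub> (a \<odot>\<^bsub>V\<^esub> x))\<rparr>"

definition cycles :: "nat \<Rightarrow> braid_word \<Rightarrow> int \<Rightarrow> int \<Rightarrow> int \<Rightarrow> chain set" where
  "cycles m w i j k = {c \<in> carrier (chain_space m w i j k). annular_diff m w c = (\<lambda>g. 0)}"

definition boundaries :: "nat \<Rightarrow> braid_word \<Rightarrow> int \<Rightarrow> int \<Rightarrow> int \<Rightarrow> chain set" where
  "boundaries m w i j k = annular_diff m w ` carrier (chain_space m w (i - 1) j k)"

definition SKh :: "nat \<Rightarrow> braid_word \<Rightarrow> int \<Rightarrow> int \<Rightarrow> int \<Rightarrow> (bit, chain set) module" where
  "SKh m w i j k =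
     quotient_space ((chain_space m w i j k)\<lparr>carrier := cycles m w i j k\<rparr>) (boundaries m w i j k)"

definition rk_SKh :: "nat \<Rightarrow> braid_word \<Rightarrow> int \<Rightarrow> int \<Rightarrow> int \<Rightarrow> nat" where
  "rk_SKh m w i j k = vectorspace.dim class_ring (SKh m w i j k)"


section \<open>Laurent polynomials\<close>

text \<open>\<open>int \<Rightarrow>\<^sub>0 int\<close> with its convolution product is the ring of Laurent polynomials with integer
  coefficients in one variable \<open>y\<close>, the exponents of \<open>y\<close> being the keys.\<close>

definition y_power :: "int \<Rightarrow> (int \<Rightarrow>\<^sub>0 int)" where
  "y_power j = Poly_Mapping.single j 1"

text \<open>The index set of the sum is finite: only bidegrees of generators occur.\<close>

definition q_poly :: "nat \<Rightarrow> braid_word \<Rightarrow> int \<Rightarrow> (int \<Rightarrow>\<^sub>0 int)" where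
  "q_poly m w k = (\<Sum>(i, j) | rk_SKh m w i j k \<noteq> 0.
     (-1) ^ nat \<bar>i\<bar> * y_power j * of_nat (rk_SKh m w i j k))"

end

theory Submission
  imports Defs "HOL-Combinatorics.Orbits" "HOL-Library.Function_Algebras"
begin

text \<open>Since the bidegree \<open>(i, j)\<close> enters with the sign \<open>(-1)\<^sup>i\<close>, \<open>q\<^bsub>L,k\<^esub>\<close> is the graded
Euler characteristic of the complex in winding number grading \<open>k\<close>, so homology can be replaced by
chains: \<open>q\<^bsub>L,k\<^esub>\<close> is the signed sum of \<open>y\<^sup>j\<close> over the generators of grading \<open>k\<close>
(\<open>q_poly_state_sum\<close>). What this costs is a proof that the annular differential squares to zero
(\<open>annular_diff_squared\<close>).

On \<open>m = n + 1\<close> strands the grading \<open>m - 2\<close> is next to the top, and this is very restrictive. A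
resolution all of whose crossings respect the orientation consists of \<open>m\<close> nontrivial circles, one of
which is labelled minus. In any other resolution some level meets a circle twice, so by parity at most
\<open>m - 2\<close> circles are nontrivial; generators exist only if there are exactly \<open>m - 2\<close> of them, they are
all labelled plus, and every trivial circle contributes a factor \<open>y + y\<^bsup>-1\<^esup>\<close>. Reading
the crossings that are not resolved along the orientation cyclically as a word in the generators of the
Temperley-Lieb algebra, this happens exactly if neighbouring letters differ by at most one, and the
trivial circles correspond to the places where a letter is repeated (\<open>few_nontrivial\<close>,
\<open>card_nontrivial\<close>, \<open>card_trivial\<close>). The same number is the trace of the word in the
\<open>m\<close>-dimensional representation where the generators are the rank one operators \<open>cup_cap\<close>, because
the trace of a product of rank one operators is the cyclic product of the pairings of neighbours
(\<open>op_trace_cup_caps\<close>).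

Summing over all resolutions gives \<open>q\<^bsub>L,m-2\<^esub> = y\<^bsup>m-2\<^esup> tr \<rho>(w)\<close>, where \<open>L\<close> is
the closure of the braid word \<open>w\<close> and \<open>\<rho>\<close> is a form of the Burau representation
(\<open>q_poly_burau\<close>). In particular the value depends only on the braid (\<open>burau_equiv\<close>).
With \<open>M = \<rho>(u)\<close> for a word \<open>u\<close> of \<open>\<sigma>\<close>, the two sides of the theorem differ by
\<open>y\<^bsup>2(m-2)\<^esup> (tr M\<^sup>2 - (tr M)\<^sup>2)\<close>, and the trace of a square is congruent to the square
of the trace modulo 2, since the off-diagonal terms on both sides come in equal pairs
(\<open>op_trace_square\<close>).\<close>

section \<open>Circles as orbits of a permutation\<close>

text \<open>Multiplying a permutation by a transposition of two points of one cycle splits this cycle between them,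
and otherwise joins their two cycles. Both halves follow by tracing the orbit that starts at one of
the two points until it meets the other.\<close>
lemma orbit_transpose_iff:
  assumes f: "permutation f" and g_def: "g = f \<circ> transpose a b" and "a \<noteq> b"
  shows "b \<in> orbit g a \<longleftrightarrow> b \<notin> orbit f a"
proof -
  have g: "permutation g"
    unfolding g_def using f by (intro permutation_compose permutation_swap_id)
  have g_simps: "g a = f b" "g b = f a" "\<And>y. y \<noteq> a \<Longrightarrow> y \<noteq> b \<Longrightarrow> g y = f y"
    by (auto simp: g_def transpose_def)
  have "b \<in> orbit g a" if "b \<notin> orbit f a"
  proof (rule ccontr)
    assume not: "b \<notin> orbit g a"
    have "a \<notin> orbit f b"
      using that f by (meson orbit_swap permutation_self_in_orbit)
    have "y \<in> orbit g a" if "y \<in> orbit f b" for y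
      using that
    proof induction
      case base
      then show ?case using orbit.base[of g a] by (simp only: g_simps)
    next
      case (step y)
      then have "y \<noteq> a" "y \<noteq> b" using \<open>a \<notin> orbit f b\<close> not by auto
      then show ?case using orbit.step[OF step.IH] by (simp add: g_simps)
    qed
    with not show False using permutation_self_in_orbit[OF f] by blast
  qed
  moreover have "b \<notin> orbit g a" if b: "b \<in> orbit f a"
  proof -
    define k where "k = (LEAST k. 0 < k \<and> (f ^^ k) a = b)"
    from b have ex: "\<exists>k. 0 < k \<and> (f ^^ k) a = b" unfolding orbit_altdef by auto
    then have k: "0 < k" "(f ^^ k) a = b" unfolding k_def by (metis (mono_tags, lifting) LeastI)+
    have least: "(f ^^ j) a \<noteq> b" if "0 < j" "j < k" for j
      using that not_less_Least unfolding k_def by blast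
    have nota: "(f ^^ j) a \<noteq> a" if "0 < j" "j < k" for j
    proof
      assume "(f ^^ j) a = a"
      moreover have "(f ^^ (k - j)) ((f ^^ j) a) = (f ^^ k) a"
        using that by (metis add.commute funpow_add le_add_diff_inverse less_imp_le o_apply)
      ultimately have "(f ^^ (k - j)) a = b" using k by simp
      then show False using least[of "k - j"] that by simp
    qed
    \<comment> \<open>The part of the cycle from \<open>f a\<close> to \<open>b\<close> is closed under \<open>g\<close>, as \<open>g b = f a\<close>.\<close>
    define S where "S = {(f ^^ j) a | j. 0 < j \<and> j \<le> k}"
    have S: "(f ^^ j) a \<in> S" if "0 < j" "j \<le> k" for j using that unfolding S_def by auto
    have "y \<in> S" if "y \<in> orbit g b" for y
      using that
    proof induction
      case base
      then show ?case using S[of 1] k by (simp add: g_simps)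
    next
      case (step y)
      then obtain j where j: "0 < j" "j \<le> k" "y = (f ^^ j) a" unfolding S_def by auto
      show ?case
      proof (cases "j = k")
        case True
        then show ?thesis using j k S[of 1] by (simp add: g_simps)
      next
        case False
        then have "g y = (f ^^ Suc j) a"
          using j least[of j] nota[of j] g_simps(3)[of y] by simp
        then show ?thesis using False j S[of "Suc j"] by simp
      qed
    qed
    moreover have "a \<notin> S"
      using nota k \<open>a \<noteq> b\<close> unfolding S_def by (auto simp: le_less) metis
    ultimately have "a \<notin> orbit g b" by blast
    then show ?thesis
      using g by (meson orbit_swap permutation_self_in_orbit)
  qed
  ultimately show ?thesis by blast
qed

text \<open>Two orbit relations that differ by a transposition become equal when the two points are identified.
So the coarser one is obtained from the finer one by this identification.\<close>
lemma orbit_transpose_join: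
  assumes f: "permutation f" and g_def: "g = f \<circ> transpose a b" and b: "b \<in> orbit g a"
  shows "y \<in> orbit g x \<longleftrightarrow>
    y \<in> orbit f x \<or> a \<in> orbit f x \<and> y \<in> orbit f b \<or> b \<in> orbit f x \<and> y \<in> orbit f a"
proof -
  have g: "permutation g"
    unfolding g_def using f by (intro permutation_compose permutation_swap_id)
  have g_simps: "g a = f b" "g b = f a" "\<And>y. y \<noteq> a \<Longrightarrow> y \<noteq> b \<Longrightarrow> g y = f y"
    by (auto simp: g_def transpose_def)
  have self: "z \<in> orbit f z" "z \<in> orbit g z" for z
    using f g by (auto intro: permutation_self_in_orbit)
  have ba: "a \<in> orbit g b"
    using b self by (meson orbit_swap)
  let ?K = "\<lambda>y. y \<in> orbit f x \<or> a \<in> orbit f x \<and> y \<in> orbit f b \<or> b \<in> orbit f x \<and> y \<in> orbit f a"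
  have Kstep: "?K (g z)" if "?K z" for z
  proof -
    consider "z = a" | "z = b" | "z \<noteq> a" "z \<noteq> b" by blast
    then show ?thesis
    proof cases
      case 1
      then have "a \<in> orbit f x \<or> b \<in> orbit f x" using that by auto
      then show ?thesis unfolding 1 g_simps by (auto intro: orbit.intros)
    next
      case 2
      then have "a \<in> orbit f x \<or> b \<in> orbit f x" using that by auto
      then show ?thesis unfolding 2 g_simps by (auto intro: orbit.intros)
    next
      case 3
      then show ?thesis using that unfolding g_simps(3)[OF 3] by (auto intro: orbit.step)
    qed
  qed
  have "?K y" if "y \<in> orbit g x"
    using that
  proof induction
    case base
    show ?case using Kstep[of x] self by blast
  next
    case (step y)
    then show ?case by (intro Kstep)
  qed
  moreover have sub: "orbit f z \<subseteq> orbit g z" for z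
  proof
    fix y assume "y \<in> orbit f z"
    have gstep: "f y \<in> orbit g z" if "y \<in> orbit g z" for y
    proof -
      consider "y = a" | "y = b" | "y \<noteq> a" "y \<noteq> b" by blast
      then show ?thesis
      proof cases
        case 1
        then have "b \<in> orbit g z" using that b by (meson orbit_trans)
        then show ?thesis using orbit.step[of b g z] 1 by (simp only: g_simps)
      next
        case 2
        then have "a \<in> orbit g z" using that ba by (meson orbit_trans)
        then show ?thesis using orbit.step[of a g z] 2 by (simp only: g_simps)
      next
        case 3
        then show ?thesis using orbit.step[OF that] 3 by (simp add: g_simps)
      qed
    qed
    from \<open>y \<in> orbit f z\<close> show "y \<in> orbit g z"
      by induction (use gstep self in auto)
  qed
  ultimately show ?thesis
    using b ba by (meson orbit_trans subsetD)
qed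

text \<open>Every resolution has a coherent orientation: go up at even positions and down at odd ones. Arcs that
pass a crossing keep position and direction, and arcs that turn change both the direction and the
parity of the position. Hence the circles are the cycles of a permutation of the points, the one
that sends a point to the next one in this orientation.\<close>
definition turns :: "braid_word \<Rightarrow> nat set \<Rightarrow> nat \<Rightarrow> nat \<Rightarrow> bool" where
  "turns w R t p \<longleftrightarrow> \<not> oriented_at w R t \<and> (p = fst (w ! t) \<or> p = Suc (fst (w ! t)))"

definition turn :: "braid_word \<Rightarrow> nat \<Rightarrow> nat \<Rightarrow> nat" where
  "turn w t p = (if p = fst (w ! t) then Suc (fst (w ! t)) else fst (w ! t))"

definition step_point :: "braid_word \<Rightarrow> nat set \<Rightarrow> bool \<Rightarrow> point \<Rightarrow> point" where
  "step_point w R up = (\<lambda>(t, p).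
     if up then
       (if t = length w then (0, p) else if turns w R t p then (t, turn w t p) else (Suc t, p))
     else
       (case t of 0 \<Rightarrow> (length w, p) | Suc s \<Rightarrow> if turns w R s p then (t, turn w s p) else (s, p)))"

definition points :: "nat \<Rightarrow> braid_word \<Rightarrow> point set" where
  "points m w = {..length w} \<times> {..<m}"

definition next_point :: "nat \<Rightarrow> braid_word \<Rightarrow> nat set \<Rightarrow> point \<Rightarrow> point" where
  "next_point m w R x = (if x \<in> points m w then step_point w R (even (snd x)) x else x)"

text \<open>At each crossing the orientation just described enters through two of the four end points, one of
them below and one above the crossing. They are the points whose successors depend on the resolution
of the crossing.\<close>
definition in_low :: "braid_word \<Rightarrow> nat \<Rightarrow> point" where
  "in_low w t = (t, if even (fst (w ! t)) then fst (w ! t) else Suc (fst (w ! t)))"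

definition in_high :: "braid_word \<Rightarrow> nat \<Rightarrow> point" where
  "in_high w t = (Suc t, if even (fst (w ! t)) then Suc (fst (w ! t)) else fst (w ! t))"

definition conn :: "nat \<Rightarrow> braid_word \<Rightarrow> nat set \<Rightarrow> (point \<times> point) set" where
  "conn m w R = (arcs m w R \<union> (arcs m w R)\<inverse>)\<^sup>*"

lemma braid_words_nth:
  assumes "w \<in> braid_words m" "t < length w"
  shows "Suc (fst (w ! t)) < m"
  using assms nth_mem[of t w] unfolding braid_words_def by (cases "w ! t") force

lemma step_point_in_points:
  assumes "w \<in> braid_words m" "x \<in> points m w"
  shows "step_point w R up x \<in> points m w"
proof -
  obtain t p where x: "x = (t, p)" "t \<le> length w" "p < m"
    using assms(2) unfolding points_def by auto
  have "turn w s p < m" if "s < length w" for s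
    using braid_words_nth[OF assms(1) that] by (simp add: turn_def)
  then show ?thesis
    using x by (cases t) (auto simp: step_point_def points_def Suc_le_eq le_neq_implies_less)
qed

lemma turns_turn:
  assumes "turns w R t p"
  shows "turns w R t (turn w t p)" "turn w t (turn w t p) = p" "even (turn w t p) \<longleftrightarrow> odd p"
  using assms by (auto simp: turns_def turn_def)

text \<open>Reversing the convention for the directions reverses the orientation of all circles, hence inverts
the successor map. The flag \<open>c\<close> selects one of the two conventions.\<close>
lemma step_point_step_point:
  assumes "x \<in> points m w" and y: "y = step_point w R (even (snd x) = c) x"
  shows "step_point w R (even (snd y) \<noteq> c) y = x"
proof -
  obtain t p where x: "x = (t, p)" "t \<le> length w" "p < m"
    using assms(1) unfolding points_def by auto
  show ?thesis
  proof (cases "even p = c")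
    case up: True
    show ?thesis
    proof (cases "t = length w")
      case True
      then show ?thesis using up y x by (simp add: step_point_def)
    next
      case False
      then show ?thesis
        using up y x turns_turn[of w R t p] by (cases "turns w R t p") (auto simp: step_point_def)
    qed
  next
    case down: False
    show ?thesis
    proof (cases t)
      case 0
      then show ?thesis using down y x by (simp add: step_point_def)
    next
      case (Suc s)
      then show ?thesis
        using down y x turns_turn[of w R s p] by (cases "turns w R s p") (auto simp: step_point_def)
    qed
  qed
qed

lemma next_point_permutes:
  assumes w: "w \<in> braid_words m"
  shows "next_point m w R permutes points m w"
proof (rule bij_imp_permutes)
  show "bij_betw (next_point m w R) (points m w) (points m w)"
  proof (rule bij_betw_byWitness[where f' = "\<lambda>y. step_point w R (odd (snd y)) y"])
    show "\<forall>x\<in>points m w. step_point w R (odd (snd (next_point m w R x))) (next_point m w R x) = x"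
      using step_point_step_point[of _ m w _ R True] by (simp add: next_point_def)
    show "\<forall>y\<in>points m w. next_point m w R (step_point w R (odd (snd y)) y) = y"
      using step_point_step_point[of _ m w _ R False] step_point_in_points[OF w]
      by (simp add: next_point_def)
  qed (use step_point_in_points[OF w] in \<open>auto simp: next_point_def\<close>)
qed (simp add: next_point_def)

lemma next_point_permutation:
  "w \<in> braid_words m \<Longrightarrow> permutation (next_point m w R)"
  using next_point_permutes[of w m R] by (auto simp: permutation_permutes points_def)

lemma step_point_arc:
  assumes "x \<in> points m w"
  shows "(x, step_point w R up x) \<in> arcs m w R \<union> (arcs m w R)\<inverse>"
proof -
  obtain t p where x: "x = (t, p)" "t \<le> length w" "p < m"
    using assms unfolding points_def by auto
  have slab: "((s, p), (Suc s, p)) \<in> arcs m w R" if "s < length w" "\<not> turns w R s p" for s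
    using that arcs.strand[of s w p m R] arcs.oriented_left[of s w R m] arcs.oriented_right[of s w R m] x(3)
    unfolding turns_def by blast
  have cap: "((s, p), (s, turn w s p)) \<in> arcs m w R \<union> (arcs m w R)\<inverse>"
    and cup: "((Suc s, p), (Suc s, turn w s p)) \<in> arcs m w R \<union> (arcs m w R)\<inverse>"
    if "s < length w" "turns w R s p" for s
    using that arcs.cap[of s w R m] arcs.cup[of s w R m] unfolding turns_def turn_def by auto
  show ?thesis
    using x arcs.closing[of p m w R] slab cap cup
    by (cases t) (auto simp: step_point_def)
qed

lemma next_point_arc:
  assumes "x \<in> points m w"
  shows "(x, next_point m w R x) \<in> arcs m w R \<union> (arcs m w R)\<inverse>"
  using step_point_arc[OF assms] assms by (simp add: next_point_def)

lemma arc_step_point: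
  assumes w: "w \<in> braid_words m" and "(x, y) \<in> arcs m w R"
  shows "x \<in> points m w \<and> (\<exists>up. y = step_point w R up x)"
proof -
  note nth = braid_words_nth[OF w]
  obtain t p s q where xy: "x = (t, p)" "y = (s, q)" by (cases x; cases y)
  from assms(2) show ?thesis
    unfolding xy
  proof cases
    case (cup u)
    then have "y = step_point w R False x"
      by (auto simp: xy step_point_def turns_def turn_def)
    moreover have "x \<in> points m w" using cup nth[of u] by (auto simp: xy points_def)
    ultimately show "(t, p) \<in> points m w \<and> (\<exists>up. (s, q) = step_point w R up (t, p))"
      unfolding xy by blast
  qed (use nth in \<open>force simp: step_point_def points_def turns_def turn_def intro: exI[of _ True]\<close>)+
qed

lemma arc_next_point:
  assumes w: "w \<in> braid_words m" and "(x, y) \<in> arcs m w R"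
  shows "y = next_point m w R x \<or> x = next_point m w R y"
proof -
  obtain up where x: "x \<in> points m w" and y: "y = step_point w R up x"
    using arc_step_point[OF assms] by blast
  show ?thesis
  proof (cases "up = even (snd x)")
    case True
    then show ?thesis using x y by (simp add: next_point_def)
  next
    case False
    then have "step_point w R (even (snd y)) y = x"
      using step_point_step_point[OF x, of y R False] y by simp
    then show ?thesis
      using step_point_in_points[OF w x, of R up] y by (simp add: next_point_def)
  qed
qed

lemma conn_iff_orbit:
  assumes w: "w \<in> braid_words m"
  shows "(x, y) \<in> conn m w R \<longleftrightarrow> y \<in> orbit (next_point m w R) x"
proof
  let ?f = "next_point m w R"
  note perm = next_point_permutation[OF w, of R]
  have self: "z \<in> orbit ?f z" for z by (rule permutation_self_in_orbit[OF perm])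
  assume "(x, y) \<in> conn m w R"
  then show "y \<in> orbit ?f x"
    unfolding conn_def
  proof (induction rule: rtrancl_induct)
    case base
    show ?case by (rule self)
  next
    case (step y z)
    then have "z = ?f y \<or> y = ?f z"
      using arc_next_point[OF w, of y z R] arc_next_point[OF w, of z y R] by blast
    then show ?case
    proof
      assume "z = ?f y"
      then show ?thesis using step.IH by (auto intro: orbit.step)
    next
      assume "y = ?f z"
      then have "z \<in> orbit ?f y" using self orbit.base by (metis orbit_swap)
      then show ?thesis using step.IH by (rule orbit_trans)
    qed
  qed
next
  let ?f = "next_point m w R"
  have step: "(z, ?f z) \<in> conn m w R" for z
  proof (cases "z \<in> points m w")
    case True
    then show ?thesis using next_point_arc[of z m w R] unfolding conn_def by blast
  next
    case False
    then have "?f z = z" using permutes_not_in[OF next_point_permutes[OF w]] by blast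
    then show ?thesis by (simp add: conn_def)
  qed
  assume "y \<in> orbit ?f x"
  then show "(x, y) \<in> conn m w R"
  proof induction
    case base
    show ?case by (rule step)
  next
    case (step y)
    then show ?case using \<open>\<And>z. (z, ?f z) \<in> conn m w R\<close> unfolding conn_def
      by (meson rtrancl_trans)
  qed
qed

lemma oriented_at_insert:
  "t \<notin> R \<Longrightarrow> oriented_at w (insert t R) s \<longleftrightarrow> (if s = t then \<not> oriented_at w R s else oriented_at w R s)"
  by (auto simp: oriented_at_def)

text \<open>Changing the resolution of a crossing exchanges the successors of the two points that enter it.\<close>
lemma next_point_insert:
  assumes w: "w \<in> braid_words m" and t: "t < length w" "t \<notin> R"
  shows "next_point m w (insert t R) = next_point m w R \<circ> transpose (in_low w t) (in_high w t)"
proof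
  fix x :: point
  define i where "i = fst (w ! t)"
  obtain s p where x: "x = (s, p)" by (cases x)
  have i: "Suc i < m" using braid_words_nth[OF w t(1)] by (simp add: i_def)
  have turns: "turns w (insert t R) u q \<longleftrightarrow>
      (if u = t then oriented_at w R t \<and> (q = i \<or> q = Suc i) else turns w R u q)" for u q
    by (simp add: turns_def oriented_at_insert[OF t(2)] i_def)
  have turns_t: "turns w R t q \<longleftrightarrow> \<not> oriented_at w R t \<and> (q = i \<or> q = Suc i)" for q
    by (simp add: turns_def i_def)
  have turn: "turn w t i = Suc i" "turn w t (Suc i) = i" by (simp_all add: turn_def i_def)
  consider (low) "x = in_low w t" | (high) "x = in_high w t"
    | (other) "x \<noteq> in_low w t" "x \<noteq> in_high w t" by blast
  then show "next_point m w (insert t R) x = (next_point m w R \<circ> transpose (in_low w t) (in_high w t)) x"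
  proof cases
    case low
    then show ?thesis
      using t i by (auto simp: next_point_def step_point_def points_def in_low_def in_high_def
          turns turns_t turn simp flip: i_def)
  next
    case high
    then show ?thesis
      using t i by (auto simp: next_point_def step_point_def points_def in_low_def in_high_def
          turns turns_t turn simp flip: i_def)
  next
    case other
    then have "step_point w (insert t R) (even p) x = step_point w R (even p) x"
      unfolding x by (cases s)
        (auto simp: step_point_def in_low_def in_high_def turns_def oriented_at_insert[OF t(2)] split: if_splits,
          metis even_Suc)
    then show ?thesis using other by (simp add: next_point_def x)
  qed
qed

lemma in_ends_points:
  assumes "w \<in> braid_words m" "t < length w"
  shows "in_low w t \<in> points m w" "in_high w t \<in> points m w"
  using braid_words_nth[OF assms] assms(2) by (auto simp: in_low_def in_high_def points_def)

text \<open>So every change of resolution either merges two circles or splits one, depending on whether the two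
entering points are connected before. A circle is never turned into a single circle.\<close>
lemma conn_insert_iff:
  assumes w: "w \<in> braid_words m" and t: "t < length w" "t \<notin> R"
  shows "(in_low w t, in_high w t) \<in> conn m w (insert t R) \<longleftrightarrow>
    (in_low w t, in_high w t) \<notin> conn m w R"
  unfolding conn_iff_orbit[OF w] next_point_insert[OF w t]
  by (rule orbit_transpose_iff[OF next_point_permutation[OF w] HOL.refl]) (simp add: in_low_def in_high_def)

lemma conn_merge:
  assumes w: "w \<in> braid_words m" and t: "t < length w" "t \<notin> R"
    and "(in_low w t, in_high w t) \<notin> conn m w R"
  shows "(x, y) \<in> conn m w (insert t R) \<longleftrightarrow> (x, y) \<in> conn m w R
    \<or> (x, in_low w t) \<in> conn m w R \<and> (in_high w t, y) \<in> conn m w R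
    \<or> (x, in_high w t) \<in> conn m w R \<and> (in_low w t, y) \<in> conn m w R"
  using assms(4) orbit_transpose_join[OF next_point_permutation[OF w, of R] HOL.refl, of "in_high w t" "in_low w t" y x]
  unfolding conn_insert_iff[OF w t, symmetric]
  unfolding conn_iff_orbit[OF w] next_point_insert[OF w t]
  by blast

lemma conn_split:
  assumes w: "w \<in> braid_words m" and t: "t < length w" "t \<notin> R"
    and "(in_low w t, in_high w t) \<in> conn m w R"
  shows "(x, y) \<in> conn m w R \<longleftrightarrow> (x, y) \<in> conn m w (insert t R)
    \<or> (x, in_low w t) \<in> conn m w (insert t R) \<and> (in_high w t, y) \<in> conn m w (insert t R)
    \<or> (x, in_high w t) \<in> conn m w (insert t R) \<and> (in_low w t, y) \<in> conn m w (insert t R)"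
proof -
  have inv: "next_point m w R
      = next_point m w (insert t R) \<circ> transpose (in_low w t) (in_high w t)"
    unfolding next_point_insert[OF w t] by (simp add: comp_assoc)
  show ?thesis
    using assms(4) orbit_transpose_join[OF next_point_permutation[OF w, of "insert t R"] HOL.refl,
        of "in_high w t" "in_low w t" y x]
    unfolding conn_iff_orbit[OF w] inv[symmetric] by blast
qed

section \<open>Merging and splitting circles\<close>

text \<open>When the classes of \<open>a\<close> and \<open>b\<close> are joined, the classes in \<open>K\<close> are those that do not change.\<close>
lemma quotient_join:
  assumes E: "equiv UNIV E" and "a \<in> P" "b \<in> P" "(a, b) \<notin> E"
    and F: "\<And>x y. (x, y) \<in> F \<longleftrightarrow> (x, y) \<in> E \<or> (x, a) \<in> E \<and> (b, y) \<in> E \<or> (x, b) \<in> E \<and> (a, y) \<in> E"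
  obtains K where "P // E = {E `` {a}, E `` {b}} \<union> K" "P // F = {E `` {a} \<union> E `` {b}} \<union> K"
    "\<forall>D\<in>K. D \<noteq> {} \<and> D \<inter> (E `` {a} \<union> E `` {b}) = {}"
    "E `` {a} \<inter> E `` {b} = {}" "a \<in> E `` {a}" "b \<in> E `` {b}"
proof
  let ?A = "E `` {a}" and ?B = "E `` {b}"
  let ?K = "{E `` {x} | x. x \<in> P \<and> (x, a) \<notin> E \<and> (x, b) \<notin> E}"
  have refl: "(x, x) \<in> E" for x
    using E by (auto simp: equiv_def refl_on_def)
  have sym: "(x, y) \<in> E \<Longrightarrow> (y, x) \<in> E" for x y
    using E by (meson equivE symD)
  have trans: "(x, y) \<in> E \<Longrightarrow> (y, z) \<in> E \<Longrightarrow> (x, z) \<in> E" for x y z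
    using E by (meson equivE transD)
  have class_eq: "E `` {x} = E `` {y}" if "(x, y) \<in> E" for x y
    using that sym trans by blast
  show "P // E = {?A, ?B} \<union> ?K"
  proof (intro equalityI subsetI)
    fix C assume "C \<in> P // E"
    then obtain x where "x \<in> P" "C = E `` {x}" by (auto elim: quotientE)
    then show "C \<in> {?A, ?B} \<union> ?K"
      using class_eq[of x a] class_eq[of x b] by (cases "(x, a) \<in> E"; cases "(x, b) \<in> E") auto
  next
    fix C assume "C \<in> {?A, ?B} \<union> ?K"
    then consider "C = ?A" | "C = ?B" | x where "x \<in> P" "C = E `` {x}" by blast
    then show "C \<in> P // E" using assms(2,3) by cases (simp_all add: quotientI)
  qed
  have classF: "F `` {x} = (if (x, a) \<in> E \<or> (x, b) \<in> E then ?A \<union> ?B else E `` {x})" for x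
  proof (cases "(x, a) \<in> E \<or> (x, b) \<in> E")
    case True
    then have "E `` {x} \<subseteq> ?A \<union> ?B" using class_eq[of x a] class_eq[of x b] by blast
    then show ?thesis using True class_eq[of x a] class_eq[of x b] by (auto simp: F)
  next
    case False
    then show ?thesis by (auto simp: F)
  qed
  show "P // F = {?A \<union> ?B} \<union> ?K"
  proof (intro equalityI subsetI)
    fix C assume "C \<in> P // F"
    then obtain x where "x \<in> P" "C = F `` {x}" by (auto elim: quotientE)
    then show "C \<in> {?A \<union> ?B} \<union> ?K" using classF[of x] by auto
  next
    fix C assume "C \<in> {?A \<union> ?B} \<union> ?K"
    then consider "C = ?A \<union> ?B" | x where "x \<in> P" "(x, a) \<notin> E" "(x, b) \<notin> E" "C = E `` {x}" by blast
    then show "C \<in> P // F"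
    proof cases
      case 1
      then show ?thesis using assms(2) classF[of a] refl quotientI[of a P F] by simp
    next
      case 2
      then show ?thesis using classF[of x] quotientI[of x P F] by simp
    qed
  qed
  show "\<forall>D\<in>?K. D \<noteq> {} \<and> D \<inter> (?A \<union> ?B) = {}"
    using refl sym trans by blast
  show "?A \<inter> ?B = {}" using assms(4) sym trans by blast
qed (use E in \<open>auto simp: equiv_def refl_on_def\<close>)

locale braid_diagram =
  fixes m :: nat and w :: braid_word
  assumes word: "w \<in> braid_words m"
begin

abbreviation "P \<equiv> points m w"
abbreviation "cn \<equiv> conn m w"
abbreviation "lo \<equiv> in_low w"
abbreviation "hi \<equiv> in_high w"
abbreviation "circ \<equiv> circles m w"

lemma conn_refl [simp]: "(x, x) \<in> cn R"
  by (simp add: conn_def)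

lemma conn_sym: "(x, y) \<in> cn R \<Longrightarrow> (y, x) \<in> cn R"
proof -
  have "sym (cn R)" unfolding conn_def by (intro sym_rtrancl) (auto simp: sym_def)
  then show "(x, y) \<in> cn R \<Longrightarrow> (y, x) \<in> cn R" by (rule symD)
qed

lemma conn_trans: "(x, y) \<in> cn R \<Longrightarrow> (y, z) \<in> cn R \<Longrightarrow> (x, z) \<in> cn R"
  unfolding conn_def by (rule rtrancl_trans)

lemma equiv_conn: "equiv UNIV (cn R)"
  by (rule equivI) (auto simp: refl_on_def intro: symI transI conn_sym conn_trans)

lemma circles_eq: "circ R = P // cn R"
  by (simp add: circles_def points_def conn_def)

lemma finite_points: "finite P"
  by (simp add: points_def)

lemma finite_circles: "finite (circ R)"
proof -
  have "circ R = (\<lambda>x. cn R `` {x}) ` P" unfolding circles_eq quotient_def by auto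
  then show ?thesis by (simp add: finite_points)
qed

lemma circle_subset: "C \<in> circ R \<Longrightarrow> C \<subseteq> P"
proof -
  have "y \<in> P" if "x \<in> P" "(x, y) \<in> cn R" for x y
    using that unfolding conn_iff_orbit[OF word]
    using permutes_orbit_subset[OF next_point_permutes[OF word]] by blast
  then show "C \<in> circ R \<Longrightarrow> C \<subseteq> P" unfolding circles_eq by (auto elim!: quotientE)
qed

lemma class_in_circles: "x \<in> P \<Longrightarrow> cn R `` {x} \<in> circ R"
  unfolding circles_eq by (rule quotientI)

lemma circle_conn: "C \<in> circ R \<Longrightarrow> x \<in> C \<Longrightarrow> y \<in> C \<longleftrightarrow> (x, y) \<in> cn R"
  unfolding circles_eq by (auto elim!: quotientE intro: conn_sym conn_trans)

lemma circle_nonempty: "C \<in> circ R \<Longrightarrow> C \<noteq> {}"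
  using conn_refl unfolding circles_eq by (metis ImageI empty_iff quotientE singletonI)

lemma circle_disjoint: "C \<in> circ R \<Longrightarrow> D \<in> circ R \<Longrightarrow> x \<in> C \<Longrightarrow> x \<in> D \<Longrightarrow> C = D"
  using circle_conn[of C R x] circle_conn[of D R x] by blast

lemma merge_circles:
  assumes t: "t < length w" "t \<notin> R" and "(lo t, hi t) \<notin> cn R"
  obtains A B K where "circ R = {A, B} \<union> K" "circ (insert t R) = {A \<union> B} \<union> K"
    "\<forall>D\<in>K. D \<noteq> {} \<and> D \<inter> (A \<union> B) = {}" "A \<inter> B = {}" "lo t \<in> A" "hi t \<in> B"
proof (rule quotient_join[OF equiv_conn in_ends_points[OF word t(1)] assms(3)])
  show "(x, y) \<in> cn (insert t R) \<longleftrightarrow> (x, y) \<in> cn R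
    \<or> (x, lo t) \<in> cn R \<and> (hi t, y) \<in> cn R \<or> (x, hi t) \<in> cn R \<and> (lo t, y) \<in> cn R" for x y
    by (rule conn_merge[OF word t assms(3)])
next
  fix K
  let ?A = "cn R `` {lo t}" and ?B = "cn R `` {hi t}"
  assume K: "P // cn R = {?A, ?B} \<union> K" "P // cn (insert t R) = {?A \<union> ?B} \<union> K"
    "\<forall>D\<in>K. D \<noteq> {} \<and> D \<inter> (?A \<union> ?B) = {}"
    "?A \<inter> ?B = {}" "lo t \<in> ?A" "hi t \<in> ?B"
  show thesis
    by (rule that, unfold circles_eq, rule K(1), rule K(2), rule K(3), rule K(4),
        rule K(5), rule K(6))
qed

lemma split_circles:
  assumes t: "t < length w" "t \<notin> R" and "(lo t, hi t) \<in> cn R"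
  obtains A B K where "circ (insert t R) = {A, B} \<union> K" "circ R = {A \<union> B} \<union> K"
    "\<forall>D\<in>K. D \<noteq> {} \<and> D \<inter> (A \<union> B) = {}" "A \<inter> B = {}" "lo t \<in> A" "hi t \<in> B"
proof -
  have not: "(lo t, hi t) \<notin> cn (insert t R)" using assms(3) conn_insert_iff[OF word t] by blast
  show thesis
  proof (rule quotient_join[OF equiv_conn in_ends_points[OF word t(1)] not])
    show "(x, y) \<in> cn R \<longleftrightarrow> (x, y) \<in> cn (insert t R)
      \<or> (x, lo t) \<in> cn (insert t R) \<and> (hi t, y) \<in> cn (insert t R)
      \<or> (x, hi t) \<in> cn (insert t R) \<and> (lo t, y) \<in> cn (insert t R)" for x y
      by (rule conn_split[OF word t assms(3)])
  next
    fix K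
    let ?A = "cn (insert t R) `` {lo t}" and ?B = "cn (insert t R) `` {hi t}"
    assume K: "P // cn (insert t R) = {?A, ?B} \<union> K" "P // cn R = {?A \<union> ?B} \<union> K"
      "\<forall>D\<in>K. D \<noteq> {} \<and> D \<inter> (?A \<union> ?B) = {}"
      "?A \<inter> ?B = {}" "lo t \<in> ?A" "hi t \<in> ?B"
    show thesis
      by (rule that, unfold circles_eq, rule K(1), rule K(2), rule K(3), rule K(4),
          rule K(5), rule K(6))
  qed
qed

lemma differences_merge:
  assumes "X = {A, B} \<union> K" "Y = {A \<union> B} \<union> K" "\<forall>D\<in>K. D \<noteq> {} \<and> D \<inter> (A \<union> B) = {}"
    "A \<inter> B = {}" "A \<noteq> {}" "B \<noteq> {}"
  shows "X - Y = {A, B}" "Y - X = {A \<union> B}" "X \<inter> Y = K" "A \<noteq> B"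
    "A \<notin> K" "B \<notin> K" "A \<union> B \<notin> K" "A \<union> B \<noteq> A" "A \<union> B \<noteq> B"
proof -
  show 1: "A \<notin> K" "B \<notin> K" "A \<union> B \<notin> K"
    using assms(3,5,6) by blast+
  show 2: "A \<noteq> B" "A \<union> B \<noteq> A" "A \<union> B \<noteq> B" using assms(4,5,6) by blast+
  then show "X - Y = {A, B}" "Y - X = {A \<union> B}" "X \<inter> Y = K" using 1 assms(1,2) by auto
qed

text \<open>For the circles \<open>A\<close> and \<open>B\<close> that are merged, membership in the differential becomes a condition on
labels alone.\<close>
lemma kh_term_merge_iff:
  assumes "t < length w" "t \<notin> R" and X: "circ R = {A, B} \<union> K" "circ (insert t R) = {A \<union> B} \<union> K"
    "\<forall>D\<in>K. D \<noteq> {} \<and> D \<inter> (A \<union> B) = {}" "A \<inter> B = {}" "A \<noteq> {}" "B \<noteq> {}"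
  shows "kh_term m w (R, l) (insert t R, l') \<longleftrightarrow>
    (\<forall>D\<in>K. l' D = l D) \<and> l' (A \<union> B) \<in> merge_map (l A) (l B)"
proof -
  note d = differences_merge[OF X]
  have comm: "merge_map x y = merge_map y x" for x y by (cases x; cases y) auto
  have t: "\<exists>s<length w. s \<notin> R \<and> insert t R = insert s R" using assms(1,2) by blast
  have merge: "(\<exists>C\<^sub>1 C\<^sub>2 C. C\<^sub>1 \<noteq> C\<^sub>2 \<and> {A, B} = {C\<^sub>1, C\<^sub>2} \<and> {A \<union> B} = {C}
      \<and> l' C \<in> merge_map (l C\<^sub>1) (l C\<^sub>2)) \<longleftrightarrow> l' (A \<union> B) \<in> merge_map (l A) (l B)"
    (is "?L \<longleftrightarrow> ?R")
  proof
    assume ?L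
    then show ?R using comm[of "l A" "l B"] by (auto simp: doubleton_eq_iff)
  next
    assume ?R
    then show ?L using d(4) by blast
  qed
  have split: "\<not> (\<exists>C C\<^sub>1 C\<^sub>2. C\<^sub>1 \<noteq> C\<^sub>2 \<and> {A, B} = {C} \<and> Q C C\<^sub>1 C\<^sub>2)" for Q
    using d(4) by blast
  show ?thesis
    unfolding kh_term_def prod.case d(1,2,3) merge
    using t split by blast
qed

lemma kh_term_split_iff:
  assumes "t < length w" "t \<notin> R" and X: "circ (insert t R) = {A, B} \<union> K" "circ R = {A \<union> B} \<union> K"
    "\<forall>D\<in>K. D \<noteq> {} \<and> D \<inter> (A \<union> B) = {}" "A \<inter> B = {}" "A \<noteq> {}" "B \<noteq> {}"
  shows "kh_term m w (R, l) (insert t R, l') \<longleftrightarrow>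
    (\<forall>D\<in>K. l' D = l D) \<and> (l' A, l' B) \<in> split_map (l (A \<union> B))"
proof -
  note d = differences_merge[OF X]
  have comm: "(x, y) \<in> split_map z \<longleftrightarrow> (y, x) \<in> split_map z" for x y z by (cases z) auto
  have t: "\<exists>s<length w. s \<notin> R \<and> insert t R = insert s R" using assms(1,2) by blast
  have split: "(\<exists>C C\<^sub>1 C\<^sub>2. C\<^sub>1 \<noteq> C\<^sub>2 \<and> {A \<union> B} = {C} \<and> {A, B} = {C\<^sub>1, C\<^sub>2}
      \<and> (l' C\<^sub>1, l' C\<^sub>2) \<in> split_map (l C)) \<longleftrightarrow> (l' A, l' B) \<in> split_map (l (A \<union> B))"
    (is "?L \<longleftrightarrow> ?R")
  proof
    assume ?L
    then show ?R using comm[of "l' A" "l' B"] by (auto simp: doubleton_eq_iff)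
  next
    assume ?R
    then show ?L using d(4) by blast
  qed
  have merge: "\<not> (\<exists>C\<^sub>1 C\<^sub>2 C. C\<^sub>1 \<noteq> C\<^sub>2 \<and> {A \<union> B} = {C\<^sub>1, C\<^sub>2} \<and> Q C C\<^sub>1 C\<^sub>2)" for Q
    by blast
  have "circ R \<inter> circ (insert t R) = K" using d(3) by blast
  then show ?thesis
    unfolding kh_term_def prod.case d(1,2) split using t merge by simp
qed

lemma kh_termD:
  assumes "kh_term m w (R, l) (R', l')"
  obtains t where "t < length w" "t \<notin> R" "R' = insert t R"
  using assms unfolding kh_term_def by auto

end

section \<open>The Khovanov differential squares to zero\<close>

text \<open>In a square of the cube of resolutions the two ways around contribute equally, and equal terms cancel.\<close>
lemma sum_symmetric_pairs_zero:
  fixes f :: "'a \<Rightarrow> 'a \<Rightarrow> 'b::comm_monoid_add"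
  assumes double: "\<And>x :: 'b. x + x = 0"
    and "finite A" and "\<And>s t. s \<in> A \<Longrightarrow> t \<in> A \<Longrightarrow> s \<noteq> t \<Longrightarrow> f s t = f t s"
  shows "(\<Sum>t\<in>A. \<Sum>s\<in>A - {t}. f t s) = 0"
  using assms(2,3)
proof (induction A rule: finite_induct)
  case empty
  then show ?case by simp
next
  case (insert x A)
  have *: "insert x A - {t} = insert x (A - {t})" if "t \<in> A" for t
    using that insert.hyps(2) by auto
  have "(\<Sum>t\<in>insert x A. \<Sum>s\<in>insert x A - {t}. f t s)
      = (\<Sum>s\<in>A. f x s) + (\<Sum>t\<in>A. \<Sum>s\<in>insert x A - {t}. f t s)"
    using insert.hyps by simp
  also have "(\<Sum>t\<in>A. \<Sum>s\<in>insert x A - {t}. f t s) = (\<Sum>t\<in>A. f t x + (\<Sum>s\<in>A - {t}. f t s))"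
  proof (rule sum.cong[OF HOL.refl])
    fix t assume "t \<in> A"
    then have "x \<notin> A - {t}" "finite (A - {t})" using insert.hyps by auto
    then show "(\<Sum>s\<in>insert x A - {t}. f t s) = f t x + (\<Sum>s\<in>A - {t}. f t s)"
      by (subst *[OF \<open>t \<in> A\<close>]) (rule sum.insert)
  qed
  also have "\<dots> = (\<Sum>t\<in>A. f t x) + (\<Sum>t\<in>A. \<Sum>s\<in>A - {t}. f t s)"
    by (rule sum.distrib)
  also have "(\<Sum>t\<in>A. \<Sum>s\<in>A - {t}. f t s) = 0"
    using insert.IH insert.prems by blast
  also have "(\<Sum>t\<in>A. f t x) = (\<Sum>s\<in>A. f x s)"
    using insert.hyps by (intro sum.cong HOL.refl insert.prems) auto
  also have "(\<Sum>s\<in>A. f x s) + ((\<Sum>s\<in>A. f x s) + 0) = 0"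
    by (simp add: double)
  finally show ?case .
qed

text \<open>To compare compositions of merge and split maps, a chain on a resolution is evaluated on sets \<open>T\<close> of
points: the value at \<open>T\<close> is the coefficient of the labelling that is plus exactly on the circles met
by \<open>T\<close>, provided that \<open>T\<close> meets each circle at most once, and 0 otherwise. In other words a circle
labelled plus becomes the sum of its points in a commutative algebra where all points square to
zero, and a circle labelled minus becomes 1. In this model split maps are inclusions, and a merge map is
the contraction with the sum of two points, one from each circle. All these operators live on the
same space and commute, which reduces the vanishing of the square to a discussion of which steps merge.\<close>
definition contract :: "'a \<Rightarrow> ('a set \<Rightarrow> 'b::zero) \<Rightarrow> 'a set \<Rightarrow> 'b" where
  "contract p F T = (if p \<in> T then 0 else F (insert p T))"

lemma contract_commute: "contract p (contract q F) T = contract q (contract p F) T"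
  by (auto simp: contract_def insert_commute)

lemma contract_sum:
  fixes F :: "'i \<Rightarrow> 'a set \<Rightarrow> 'b::comm_monoid_add"
  shows "contract p (\<lambda>T. \<Sum>i\<in>I. F i T) T = (\<Sum>i\<in>I. contract p (F i) T)"
  by (simp add: contract_def)

lemma bit_add_self: "x + x = (0::bit)"
  by (cases x) simp_all

definition kh_diff :: "nat \<Rightarrow> braid_word \<Rightarrow> chain \<Rightarrow> chain" where
  "kh_diff m w c = (\<lambda>h. if h \<in> generators m w
     then (\<Sum>g | g \<in> generators m w \<and> kh_term m w g h. c g) else 0)"

context braid_diagram begin

definition transversal :: "nat set \<Rightarrow> point set \<Rightarrow> bool" where
  "transversal R T \<longleftrightarrow> (\<forall>p\<in>T. \<forall>q\<in>T. (p, q) \<in> cn R \<longrightarrow> p = q)"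

definition labelling :: "nat set \<Rightarrow> point set \<Rightarrow> point set \<Rightarrow> label" where
  "labelling R T = (\<lambda>C\<in>circ R. if T \<inter> C = {} then Vminus else Vplus)"

definition evaluate :: "chain \<Rightarrow> nat set \<Rightarrow> point set \<Rightarrow> bit" where
  "evaluate c R T = (if transversal R T then c (R, labelling R T) else 0)"

text \<open>The effect of changing the resolution of crossing \<open>t\<close> in terms of the evaluations.\<close>
definition cross :: "nat set \<Rightarrow> nat \<Rightarrow> (point set \<Rightarrow> 'b::comm_monoid_add) \<Rightarrow> point set \<Rightarrow> 'b" where
  "cross R t F T = (if (lo t, hi t) \<in> cn R then F T else contract (lo t) F T + contract (hi t) F T)"

text \<open>Evaluations of chains do not distinguish points of one circle; this is what makes the contraction
with a merged pair independent of the choice of points.\<close>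
definition balanced :: "nat set \<Rightarrow> (point set \<Rightarrow> 'b::comm_monoid_add) \<Rightarrow> bool" where
  "balanced R F \<longleftrightarrow> (\<forall>p\<in>P. \<forall>q\<in>P. \<forall>T. (p, q) \<in> cn R \<longrightarrow> contract p F T = contract q F T)"

lemma finite_labels: "finite (UNIV :: label set)"
  by (rule finite_subset[of _ "{Vplus, Vminus}"]) (auto intro: label.exhaust)

lemma generators_iff: "(R, l) \<in> generators m w \<longleftrightarrow> R \<subseteq> {..<length w} \<and> l \<in> circ R \<rightarrow>\<^sub>E UNIV"
  by (simp add: generators_def resolutions_def)

lemma finite_generators: "finite (generators m w)"
  unfolding generators_def resolutions_def
  by (intro finite_SigmaI finite_PiE finite_circles finite_labels) simp_all

lemma balanced_evaluate: "balanced R (evaluate c R)"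
  unfolding balanced_def
proof (intro ballI allI impI)
  fix p q T assume pq: "p \<in> P" "q \<in> P" "(p, q) \<in> cn R"
  then have qp: "(q, p) \<in> cn R" by (blast intro: conn_sym)
  show "contract p (evaluate c R) T = contract q (evaluate c R) T"
  proof (cases "p = q")
    case False
    have trans_iff: "(p, z) \<in> cn R \<longleftrightarrow> (q, z) \<in> cn R" "(z, p) \<in> cn R \<longleftrightarrow> (z, q) \<in> cn R" for z
      using pq qp by (blast intro: conn_trans)+
    have "\<not> transversal R (insert p T)" if "q \<in> T"
      using that False pq unfolding transversal_def by blast
    moreover have "\<not> transversal R (insert q T)" if "p \<in> T"
      using that False pq unfolding transversal_def by blast
    moreover have "transversal R (insert p T) \<longleftrightarrow> transversal R (insert q T)" if "p \<notin> T" "q \<notin> T"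
      unfolding transversal_def using that trans_iff conn_refl by (metis insert_iff)
    moreover have "labelling R (insert p T) = labelling R (insert q T)"
    proof -
      have "p \<in> C \<longleftrightarrow> q \<in> C" if "C \<in> circ R" for C
        using circle_conn[OF that] pq qp by blast
      then show ?thesis unfolding labelling_def by (intro restrict_ext) (simp add: Int_insert_left)
    qed
    ultimately show ?thesis by (auto simp: contract_def evaluate_def)
  qed simp
qed

lemma cross_sum: "cross R t (\<lambda>T. \<Sum>i\<in>I. F i T) T = (\<Sum>i\<in>I. cross R t (F i) T)"
  by (simp add: cross_def contract_sum sum.distrib)

lemma cross_cong:
  assumes "t < length w" "T \<subseteq> P" and "\<And>T. T \<subseteq> P \<Longrightarrow> F T = G T"
  shows "cross R t F T = cross R t G T"
  using assms in_ends_points[OF word assms(1)] by (auto simp: cross_def contract_def)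

text \<open>The cases are distinguished by what each crossing does if it is changed first. If one merges and the
other one splits, then they do so in either order. If both merge, then either the second change merges
too, whichever comes first, and contractions commute; or the second change splits, which means that both
crossings connect the same two circles, so that the contractions agree. If both split, then either the
second change splits too, and nothing happens to the evaluations; or it merges, and the result is the
contraction with two points of one circle, which is zero in characteristic 2.\<close>
lemma cross_commute:
  fixes F :: "point set \<Rightarrow> 'b::comm_monoid_add"
  assumes double: "\<And>x :: 'b. x + x = 0"
    and s: "s < length w" "s \<notin> R" and t: "t < length w" "t \<notin> R" and "s \<noteq> t"
    and F: "balanced R F"
  shows "cross (insert s R) t (cross R s F) T = cross (insert t R) s (cross R t F) T"
proof -
  let ?st = "insert t (insert s R)"
  have st: "insert s (insert t R) = ?st" by auto
  have s': "s \<notin> insert t R" and t': "t \<notin> insert s R" using assms by auto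
  let ?S = "(lo s, hi s) \<in> cn R" and ?T = "(lo t, hi t) \<in> cn R"
    and ?S' = "(lo s, hi s) \<in> cn (insert t R)" and ?T' = "(lo t, hi t) \<in> cn (insert s R)"
  note ends = in_ends_points[OF word s(1)] in_ends_points[OF word t(1)]
  have bal: "contract p F T = contract q F T" if "(p, q) \<in> cn R" "p \<in> P" "q \<in> P" for p q T
    using that F unfolding balanced_def by blast
  have mono_s: "(x, y) \<in> cn (insert s R)" if "\<not> ?S" "(x, y) \<in> cn R" for x y
    using that conn_merge[OF word s] by blast
  have mono_t: "(x, y) \<in> cn (insert t R)" if "\<not> ?T" "(x, y) \<in> cn R" for x y
    using that conn_merge[OF word t] by blast
  have join_s: "(lo s, hi s) \<in> cn (insert s R)" if "\<not> ?S"
    using that conn_insert_iff[OF word s] by blast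
  have join_t: "(lo t, hi t) \<in> cn (insert t R)" if "\<not> ?T"
    using that conn_insert_iff[OF word t] by blast
  have stay: "(lo r, hi r) \<in> cn R \<Longrightarrow> cross R r F = F" for r
    by (rule ext) (simp add: cross_def)
  consider
      (SS) ?S ?T | (MS) "\<not> ?S" ?T | (SM) ?S "\<not> ?T" | (MM) "\<not> ?S" "\<not> ?T" by blast
  then show ?thesis
  proof cases
    case SS
    have zero: "contract (lo s) F T + contract (hi s) F T = 0"
      "contract (lo t) F T + contract (hi t) F T = 0" for T
      using bal[of "lo s" "hi s" T] bal[of "lo t" "hi t" T] SS ends by (simp_all add: double)
    have "?T' \<longleftrightarrow> ?S'"
    proof -
      \<comment> \<open>If the second change splits after the first one, the first splits after the second: otherwise it
        would join the two parts that the second one separates.\<close>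
      have no: False if sS: "s < length w" "s \<notin> R" "s \<notin> insert t R" and tT: "t < length w" "t \<notin> R" "t \<notin> insert s R"
        and "(lo s, hi s) \<in> cn R" "(lo t, hi t) \<in> cn R"
          "(lo t, hi t) \<in> cn (insert s R)" "(lo s, hi s) \<notin> cn (insert t R)" for s t
      proof -
        have not: "(lo t, hi t) \<notin> cn (insert s (insert t R))"
          using conn_insert_iff[OF word tT(1,3)] that unfolding insert_commute[of t s] by blast
        have join: "(lo s, hi s) \<in> cn (insert s (insert t R))"
          using conn_insert_iff[OF word sS(1,3)] that by blast
        have mono: "(x, y) \<in> cn (insert s (insert t R))" if "(x, y) \<in> cn (insert t R)" for x y
          using conn_merge[OF word sS(1,3)] that \<open>(lo s, hi s) \<notin> cn (insert t R)\<close> by blast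
        have "(lo s, lo t) \<in> cn (insert t R) \<and> (hi t, hi s) \<in> cn (insert t R)
          \<or> (lo s, hi t) \<in> cn (insert t R) \<and> (lo t, hi s) \<in> cn (insert t R)"
          using conn_split[OF word tT(1,2)] that by blast
        then show False
        proof
          assume "(lo s, lo t) \<in> cn (insert t R) \<and> (hi t, hi s) \<in> cn (insert t R)"
          then have "(lo t, hi t) \<in> cn (insert s (insert t R))"
            using conn_trans[OF conn_sym[OF mono] conn_trans[OF join conn_sym[OF mono]]] by blast
          then show False using not by blast
        next
          assume "(lo s, hi t) \<in> cn (insert t R) \<and> (lo t, hi s) \<in> cn (insert t R)"
          then have "(lo t, hi t) \<in> cn (insert s (insert t R))"
            using conn_trans[OF mono conn_trans[OF conn_sym[OF join] mono]] by blast
          then show False using not by blast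
        qed
      qed
      show ?thesis using no[of s t] no[of t s] s t s' t' SS by blast
    qed
    then show ?thesis
      using SS zero stay by (simp add: cross_def)
  next
    case MS
    then have "?T'" "\<not> ?S'" using mono_s conn_split[OF word t] by blast+
    then show ?thesis using MS stay by (simp add: cross_def)
  next
    case SM
    then have "?S'" "\<not> ?T'" using mono_t conn_split[OF word s] by blast+
    then show ?thesis using SM stay by (simp add: cross_def)
  next
    case MM
    have T': "?T' \<longleftrightarrow> (lo t, lo s) \<in> cn R \<and> (hi s, hi t) \<in> cn R \<or> (lo t, hi s) \<in> cn R \<and> (lo s, hi t) \<in> cn R"
      using conn_merge[OF word s MM(1), of "lo t" "hi t"] MM(2) by blast
    have S': "?S' \<longleftrightarrow> (lo s, lo t) \<in> cn R \<and> (hi t, hi s) \<in> cn R \<or> (lo s, hi t) \<in> cn R \<and> (lo t, hi s) \<in> cn R"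
      using conn_merge[OF word t MM(2), of "lo s" "hi s"] MM(1) by blast
    have eq: "?S' \<longleftrightarrow> ?T'" unfolding S' T' using conn_sym by blast
    show ?thesis
    proof (cases ?T')
      case True
      then have "contract (lo s) F T + contract (hi s) F T = contract (lo t) F T + contract (hi t) F T"
        using T' bal[of "lo t" "lo s" T] bal[of "hi s" "hi t" T] bal[of "lo t" "hi s" T] bal[of "lo s" "hi t" T] ends
        by (auto simp: add.commute)
      then show ?thesis using True eq MM by (simp add: cross_def)
    next
      case False
      have "contract p (cross R s F) T = contract p (contract (lo s) F) T + contract p (contract (hi s) F) T" for p
        using MM by (simp add: cross_def contract_def)
      moreover have "contract p (cross R t F) T = contract p (contract (lo t) F) T + contract p (contract (hi t) F) T" for p
        using MM by (simp add: cross_def contract_def)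
      ultimately show ?thesis
        using False eq contract_commute[of "lo s" "lo t" F T] contract_commute[of "lo s" "hi t" F T]
          contract_commute[of "hi s" "lo t" F T] contract_commute[of "hi s" "hi t" F T]
        by (simp add: cross_def[of "insert s R"] cross_def[of "insert t R"] ac_simps)
    qed
  qed
qed

lemma transversal_circle:
  assumes "transversal R T" "C \<in> circ R" "p \<in> T" "p \<in> C" "q \<in> T" "q \<in> C"
  shows "p = q"
  using assms circle_conn unfolding transversal_def by blast

lemma transversalI:
  assumes "T \<subseteq> P" and "\<And>C p q. C \<in> circ R \<Longrightarrow> p \<in> T \<inter> C \<Longrightarrow> q \<in> T \<inter> C \<Longrightarrow> p = q"
  shows "transversal R T"
  unfolding transversal_def
proof (intro ballI impI)
  fix p q assume "p \<in> T" "q \<in> T" "(p, q) \<in> cn R"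
  then show "p = q" using assms(2)[of "cn R `` {p}" p q] class_in_circles[of p R] assms(1) by auto
qed

lemma labelling_PiE: "labelling R T \<in> circ R \<rightarrow>\<^sub>E UNIV"
  by (simp add: labelling_def)

lemma labelling_eqI:
  assumes "l \<in> circ R \<rightarrow>\<^sub>E UNIV" "\<And>C. C \<in> circ R \<Longrightarrow> l C = labelling R T C"
  shows "l = labelling R T"
  using assms(1) labelling_PiE assms(2) by (rule PiE_ext)

lemma labelling_circle:
  "C \<in> circ R \<Longrightarrow> labelling R T C = (if T \<inter> C = {} then Vminus else Vplus)"
  by (simp add: labelling_def)

lemma contract_evaluate_zero:
  assumes "A \<in> circ R" "a \<in> A" "p \<in> T" "p \<in> A"
  shows "contract a (evaluate c R) T = 0"
proof (cases "a \<in> T")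
  case False
  then have "a \<noteq> p" using assms by auto
  moreover have "(a, p) \<in> cn R" using assms circle_conn by blast
  ultimately have "\<not> transversal R (insert a T)" using assms unfolding transversal_def by blast
  then show ?thesis by (simp add: contract_def evaluate_def)
qed (simp add: contract_def)

lemma contract_evaluate_fresh:
  assumes "transversal R T" "A \<in> circ R" "a \<in> A" "T \<inter> A = {}"
  shows "contract a (evaluate c R) T = c (R, labelling R (insert a T))"
proof -
  have "(a, q) \<notin> cn R" "(q, a) \<notin> cn R" if "q \<in> T" for q
    using assms circle_conn[OF assms(2,3), of q] that conn_sym[of q a] by blast+
  then have "transversal R (insert a T)"
    using assms(1) unfolding transversal_def by blast
  then show ?thesis using assms by (auto simp: contract_def evaluate_def)
qed

lemma merge_preimage_plus:
  assumes X: "circ R = {A, B} \<union> K" "\<forall>D\<in>K. D \<noteq> {} \<and> D \<inter> (A \<union> B) = {}" "A \<inter> B = {}"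
    and ab: "a \<in> A" "b \<in> B" and "transversal R T" and p: "p \<in> T" "p \<in> A" and "T \<inter> B = {}"
    and l': "\<And>D. D \<in> K \<Longrightarrow> l' D = (if T \<inter> D = {} then Vminus else Vplus)"
  shows "(\<Sum>l | l \<in> circ R \<rightarrow>\<^sub>E UNIV \<and> (\<forall>D\<in>K. l' D = l D) \<and> l A = Vplus \<and> l B = Vplus. c (R, l))
    = contract a (evaluate c R) T + contract b (evaluate c R) T"
proof -
  have AB: "A \<in> circ R" "B \<in> circ R" using X by auto
  let ?l = "labelling R (insert b T)"
  have val: "?l A = Vplus" "?l B = Vplus" "\<And>D. D \<in> K \<Longrightarrow> ?l D = l' D"
  proof -
    have "insert b T \<inter> D = T \<inter> D" if "D \<in> K" for D using that X(2) ab by blast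
    then show "?l A = Vplus" "?l B = Vplus" "\<And>D. D \<in> K \<Longrightarrow> ?l D = l' D"
      using X(1) ab p l' by (auto simp: labelling_circle)
  qed
  have "{l. l \<in> circ R \<rightarrow>\<^sub>E UNIV \<and> (\<forall>D\<in>K. l' D = l D) \<and> l A = Vplus \<and> l B = Vplus} = {?l}"
  proof (intro equalityI subsetI)
    fix l assume l: "l \<in> {l. l \<in> circ R \<rightarrow>\<^sub>E UNIV \<and> (\<forall>D\<in>K. l' D = l D) \<and> l A = Vplus \<and> l B = Vplus}"
    then have "l = ?l"
      using val by (intro labelling_eqI) (auto simp: X(1))
    then show "l \<in> {?l}" by simp
  qed (use val in \<open>auto simp: labelling_PiE\<close>)
  then show ?thesis
    using contract_evaluate_zero[OF AB(1) ab(1) p] contract_evaluate_fresh[OF \<open>transversal R T\<close> AB(2) ab(2)]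
      \<open>T \<inter> B = {}\<close> by simp
qed

lemma merge_preimage_minus:
  assumes X: "circ R = {A, B} \<union> K" "\<forall>D\<in>K. D \<noteq> {} \<and> D \<inter> (A \<union> B) = {}" "A \<inter> B = {}"
    and ab: "a \<in> A" "b \<in> B" and "transversal R T" and "T \<inter> (A \<union> B) = {}"
    and l': "\<And>D. D \<in> K \<Longrightarrow> l' D = (if T \<inter> D = {} then Vminus else Vplus)"
  shows "(\<Sum>l | l \<in> circ R \<rightarrow>\<^sub>E UNIV \<and> (\<forall>D\<in>K. l' D = l D) \<and> l A \<noteq> l B. c (R, l))
    = contract a (evaluate c R) T + contract b (evaluate c R) T"
proof -
  have AB: "A \<in> circ R" "B \<in> circ R" using X by auto
  let ?l = "labelling R (insert a T)" and ?k = "labelling R (insert b T)"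
  have val: "?l A = Vplus" "?l B = Vminus" "\<And>D. D \<in> K \<Longrightarrow> ?l D = l' D"
    "?k A = Vminus" "?k B = Vplus" "\<And>D. D \<in> K \<Longrightarrow> ?k D = l' D"
  proof -
    have "insert a T \<inter> D = T \<inter> D" "insert b T \<inter> D = T \<inter> D" if "D \<in> K" for D
      using that X(2) ab by blast+
    moreover have "insert a T \<inter> B = {}" "insert b T \<inter> A = {}"
      using X(3) ab \<open>T \<inter> (A \<union> B) = {}\<close> by blast+
    ultimately show "?l A = Vplus" "?l B = Vminus" "\<And>D. D \<in> K \<Longrightarrow> ?l D = l' D"
      "?k A = Vminus" "?k B = Vplus" "\<And>D. D \<in> K \<Longrightarrow> ?k D = l' D"
      using X(1) ab l' by (auto simp: labelling_circle)
  qed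
  have "{l. l \<in> circ R \<rightarrow>\<^sub>E UNIV \<and> (\<forall>D\<in>K. l' D = l D) \<and> l A \<noteq> l B} = {?l, ?k}"
  proof (intro equalityI subsetI)
    fix l assume l: "l \<in> {l. l \<in> circ R \<rightarrow>\<^sub>E UNIV \<and> (\<forall>D\<in>K. l' D = l D) \<and> l A \<noteq> l B}"
    show "l \<in> {?l, ?k}"
    proof (cases "l A")
      case Vplus
      then have "l B = Vminus" using l by (cases "l B") auto
      then have "l = ?l"
        using Vplus l val by (intro labelling_eqI) (auto simp: X(1))
      then show ?thesis by simp
    next
      case Vminus
      then have "l B = Vplus" using l by (cases "l B") auto
      then have "l = ?k"
        using Vminus l val by (intro labelling_eqI) (auto simp: X(1))
      then show ?thesis by simp
    qed
  next
    fix l assume "l \<in> {?l, ?k}"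
    then consider "l = ?l" | "l = ?k" by blast
    then show "l \<in> {l. l \<in> circ R \<rightarrow>\<^sub>E UNIV \<and> (\<forall>D\<in>K. l' D = l D) \<and> l A \<noteq> l B}"
      by cases (simp_all add: val labelling_PiE)
  qed
  moreover have "?l \<noteq> ?k" using val by (metis label.distinct(1))
  ultimately show ?thesis
    using contract_evaluate_fresh[OF \<open>transversal R T\<close> AB(1) ab(1)]
      contract_evaluate_fresh[OF \<open>transversal R T\<close> AB(2) ab(2)] \<open>T \<inter> (A \<union> B) = {}\<close>
    by (simp add: Int_Un_distrib)
qed

text \<open>The preimages of a labelling under a merge: a merged circle labelled minus comes from the labels plus,
minus and minus, plus, which are obtained by adding to \<open>T\<close> the point of one or the other circle. If
the merged circle is labelled plus, then one of the two circles meets \<open>T\<close> already and only the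
point of the other one can be added.\<close>
lemma evaluate_cross_merge:
  assumes t: "t < length w" "t \<notin> R" and T: "T \<subseteq> P" and "(lo t, hi t) \<notin> cn R"
  shows "(if transversal (insert t R) T
      then \<Sum>l | l \<in> circ R \<rightarrow>\<^sub>E UNIV \<and> kh_term m w (R, l) (insert t R, labelling (insert t R) T). c (R, l)
      else 0) = contract (lo t) (evaluate c R) T + contract (hi t) (evaluate c R) T"
proof -
  obtain A B K where X: "circ R = {A, B} \<union> K" "circ (insert t R) = {A \<union> B} \<union> K"
    "\<forall>D\<in>K. D \<noteq> {} \<and> D \<inter> (A \<union> B) = {}" "A \<inter> B = {}" and ab: "lo t \<in> A" "hi t \<in> B"
    by (rule merge_circles[OF t assms(4)])
  have ne: "A \<noteq> {}" "B \<noteq> {}" using ab by auto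
  have AB: "A \<in> circ R" "B \<in> circ R" "A \<union> B \<in> circ (insert t R)" using X by auto
  have mono: "(x, y) \<in> cn (insert t R)" if "(x, y) \<in> cn R" for x y
    using that conn_merge[OF word t assms(4)] by blast
  show ?thesis
  proof (cases "transversal (insert t R) T")
    case True
    let ?l' = "labelling (insert t R) T"
    have kterm: "kh_term m w (R, l) (insert t R, ?l') \<longleftrightarrow>
        (\<forall>D\<in>K. ?l' D = l D) \<and> ?l' (A \<union> B) \<in> merge_map (l A) (l B)" for l
      by (rule kh_term_merge_iff[OF t X ne])
    have l': "?l' D = (if T \<inter> D = {} then Vminus else Vplus)" if "D \<in> K" for D
      using that X by (simp add: labelling_def)
    have l'_AB: "?l' (A \<union> B) = (if T \<inter> (A \<union> B) = {} then Vminus else Vplus)"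
      using X by (simp add: labelling_def)
    have trans: "transversal R T" using True mono unfolding transversal_def by blast
    show ?thesis
    proof (cases "T \<inter> (A \<union> B) = {}")
      case empty: True
      have "Vminus \<in> merge_map x y \<longleftrightarrow> x \<noteq> y" for x y by (cases x; cases y) auto
      then show ?thesis
        using merge_preimage_minus[OF X(1,3,4) ab trans empty l'] True l'_AB empty
        by (simp add: kterm)
    next
      case False
      then obtain p where p: "p \<in> T" "p \<in> A \<union> B" by blast
      have uniq: "q = p" if "q \<in> T" "q \<in> A \<union> B" for q
        using transversal_circle[OF True AB(3)] p that by blast
      have plus: "Vplus \<in> merge_map x y \<longleftrightarrow> x = Vplus \<and> y = Vplus" for x y by (cases x; cases y) auto
      have plus': "Vplus \<in> merge_map x y \<longleftrightarrow> y = Vplus \<and> x = Vplus" for x y by (auto simp: plus)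
      show ?thesis
      proof (cases "p \<in> A")
        case pA: True
        then have "T \<inter> B = {}" using uniq X(4) by blast
        from merge_preimage_plus[OF X(1,3,4) ab trans p(1) pA this l']
        show ?thesis using True l'_AB False by (simp add: kterm plus)
      next
        case pA: False
        then have pB: "p \<in> B" and "T \<inter> A = {}" using uniq p X(4) by blast+
        have X': "circ R = {B, A} \<union> K" "\<forall>D\<in>K. D \<noteq> {} \<and> D \<inter> (B \<union> A) = {}" "B \<inter> A = {}"
          using X by auto
        from merge_preimage_plus[OF X' ab(2,1) trans p(1) pB \<open>T \<inter> A = {}\<close> l']
        show ?thesis
          using True l'_AB False by (subst add.commute) (simp add: kterm plus')
      qed
    qed
  next
    case False
    have "contract a (evaluate c R) T = 0" if "\<not> transversal R T" for a
      using that by (auto simp: contract_def evaluate_def transversal_def)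
    moreover have "contract (lo t) (evaluate c R) T = 0 \<and> contract (hi t) (evaluate c R) T = 0"
      if trans: "transversal R T"
    proof -
      obtain p q where "p \<in> T" "q \<in> T" "p \<noteq> q" "(p, q) \<in> cn (insert t R)"
        using False unfolding transversal_def by blast
      moreover from this trans have "(p, q) \<notin> cn R" unfolding transversal_def by blast
      ultimately have "p \<in> T \<and> q \<in> T \<and> (((lo t, p) \<in> cn R \<and> (hi t, q) \<in> cn R)
          \<or> ((hi t, p) \<in> cn R \<and> (lo t, q) \<in> cn R))"
        using conn_merge[OF word t assms(4), of p q] conn_sym by blast
      then obtain p' q' where "p' \<in> T" "q' \<in> T" "p' \<in> A" "q' \<in> B"
        using circle_conn[OF AB(1) ab(1)] circle_conn[OF AB(2) ab(2)] by blast
      then show ?thesis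
        using contract_evaluate_zero[OF AB(1) ab(1)] contract_evaluate_zero[OF AB(2) ab(2)] by blast
    qed
    ultimately show ?thesis using False by (cases "transversal R T") simp_all
  qed
qed

text \<open>A circle is labelled plus before the split iff exactly one of its parts is afterwards, so the set \<open>T\<close> does
not change. If \<open>T\<close> meets both parts, then the labelling has no preimage, and \<open>T\<close> meets the
circle twice.\<close>
lemma evaluate_cross_split:
  assumes t: "t < length w" "t \<notin> R" and T: "T \<subseteq> P" and "(lo t, hi t) \<in> cn R"
  shows "(if transversal (insert t R) T
      then \<Sum>l | l \<in> circ R \<rightarrow>\<^sub>E UNIV \<and> kh_term m w (R, l) (insert t R, labelling (insert t R) T). c (R, l)
      else 0) = evaluate c R T"
proof -
  obtain A B K where X: "circ (insert t R) = {A, B} \<union> K" "circ R = {A \<union> B} \<union> K"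
    "\<forall>D\<in>K. D \<noteq> {} \<and> D \<inter> (A \<union> B) = {}" "A \<inter> B = {}" and ab: "lo t \<in> A" "hi t \<in> B"
    by (rule split_circles[OF t assms(4)])
  have ne: "A \<noteq> {}" "B \<noteq> {}" using ab by auto
  have AB: "A \<in> circ (insert t R)" "B \<in> circ (insert t R)" "A \<union> B \<in> circ R" using X by auto
  have mono: "(x, y) \<in> cn R" if "(x, y) \<in> cn (insert t R)" for x y
    using that conn_split[OF word t assms(4)] by blast
  show ?thesis
  proof (cases "transversal (insert t R) T")
    case True
    let ?l' = "labelling (insert t R) T"
    have kterm: "kh_term m w (R, l) (insert t R, ?l') \<longleftrightarrow>
        (\<forall>D\<in>K. ?l' D = l D) \<and> (?l' A, ?l' B) \<in> split_map (l (A \<union> B))" for l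
      by (rule kh_term_split_iff[OF t X ne])
    have l': "?l' D = (if T \<inter> D = {} then Vminus else Vplus)" if "D \<in> {A, B} \<union> K" for D
      using that X by (simp add: labelling_def)
    have l: "labelling R T D = (if T \<inter> D = {} then Vminus else Vplus)" if "D \<in> {A \<union> B} \<union> K" for D
      using that X by (simp add: labelling_def)
    show ?thesis
    proof (cases "T \<inter> A \<noteq> {} \<and> T \<inter> B \<noteq> {}")
      case both: True
      then have "(?l' A, ?l' B) \<notin> split_map x" for x by (cases x) (simp_all add: l')
      moreover obtain p q where pq: "p \<in> T" "p \<in> A" "q \<in> T" "q \<in> B" using both by blast
      moreover have "p \<noteq> q" using pq X(4) by blast
      ultimately have "\<not> transversal R T"
        using transversal_circle[OF _ AB(3), of T p q] by blast
      then show ?thesis using \<open>\<And>x. (?l' A, ?l' B) \<notin> split_map x\<close>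
        by (simp add: kterm evaluate_def)
    next
      case False
      have "transversal R T"
      proof (rule transversalI[OF T])
        fix C p q assume C: "C \<in> circ R" "p \<in> T \<inter> C" "q \<in> T \<inter> C"
        then have "C \<in> circ (insert t R) \<or> p \<in> A \<and> q \<in> A \<or> p \<in> B \<and> q \<in> B"
          using X(1,2) False by blast
        then show "p = q"
          using transversal_circle[OF True] C AB by blast
      qed
      have "(?l' A, ?l' B) \<in> split_map x \<longleftrightarrow> x = labelling R T (A \<union> B)" for x
        using False by (cases x) (auto simp: l' l Int_Un_distrib)
      moreover have "?l' D = labelling R T D" if "D \<in> K" for D
        using that by (simp add: l l')
      ultimately have "kh_term m w (R, k) (insert t R, ?l') \<longleftrightarrow> (\<forall>D\<in>circ R. k D = labelling R T D)" for k
        unfolding kterm X(2) by (metis UnE UnI1 UnI2 singletonD singletonI)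
      then have "{k. k \<in> circ R \<rightarrow>\<^sub>E UNIV \<and> kh_term m w (R, k) (insert t R, ?l')} = {labelling R T}"
        using labelling_PiE[of R T] labelling_eqI[of _ R T] by blast
      then show ?thesis using True \<open>transversal R T\<close> by (simp add: evaluate_def)
    qed
  next
    case False
    then have "\<not> transversal R T" using mono unfolding transversal_def by blast
    then show ?thesis using False by (simp add: evaluate_def)
  qed
qed

lemma evaluate_cross:
  assumes "t < length w" "t \<notin> R" and "T \<subseteq> P"
  shows "(if transversal (insert t R) T
      then \<Sum>l | l \<in> circ R \<rightarrow>\<^sub>E UNIV \<and> kh_term m w (R, l) (insert t R, labelling (insert t R) T). c (R, l)
      else 0) = cross R t (evaluate c R) T"
  unfolding cross_def using evaluate_cross_merge[OF assms] evaluate_cross_split[OF assms] by simp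

lemma evaluate_kh_diff:
  assumes R: "R \<subseteq> {..<length w}" and T: "T \<subseteq> P"
  shows "evaluate (kh_diff m w c) R T = (\<Sum>t\<in>R. cross (R - {t}) t (evaluate c (R - {t})) T)"
proof -
  let ?h = "(R, labelling R T)"
  let ?L = "\<lambda>t. {l \<in> circ (R - {t}) \<rightarrow>\<^sub>E UNIV. kh_term m w (R - {t}, l) ?h}"
  have fin: "finite R" "finite (?L t)" for t
    using R finite_subset by (auto intro!: finite_PiE finite_circles finite_labels)
  have set: "{g. g \<in> generators m w \<and> kh_term m w g ?h} = (\<Union>t\<in>R. Pair (R - {t}) ` ?L t)"
  proof (intro equalityI subsetI)
    fix g assume g: "g \<in> {g. g \<in> generators m w \<and> kh_term m w g ?h}"
    obtain R' l where gl: "g = (R', l)" by (cases g)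
    obtain t where "t \<notin> R'" "R = insert t R'"
      using g kh_termD[of R' l R "labelling R T"] unfolding gl by blast
    then have "t \<in> R" "R' = R - {t}" by auto
    then show "g \<in> (\<Union>t\<in>R. Pair (R - {t}) ` ?L t)"
      using g unfolding gl by (auto simp: generators_iff)
  next
    fix g assume "g \<in> (\<Union>t\<in>R. Pair (R - {t}) ` ?L t)"
    then show "g \<in> {g. g \<in> generators m w \<and> kh_term m w g ?h}"
      using R by (auto simp: generators_iff)
  qed
  have "(\<Sum>g | g \<in> generators m w \<and> kh_term m w g ?h. c g) = (\<Sum>t\<in>R. \<Sum>g\<in>Pair (R - {t}) ` ?L t. c g)"
    unfolding set by (rule sum.UNION_disjoint) (use fin in auto)
  also have "\<dots> = (\<Sum>t\<in>R. \<Sum>l\<in>?L t. c (R - {t}, l))"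
    by (intro sum.cong HOL.refl, subst sum.reindex) (auto simp: inj_on_def)
  finally have sum: "(\<Sum>g | g \<in> generators m w \<and> kh_term m w g ?h. c g)
    = (\<Sum>t\<in>R. \<Sum>l\<in>?L t. c (R - {t}, l))" .
  have "?h \<in> generators m w" using R by (simp add: generators_iff labelling_def)
  then have "evaluate (kh_diff m w c) R T = (\<Sum>t\<in>R. if transversal R T then \<Sum>l\<in>?L t. c (R - {t}, l) else 0)"
    by (simp add: evaluate_def kh_diff_def sum)
  also have "\<dots> = (\<Sum>t\<in>R. cross (R - {t}) t (evaluate c (R - {t})) T)"
  proof (rule sum.cong[OF HOL.refl])
    fix t assume t: "t \<in> R"
    then have "insert t (R - {t}) = R" by auto
    then show "(if transversal R T then \<Sum>l\<in>?L t. c (R - {t}, l) else 0)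
        = cross (R - {t}) t (evaluate c (R - {t})) T"
      using evaluate_cross[of t "R - {t}" T c] t R T by auto
  qed
  finally show ?thesis .
qed

text \<open>Every labelling is seen by some evaluation, so a chain whose evaluations vanish is zero.\<close>
lemma ex_transversal:
  assumes l: "l \<in> circ R \<rightarrow>\<^sub>E UNIV"
  obtains T where "T \<subseteq> P" "transversal R T" "labelling R T = l"
proof -
  define pt where "pt C = (SOME p. p \<in> C)" for C :: "point set"
  have pt: "pt C \<in> C" if "C \<in> circ R" for C
    using circle_nonempty[OF that] unfolding pt_def by (simp add: some_in_eq)
  define T where "T = pt ` {C \<in> circ R. l C = Vplus}"
  have pt_iff: "pt C \<in> D \<longleftrightarrow> C = D" if "C \<in> circ R" "D \<in> circ R" for C D
    using circle_disjoint[OF that pt] pt that by auto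
  show thesis
  proof
    show sub: "T \<subseteq> P" unfolding T_def using pt circle_subset by blast
    show "transversal R T"
    proof (rule transversalI[OF sub])
      fix C p q assume C: "C \<in> circ R" "p \<in> T \<inter> C" "q \<in> T \<inter> C"
      have "r = pt C" if "r \<in> T \<inter> C" for r
      proof -
        obtain D where "r = pt D" "D \<in> circ R" using \<open>r \<in> T \<inter> C\<close> unfolding T_def by blast
        then show ?thesis using that C(1) pt_iff[of D C] by simp
      qed
      from this[OF C(2)] this[OF C(3)] show "p = q" by (rule HOL.trans[OF _ HOL.sym])
    qed
    have "T \<inter> C = {} \<longleftrightarrow> l C = Vminus" if "C \<in> circ R" for C
      using that pt_iff[of _ C] by (cases "l C") (auto simp: T_def)
    then have "labelling R T C = l C" for C
      using l by (cases "C \<in> circ R"; cases "l C") (auto simp: labelling_def PiE_def extensional_def)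
    then show "labelling R T = l" by auto
  qed
qed

lemma kh_diff_squared: "kh_diff m w (kh_diff m w c) = (\<lambda>g. 0)"
proof
  fix h :: generator
  obtain R l where h: "h = (R, l)" by (cases h)
  show "kh_diff m w (kh_diff m w c) h = 0"
  proof (cases "h \<in> generators m w")
    case True
    then have R: "R \<subseteq> {..<length w}" and l: "l \<in> circ R \<rightarrow>\<^sub>E UNIV"
      by (simp_all add: h generators_iff)
    obtain T where T: "T \<subseteq> P" "transversal R T" "labelling R T = l"
      using ex_transversal[OF l] .
    have fin: "finite R" using R finite_subset by auto
    let ?f = "\<lambda>t s. cross (R - {t}) t (cross (R - {t} - {s}) s (evaluate c (R - {t} - {s}))) T"
    have "kh_diff m w (kh_diff m w c) h = evaluate (kh_diff m w (kh_diff m w c)) R T"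
      using T by (simp add: evaluate_def h)
    also have "\<dots> = (\<Sum>t\<in>R. cross (R - {t}) t (evaluate (kh_diff m w c) (R - {t})) T)"
      by (rule evaluate_kh_diff[OF R T(1)])
    also have "\<dots> = (\<Sum>t\<in>R. \<Sum>s\<in>R - {t}. ?f t s)"
    proof (rule sum.cong[OF HOL.refl])
      fix t assume "t \<in> R"
      then have "t < length w" using R by auto
      then have "cross (R - {t}) t (evaluate (kh_diff m w c) (R - {t})) T
        = cross (R - {t}) t (\<lambda>T. \<Sum>s\<in>R - {t}. cross (R - {t} - {s}) s (evaluate c (R - {t} - {s})) T) T"
        using R by (intro cross_cong T evaluate_kh_diff) auto
      then show "cross (R - {t}) t (evaluate (kh_diff m w c) (R - {t})) T = (\<Sum>s\<in>R - {t}. ?f t s)"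
        by (simp add: cross_sum)
    qed
    also have "\<dots> = 0"
    proof (rule sum_symmetric_pairs_zero[OF bit_add_self fin])
      fix s t assume st: "s \<in> R" "t \<in> R" "s \<noteq> t"
      define Q where "Q = R - {s} - {t}"
      have "R - {s} = insert t Q" "R - {t} = insert s Q" "R - {t} - {s} = Q"
        using st by (auto simp: Q_def)
      moreover have "cross (insert t Q) s (cross Q t (evaluate c Q)) T
        = cross (insert s Q) t (cross Q s (evaluate c Q)) T"
        using st R by (intro cross_commute bit_add_self balanced_evaluate) (auto simp: Q_def)
      ultimately show "?f s t = ?f t s" by (simp add: Q_def)
    qed
    finally show ?thesis .
  qed (simp add: kh_diff_def)
qed

end

section \<open>Vector spaces over the field with two elements\<close>

text \<open>Dimensions over the field with two elements are logarithms of cardinalities, so ranks can be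
computed by counting.\<close>
lemma card_vectorspace_over_bit:
  fixes V :: "(bit, 'v, 'x) module_scheme"
  assumes "vectorspace class_ring V" and finV: "finite (carrier V)"
  shows "card (carrier V) = 2 ^ vectorspace.dim class_ring V"
proof -
  interpret vectorspace class_ring V by fact
  have "span (carrier V) = carrier V"
    using span_is_subset2 in_own_span by blast
  then have "fin_dim"
    unfolding fin_dim_def by (intro exI[of _ "carrier V"] conjI finV subset_refl)
  then obtain B where B: "finite B" "basis B"
    using finite_basis_exists by auto
  then have sub: "B \<subseteq> carrier V" and dim: "dim = card B"
    using dim_basis unfolding basis_def by auto
  let ?F = "B \<rightarrow>\<^sub>E (UNIV :: bit set)"
  have "\<forall>v\<in>carrier V. \<exists>!a. a \<in> ?F \<and> lincomb a B = v"
    using iffD1[OF basis_criterion[OF B(1) sub] B(2)] by (simp only: partial_object.simps) blast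
  then have ex1: "\<exists>!a. a \<in> ?F \<and> lincomb a B = v" if "v \<in> carrier V" for v
    using that by (rule bspec)
  have closed: "lincomb a B \<in> carrier V" for a
    by (rule lincomb_closed[OF sub]) simp
  have "bij_betw (\<lambda>a. lincomb a B) ?F (carrier V)"
  proof (rule bij_betwI')
    fix a b assume "a \<in> ?F" "b \<in> ?F"
    then show "lincomb a B = lincomb b B \<longleftrightarrow> a = b" using ex1[OF closed[of a]] by metis
  next
    fix v assume "v \<in> carrier V"
    from ex1[OF this] show "\<exists>a\<in>?F. v = lincomb a B" by metis
  qed (rule closed)
  from bij_betw_same_card[OF this] have "card (carrier V) = card ?F"
    by (rule HOL.sym)
  also have "\<dots> = 2 ^ card B"
  proof -
    have bits: "(UNIV :: bit set) = {0, 1}" by (auto intro: bit.exhaust)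
    have "card (UNIV :: bit set) = 2" unfolding bits by simp
    then show ?thesis using B(1) by (simp add: card_PiE)
  qed
  finally show ?thesis by (simp only: dim)
qed

text \<open>The scalars 0 and 1 can act in one way only, so all that is left of the module axioms is that twice any
vector is zero.\<close>
lemma vectorspace_over_bitI:
  fixes V :: "(bit, 'v, 'x) module_scheme"
  assumes "abelian_group V"
    and "\<And>x. x \<in> carrier V \<Longrightarrow> x \<oplus>\<^bsub>V\<^esub> x = \<zero>\<^bsub>V\<^esub>"
    and "\<And>x. x \<in> carrier V \<Longrightarrow> 0 \<odot>\<^bsub>V\<^esub> x = \<zero>\<^bsub>V\<^esub>"
    and "\<And>x. x \<in> carrier V \<Longrightarrow> 1 \<odot>\<^bsub>V\<^esub> x = x"
  shows "vectorspace class_ring V"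
proof -
  interpret abelian_group V by fact
  have "cring (class_ring :: bit ring)" "field (class_ring :: bit ring)"
    by (rule class_cring.is_cring class_field.field_axioms)+
  moreover have "module (class_ring :: bit ring) V"
  proof (rule Module.module.intro[OF calculation(1) assms(1)])
    have bits: "a = 0 \<or> a = 1" for a :: bit by (cases a) simp_all
    show "module_axioms class_ring V"
    proof (rule module_axioms.intro, goal_cases)
      case (1 a x) then show ?case using bits[of a] by (elim disjE) (simp_all add: assms(3,4))
    next
      case (2 a b x) then show ?case
        using bits[of a] bits[of b] by (elim disjE) (simp_all add: assms(2,3,4))
    next
      case (3 a x y) then show ?case using bits[of a] by (elim disjE) (simp_all add: assms(3,4))
    next
      case (4 a b x) then show ?case
        using bits[of a] bits[of b] by (elim disjE) (simp_all add: assms(3,4))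
    next
      case (5 x) then show ?case by (simp add: assms(4))
    qed
  qed
  ultimately show ?thesis by (intro vectorspace.intro)
qed

lemma quotient_space_over_bit:
  fixes V :: "(bit, 'v) module"
  assumes V: "vectorspace class_ring V"
    and W: "W \<subseteq> carrier V" "\<zero>\<^bsub>V\<^esub> \<in> W"
      "\<And>x y. x \<in> W \<Longrightarrow> y \<in> W \<Longrightarrow> x \<oplus>\<^bsub>V\<^esub> y \<in> W"
  shows "vectorspace class_ring (quotient_space V W)"
    and "finite (carrier V) \<Longrightarrow>
      card (carrier V) = card W * card (carrier (quotient_space V W))"
proof -
  interpret vectorspace class_ring V by fact
  have self: "x \<oplus>\<^bsub>V\<^esub> x = \<zero>\<^bsub>V\<^esub>" if x: "x \<in> carrier V" for x
  proof -
    have "x \<oplus>\<^bsub>V\<^esub> x = (1 + 1 :: bit) \<odot>\<^bsub>V\<^esub> x"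
      using smult_l_distr[of 1 1 x] smult_one[of x] x by simp
    also have "\<dots> = \<zero>\<^bsub>V\<^esub>" using lmult_0 x by simp
    finally show ?thesis .
  qed
  then have neg: "\<ominus>\<^bsub>V\<^esub> x = x" if "x \<in> carrier V" for x
    using that by (simp add: minus_equality)
  have subgrp: "additive_subgroup W V"
    unfolding additive_subgroup_def
    by (rule subgroup.intro) (use W neg in \<open>auto simp: a_inv_def[symmetric] subset_iff\<close>)
  interpret W: abelian_subgroup W V
    by (rule abelian_subgroupI3[OF subgrp]) unfold_locales
  interpret Q: comm_group "V A_Mod W"
    by (rule W.a_factorgroup_is_comm_group)
  let ?Q = "quotient_space V W"
  have carrier: "carrier ?Q = a_rcosets\<^bsub>V\<^esub> W" by (simp add: quotient_space_def)
  have ops: "X \<oplus>\<^bsub>?Q\<^esub> Y = X \<otimes>\<^bsub>V A_Mod W\<^esub> Y" "\<zero>\<^bsub>?Q\<^esub> = \<one>\<^bsub>V A_Mod W\<^esub>"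
    "carrier ?Q = carrier (V A_Mod W)" for X Y
    by (simp_all add: quotient_space_def A_FactGroup_def FactGroup_def A_RCOSETS_def set_add_def)
  have "abelian_group ?Q"
    by (rule abelian_groupI) (unfold ops, (rule Q.m_closed Q.one_closed Q.m_assoc Q.m_comm Q.l_one Q.l_inv_ex; assumption)+)
  moreover have "X \<oplus>\<^bsub>?Q\<^esub> X = \<zero>\<^bsub>?Q\<^esub>" "0 \<odot>\<^bsub>?Q\<^esub> X = \<zero>\<^bsub>?Q\<^esub>" "1 \<odot>\<^bsub>?Q\<^esub> X = X" if "X \<in> carrier ?Q" for X
  proof -
    have "\<exists>x\<in>carrier V. X = W +>\<^bsub>V\<^esub> x"
      using that unfolding carrier A_RCOSETS_def' by (simp only: UN_iff singleton_iff)
    then obtain x where x: "x \<in> carrier V" and X: "X = W +>\<^bsub>V\<^esub> x"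
      by (elim bexE)
    have sub: "X \<subseteq> carrier V" unfolding X using W(1) x by (rule a_r_coset_subset_G)
    have ne: "x \<in> X" using X x W.a_rcos_self by simp
    have zero: "W +>\<^bsub>V\<^esub> \<zero>\<^bsub>V\<^esub> = W" using W(1) by (simp add: a_coset_add_zero)
    show "X \<oplus>\<^bsub>?Q\<^esub> X = \<zero>\<^bsub>?Q\<^esub>"
      using W.a_rcos_sum[OF x x] self[OF x] zero by (simp add: quotient_space_def X)
    have "0 \<odot>\<^bsub>V\<^esub> y = \<zero>\<^bsub>V\<^esub>" if "y \<in> X" for y using lmult_0[of y] that sub by auto
    then show "0 \<odot>\<^bsub>?Q\<^esub> X = \<zero>\<^bsub>?Q\<^esub>"
      using ne zero by (auto simp: quotient_space_def)
    have "W +>\<^bsub>V\<^esub> (1 \<odot>\<^bsub>V\<^esub> y) = X" if "y \<in> X" for y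
    proof -
      have "y \<in> carrier V" using that sub by blast
      then have "1 \<odot>\<^bsub>V\<^esub> y = y" using smult_one[of y] by simp
      moreover have "W +>\<^bsub>V\<^esub> x = W +>\<^bsub>V\<^esub> y"
        using a_repr_independence[OF that[unfolded X] x] subgrp by (simp add: additive_subgroup_def)
      ultimately show ?thesis by (simp add: X)
    qed
    then show "1 \<odot>\<^bsub>?Q\<^esub> X = X" using ne by (auto simp: quotient_space_def)
  qed
  ultimately show "vectorspace class_ring ?Q" by (rule vectorspace_over_bitI)
  show "card (carrier V) = card W * card (carrier ?Q)" if "finite (carrier V)"
    using group.lagrange[OF a_group, of W] subgrp
    unfolding carrier A_RCOSETS_def additive_subgroup_def Coset.order_def
    by (metis mult.commute partial_object.select_convs(1))
qed

section \<open>Gradings and the Euler characteristic\<close>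

fun sign_of :: "label \<Rightarrow> int" where
  "sign_of Vplus = 1"
| "sign_of Vminus = - 1"

lemma sum_sign_of:
  assumes "finite A"
  shows "int (card {C \<in> A. l C = Vplus}) - int (card {C \<in> A. l C = Vminus}) = (\<Sum>C\<in>A. sign_of (l C))"
  using assms
proof (induction A rule: finite_induct)
  case (insert x A)
  have "{C \<in> insert x A. l C = v} = (if l x = v then insert x {C \<in> A. l C = v} else {C \<in> A. l C = v})" for v
    by auto
  then show ?case using insert by (cases "l x") simp_all
qed simp

text \<open>Parity of intersection numbers is all that the behaviour of the winding number grading depends on.\<close>
lemma nontrivial_Un:
  assumes "finite A" "finite B" "A \<inter> B = {}"
  shows "nontrivial (A \<union> B) \<longleftrightarrow> nontrivial A \<noteq> nontrivial B"
proof -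
  have fin: "finite {p. (0, p) \<in> X}" if "finite X" for X :: "point set"
    using finite_vimageI[OF that, of "Pair 0"] by (simp add: vimage_def inj_on_def)
  have "{p. (0, p) \<in> A \<union> B} = {p. (0, p) \<in> A} \<union> {p. (0, p) \<in> B}" by auto
  then have "card {p. (0, p) \<in> A \<union> B} = card {p. (0, p) \<in> A} + card {p. (0, p) \<in> B}"
    using assms(3) by (simp add: card_Un_disjoint fin assms(1,2) disjoint_iff)
  then show ?thesis by (simp add: nontrivial_def)
qed

definition parity_sign :: "int \<Rightarrow> 'a::comm_ring_1" where
  "parity_sign i = (-1) ^ nat \<bar>i\<bar>"

lemma parity_sign_even: "parity_sign i = (if even i then 1 else - 1)"
  by (simp add: parity_sign_def even_nat_iff)

context braid_diagram begin

lemma q_deg_sum: "q_deg m w (R, l)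
    = (\<Sum>C\<in>circ R. sign_of (l C)) + int (card R) + int (n_pos w) - 2 * int (n_neg w)"
  by (simp add: q_deg_def sum_sign_of[OF finite_circles])

lemma wind_deg_sum: "wind_deg m w (R, l) = (\<Sum>C\<in>circ R. if nontrivial C then sign_of (l C) else 0)"
proof -
  have "wind_deg m w (R, l) = (\<Sum>C\<in>{C \<in> circ R. nontrivial C}. sign_of (l C))"
    using sum_sign_of[of "{C \<in> circ R. nontrivial C}" l]
    by (simp add: wind_deg_def finite_circles conj_assoc)
  then show ?thesis by (simp add: sum.inter_filter finite_circles)
qed

lemma finite_circle: "C \<in> circ R \<Longrightarrow> finite C"
  using circle_subset finite_points finite_subset by blast

text \<open>Among the three circles of a merge or a split either none or two are nontrivial. If there are two, then
a pair labelled with both signs or plus twice disappears, a pair labelled with both signs or minus twice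
appears, or a nontrivial circle is replaced by a nontrivial one, whose label may change from plus to
minus only. None of this increases the winding number grading.\<close>
lemma kh_term_degrees:
  assumes kterm: "kh_term m w (R, l) (R', l')" and R: "R \<subseteq> {..<length w}"
  shows "hom_deg w (R', l') = hom_deg w (R, l) + 1"
    and "q_deg m w (R', l') = q_deg m w (R, l)"
    and "wind_deg m w (R', l') \<le> wind_deg m w (R, l)"
proof -
  obtain t where t: "t < length w" "t \<notin> R" and R': "R' = insert t R"
    by (rule kh_termD[OF kterm])
  have "finite R" using R finite_subset by blast
  then have card: "card R' = card R + 1" using t R' by simp
  then show "hom_deg w (R', l') = hom_deg w (R, l) + 1" by (simp add: hom_deg_def)
  let ?f = "\<lambda>l C. if nontrivial C then sign_of (l C) else 0"
  have "(\<Sum>C\<in>circ R'. sign_of (l' C)) + 1 = (\<Sum>C\<in>circ R. sign_of (l C)) \<and>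
    (\<Sum>C\<in>circ R'. ?f l' C) \<le> (\<Sum>C\<in>circ R. ?f l C)"
  proof (cases "(lo t, hi t) \<in> cn R")
    case False
    obtain A B K where X: "circ R = {A, B} \<union> K" "circ (insert t R) = {A \<union> B} \<union> K"
      "\<forall>D\<in>K. D \<noteq> {} \<and> D \<inter> (A \<union> B) = {}" "A \<inter> B = {}" and ab: "lo t \<in> A" "hi t \<in> B"
      by (rule merge_circles[OF t False])
    have ne: "A \<noteq> {}" "B \<noteq> {}" using ab by auto
    note d = differences_merge[OF X ne]
    have K: "\<And>D. D \<in> K \<Longrightarrow> l' D = l D" and AB: "l' (A \<union> B) \<in> merge_map (l A) (l B)"
      using kterm kh_term_merge_iff[OF t X ne] unfolding R' by blast+
    have finK: "finite K" using finite_circles[of R] X(1) by simp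
    have sums: "(\<Sum>C\<in>circ R. f C) = f A + f B + (\<Sum>C\<in>K. f C)"
      "(\<Sum>C\<in>circ R'. f C) = f (A \<union> B) + (\<Sum>C\<in>K. f C)" for f :: "point set \<Rightarrow> int"
      unfolding R' X using d finK by simp_all
    have "finite A" "finite B" using X(1) finite_circle[of _ R] by auto
    note nt = nontrivial_Un[OF this X(4)]
    have "(\<Sum>C\<in>K. sign_of (l' C)) = (\<Sum>C\<in>K. sign_of (l C))" "(\<Sum>C\<in>K. ?f l' C) = (\<Sum>C\<in>K. ?f l C)"
      using K by (auto intro: sum.cong)
    then show ?thesis
      unfolding sums using AB nt by (cases "l A"; cases "l B") auto
  next
    case True
    obtain A B K where X: "circ (insert t R) = {A, B} \<union> K" "circ R = {A \<union> B} \<union> K"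
      "\<forall>D\<in>K. D \<noteq> {} \<and> D \<inter> (A \<union> B) = {}" "A \<inter> B = {}" and ab: "lo t \<in> A" "hi t \<in> B"
      by (rule split_circles[OF t True])
    have ne: "A \<noteq> {}" "B \<noteq> {}" using ab by auto
    note d = differences_merge[OF X ne]
    have K: "\<And>D. D \<in> K \<Longrightarrow> l' D = l D" and AB: "(l' A, l' B) \<in> split_map (l (A \<union> B))"
      using kterm kh_term_split_iff[OF t X ne] unfolding R' by blast+
    have finK: "finite K" using finite_circles[of R] X(2) by simp
    have sums: "(\<Sum>C\<in>circ R'. f C) = f A + f B + (\<Sum>C\<in>K. f C)"
      "(\<Sum>C\<in>circ R. f C) = f (A \<union> B) + (\<Sum>C\<in>K. f C)" for f :: "point set \<Rightarrow> int"
      unfolding R' X using d finK by simp_all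
    have "finite A" "finite B" using X(1) finite_circle[of _ "insert t R"] by auto
    note nt = nontrivial_Un[OF this X(4)]
    have "(\<Sum>C\<in>K. sign_of (l' C)) = (\<Sum>C\<in>K. sign_of (l C))" "(\<Sum>C\<in>K. ?f l' C) = (\<Sum>C\<in>K. ?f l C)"
      using K by (auto intro: sum.cong)
    then show ?thesis
      unfolding sums using AB nt by (cases "l (A \<union> B)") auto
  qed
  then show "q_deg m w (R', l') = q_deg m w (R, l)" "wind_deg m w (R', l') \<le> wind_deg m w (R, l)"
    by (simp_all add: q_deg_sum wind_deg_sum card)
qed

definition graded_gens :: "int \<Rightarrow> int \<Rightarrow> int \<Rightarrow> generator set" where
  "graded_gens i j k = {g \<in> generators m w. hom_deg w g = i \<and> q_deg m w g = j \<and> wind_deg m w g = k}"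

abbreviation "ch i j k \<equiv> carrier (chain_space m w i j k)"
abbreviation "dif \<equiv> annular_diff m w"

lemma chains_iff: "c \<in> ch i j k \<longleftrightarrow> (\<forall>g. g \<notin> graded_gens i j k \<longrightarrow> c g = 0)"
  unfolding chain_space_def graded_gens_def by (simp only: partial_object.simps mem_Collect_eq) blast

lemma chain_zero: "c \<in> ch i j k \<Longrightarrow> g \<notin> graded_gens i j k \<Longrightarrow> c g = 0"
  unfolding chains_iff by blast

lemma generator_degrees:
  assumes "g \<in> generators m w" "kh_term m w g h"
  shows "hom_deg w h = hom_deg w g + 1" "q_deg m w h = q_deg m w g" "wind_deg m w h \<le> wind_deg m w g"
proof -
  obtain R l R' l' where gh: "g = (R, l)" "h = (R', l')" by (cases g; cases h)
  have "R \<subseteq> {..<length w}" using assms(1) by (simp add: gh generators_iff)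
  from kh_term_degrees[OF assms(2)[unfolded gh] this]
  show "hom_deg w h = hom_deg w g + 1" "q_deg m w h = q_deg m w g" "wind_deg m w h \<le> wind_deg m w g"
    by (simp_all add: gh)
qed

lemma annular_diff_chains:
  assumes c: "c \<in> ch i j k"
  shows "dif c \<in> ch (i + 1) j k"
  unfolding chains_iff
proof (intro allI impI)
  fix h assume h: "h \<notin> graded_gens (i + 1) j k"
  have "c g = 0" if "g \<in> generators m w" "kh_term m w g h" "wind_deg m w g = wind_deg m w h" "h \<in> generators m w" for g
    by (rule chain_zero[OF c])
      (use that h generator_degrees(1,2)[OF that(1,2)] in \<open>auto simp: graded_gens_def\<close>)
  then show "dif c h = 0" unfolding annular_diff_def by (auto intro: sum.neutral)
qed

lemma annular_diff_add: "dif (\<lambda>g. c g + d g) = (\<lambda>g. dif c g + dif d g)"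
  unfolding annular_diff_def sum.distrib by (rule ext) simp

lemma annular_diff_eq_kh_diff:
  assumes c: "c \<in> ch i j k"
  shows "dif c h = (if wind_deg m w h = k then kh_diff m w c h else 0)"
proof (cases "h \<in> generators m w")
  case True
  have zero: "c g = 0" if "wind_deg m w g \<noteq> k" for g
    by (rule chain_zero[OF c]) (use that in \<open>simp add: graded_gens_def\<close>)
  show ?thesis
  proof (cases "wind_deg m w h = k")
    case eq: True
    have "(\<Sum>g | g \<in> generators m w \<and> kh_term m w g h \<and> wind_deg m w g = wind_deg m w h. c g)
      = (\<Sum>g | g \<in> generators m w \<and> kh_term m w g h. c g)"
      using finite_generators by (intro sum.mono_neutral_left) (auto simp: eq zero)
    then show ?thesis using True eq by (simp only: annular_diff_def kh_diff_def if_True simp_thms)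
  next
    case neq: False
    then have "c g = 0" if "wind_deg m w g = wind_deg m w h" for g using that zero by simp
    then have "(\<Sum>g | g \<in> generators m w \<and> kh_term m w g h \<and> wind_deg m w g = wind_deg m w h. c g) = 0"
      by (intro sum.neutral) auto
    then show ?thesis using neq by (simp add: annular_diff_def)
  qed
qed (simp add: annular_diff_def kh_diff_def)

text \<open>The full differential never increases the winding number grading, so the part that preserves it inherits
that the square is zero: a composition from grading \<open>k\<close> to grading \<open>k\<close> cannot leave this
grading in between.\<close>
lemma annular_diff_squared:
  assumes c: "c \<in> ch i j k"
  shows "dif (dif c) = (\<lambda>g. 0)"
proof
  fix h
  have zero: "c g = 0" if "wind_deg m w g \<noteq> k" for g
    by (rule chain_zero[OF c]) (use that in \<open>simp add: graded_gens_def\<close>)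
  have "kh_diff m w (dif c) h = kh_diff m w (kh_diff m w c) h"
    if k: "wind_deg m w h = k" and h: "h \<in> generators m w"
  proof -
    have "dif c x = kh_diff m w c x" if x: "x \<in> generators m w" "kh_term m w x h" for x
    proof (cases "wind_deg m w x = k")
      case False
      then have "k < wind_deg m w x" using generator_degrees(3)[OF x] k by simp
      then have "c g = 0" if "g \<in> generators m w" "kh_term m w g x" for g
        using generator_degrees(3)[OF that] by (intro zero) auto
      then have "kh_diff m w c x = 0" unfolding kh_diff_def by (auto intro: sum.neutral)
      then show ?thesis using False annular_diff_eq_kh_diff[OF c] by simp
    qed (simp add: annular_diff_eq_kh_diff[OF c])
    then have "(\<Sum>x | x \<in> generators m w \<and> kh_term m w x h. dif c x)
      = (\<Sum>x | x \<in> generators m w \<and> kh_term m w x h. kh_diff m w c x)"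
      by (intro sum.cong) auto
    then show ?thesis using h by (simp only: kh_diff_def if_True)
  qed
  moreover have "kh_diff m w (dif c) h = 0" if "h \<notin> generators m w"
    using that by (simp add: kh_diff_def)
  ultimately show "dif (dif c) h = 0"
    using annular_diff_eq_kh_diff[OF annular_diff_chains[OF c]] kh_diff_squared
    by (cases "h \<in> generators m w") auto
qed

lemma chain_space_sub:
  assumes "0 \<in> Z" "\<And>c d. c \<in> Z \<Longrightarrow> d \<in> Z \<Longrightarrow> c + d \<in> Z"
  shows "vectorspace class_ring ((chain_space m w i j k)\<lparr>carrier := Z\<rparr>)"
proof (rule vectorspace_over_bitI)
  let ?V = "(chain_space m w i j k)\<lparr>carrier := Z\<rparr>"
  have ops: "carrier ?V = Z" "c \<oplus>\<^bsub>?V\<^esub> d = c + d" "\<zero>\<^bsub>?V\<^esub> = 0" "a \<odot>\<^bsub>?V\<^esub> c = (\<lambda>g. a * c g)" for c d a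
    by (simp_all add: chain_space_def plus_fun_def zero_fun_def)
  have self: "c + c = 0" for c :: chain by (rule ext) (simp only: plus_fun_def zero_fun_def bit_add_self)
  show "abelian_group ?V"
    by (rule abelian_groupI; unfold ops)
      (use assms(2) in blast, rule assms(1), rule add.assoc, rule add.commute, rule add_0_left,
        use self in blast)
  show "x \<oplus>\<^bsub>?V\<^esub> x = \<zero>\<^bsub>?V\<^esub>" "0 \<odot>\<^bsub>?V\<^esub> x = \<zero>\<^bsub>?V\<^esub>" "1 \<odot>\<^bsub>?V\<^esub> x = x" for x
    unfolding ops by (simp_all only: self zero_fun_def mult_zero_left mult_1_left)
qed

lemma finite_chains: "finite (ch i j k)"
  and card_chains: "card (ch i j k) = 2 ^ card (graded_gens i j k)"
proof -
  have fin: "finite (graded_gens i j k)"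
    unfolding graded_gens_def using finite_generators by simp
  have bits: "(UNIV :: bit set) = {0, 1}" by (auto intro: bit.exhaust)
  have bij: "bij_betw (\<lambda>c. restrict c (graded_gens i j k)) (ch i j k) (graded_gens i j k \<rightarrow>\<^sub>E (UNIV :: bit set))"
  proof (rule bij_betw_byWitness[where f' = "\<lambda>c g. if g \<in> graded_gens i j k then c g else 0"])
    show "\<forall>c\<in>ch i j k. (\<lambda>g. if g \<in> graded_gens i j k then restrict c (graded_gens i j k) g else 0) = c"
    proof (intro ballI ext)
      fix c g assume "c \<in> ch i j k"
      then show "(if g \<in> graded_gens i j k then restrict c (graded_gens i j k) g else 0) = c g"
        using chain_zero[of c i j k g] by (cases "g \<in> graded_gens i j k") simp_all
    qed
    show "\<forall>c\<in>graded_gens i j k \<rightarrow>\<^sub>E UNIV. restrict (\<lambda>g. if g \<in> graded_gens i j k then c g else 0) (graded_gens i j k) = c"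
      by (auto simp: PiE_def extensional_def fun_eq_iff restrict_def)
  qed (auto simp: chains_iff)
  have finPi: "finite (graded_gens i j k \<rightarrow>\<^sub>E (UNIV :: bit set))"
    by (intro finite_PiE fin) (unfold bits, simp)
  show "finite (ch i j k)" using bij_betw_finite[OF bij] finPi by blast
  have "card (UNIV :: bit set) = 2" unfolding bits by simp
  then show "card (ch i j k) = 2 ^ card (graded_gens i j k)"
    using bij_betw_same_card[OF bij] by (simp add: card_PiE fin)
qed

lemma zero_chain: "0 \<in> ch i j k" and add_chains: "c \<in> ch i j k \<Longrightarrow> d \<in> ch i j k \<Longrightarrow> c + d \<in> ch i j k"
  unfolding chains_iff by (auto simp: zero_fun_def plus_fun_def)

lemma dif_zero: "dif 0 = 0"
  unfolding annular_diff_def zero_fun_def by (rule ext) simp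

lemma dif_add: "dif (c + d) = dif c + dif d"
  using annular_diff_add[of c d] by (simp only: plus_fun_def)

lemma cycles_iff: "c \<in> cycles m w i j k \<longleftrightarrow> c \<in> ch i j k \<and> dif c = 0"
  by (simp add: cycles_def zero_fun_def)

text \<open>The ranks of the spaces of boundaries cancel in the alternating sum of the ranks of homology.\<close>
definition boundary_rank :: "int \<Rightarrow> int \<Rightarrow> int \<Rightarrow> nat" where
  "boundary_rank i j k = vectorspace.dim class_ring ((chain_space m w i j k)\<lparr>carrier := boundaries m w i j k\<rparr>)"

lemma boundaries_space: "0 \<in> boundaries m w i j k"
  "c \<in> boundaries m w i j k \<Longrightarrow> d \<in> boundaries m w i j k \<Longrightarrow> c + d \<in> boundaries m w i j k"
proof -
  show "0 \<in> boundaries m w i j k"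
    unfolding boundaries_def using zero_chain dif_zero by (metis imageI)
  assume "c \<in> boundaries m w i j k" "d \<in> boundaries m w i j k"
  then show "c + d \<in> boundaries m w i j k"
    unfolding boundaries_def using add_chains dif_add by (smt (verit) imageE imageI)
qed

lemma cycles_space: "0 \<in> cycles m w i j k"
  "c \<in> cycles m w i j k \<Longrightarrow> d \<in> cycles m w i j k \<Longrightarrow> c + d \<in> cycles m w i j k"
  unfolding cycles_iff using zero_chain dif_zero add_chains dif_add by auto

lemma boundaries_subset: "boundaries m w i j k \<subseteq> cycles m w i j k"
proof
  fix b assume "b \<in> boundaries m w i j k"
  then obtain c where c: "c \<in> ch (i - 1) j k" "b = dif c" unfolding boundaries_def by blast
  then show "b \<in> cycles m w i j k"
    using annular_diff_chains[OF c(1)] annular_diff_squared[OF c(1)] by (simp add: cycles_iff zero_fun_def)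
qed

lemma card_boundaries: "card (boundaries m w i j k) = 2 ^ boundary_rank i j k"
proof -
  let ?V = "(chain_space m w i j k)\<lparr>carrier := boundaries m w i j k\<rparr>"
  have "vectorspace class_ring ?V" by (rule chain_space_sub[OF boundaries_space])
  moreover have "finite (boundaries m w i j k)"
    unfolding boundaries_def by (intro finite_imageI finite_chains)
  then have "finite (carrier ?V)" by simp
  ultimately have "card (carrier ?V) = 2 ^ boundary_rank i j k"
    unfolding boundary_rank_def by (rule card_vectorspace_over_bit)
  then show ?thesis by simp
qed

lemma card_cycles: "card (cycles m w i j k) = 2 ^ (boundary_rank i j k + rk_SKh m w i j k)"
proof -
  let ?V = "(chain_space m w i j k)\<lparr>carrier := cycles m w i j k\<rparr>"
  let ?W = "boundaries m w i j k"
  have V: "vectorspace class_ring ?V" by (rule chain_space_sub[OF cycles_space])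
  have ops: "carrier ?V = cycles m w i j k" "c \<oplus>\<^bsub>?V\<^esub> d = c + d" "\<zero>\<^bsub>?V\<^esub> = 0" for c d
    by (simp_all add: chain_space_def plus_fun_def zero_fun_def)
  have fin: "finite (carrier ?V)"
    unfolding ops using finite_chains by (rule finite_subset[rotated]) (auto simp: cycles_iff)
  have W: "?W \<subseteq> carrier ?V" "\<zero>\<^bsub>?V\<^esub> \<in> ?W" "\<And>x y. x \<in> ?W \<Longrightarrow> y \<in> ?W \<Longrightarrow> x \<oplus>\<^bsub>?V\<^esub> y \<in> ?W"
    unfolding ops by (fact boundaries_subset boundaries_space)+
  have Q1: "vectorspace class_ring (quotient_space ?V ?W)"
    by (rule quotient_space_over_bit(1)[OF V W(1,2)]) (rule W(3))
  have Q2: "card (carrier ?V) = card ?W * card (carrier (quotient_space ?V ?W))"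
    by (rule quotient_space_over_bit(2)[OF V W(1,2) _ fin]) (rule W(3))
  have "finite (carrier (quotient_space ?V ?W))"
  proof -
    have "carrier ?V \<noteq> {}" unfolding ops using cycles_space(1) by blast
    then have nonzero: "card (carrier ?V) \<noteq> 0" using fin card_0_eq by blast
    have "card (carrier (quotient_space ?V ?W)) \<noteq> 0"
    proof
      assume zero: "card (carrier (quotient_space ?V ?W)) = 0"
      have "card (carrier ?V) = 0" unfolding Q2 zero by (rule mult_0_right)
      with nonzero show False by contradiction
    qed
    then show ?thesis by (rule contrapos_np) (rule card.infinite)
  qed
  from card_vectorspace_over_bit[OF Q1 this]
  have "card (carrier (quotient_space ?V ?W)) = 2 ^ rk_SKh m w i j k"
    unfolding rk_SKh_def SKh_def .
  then show ?thesis
    using Q2 card_boundaries unfolding ops by (simp only: power_add)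
qed

text \<open>The fibres of the differential are translates of the space of cycles.\<close>
lemma card_chains_kernel_image:
  "card (ch i j k) = card (cycles m w i j k) * card (boundaries m w (i + 1) j k)"
proof -
  let ?C = "ch i j k"
  have img: "boundaries m w (i + 1) j k = dif ` ?C" by (simp add: boundaries_def)
  have "card {c \<in> ?C. dif c = b} = card (cycles m w i j k)" if b: "b \<in> dif ` ?C" for b
  proof -
    from b obtain c0 where c0: "c0 \<in> ?C" "dif c0 = b" by auto
    have self: "c + c = 0" for c :: chain by (rule ext) (simp only: plus_fun_def zero_fun_def bit_add_self)
    have cancel: "c0 + (c0 + c) = c" for c by (simp only: add.assoc[symmetric] self add_0_left)
    have "bij_betw ((+) c0) (cycles m w i j k) {c \<in> ?C. dif c = b}"
      by (rule bij_betw_byWitness[where f' = "(+) c0"])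
        (use cancel c0 self add_chains in \<open>auto simp: cycles_iff dif_add simp del: plus_fun_apply\<close>)
    from bij_betw_same_card[OF this] show ?thesis by (rule HOL.sym)
  qed
  moreover have "card ?C = (\<Sum>b\<in>dif ` ?C. card {c \<in> ?C. dif c = b})"
    using sum.image_gen[OF finite_chains, of "\<lambda>_. 1::nat" i j k dif] by simp
  ultimately show ?thesis by (simp add: img)
qed

lemma rank_relation: "card (graded_gens i j k) = rk_SKh m w i j k + boundary_rank i j k + boundary_rank (i + 1) j k"
proof -
  have "(2::nat) ^ card (graded_gens i j k) = 2 ^ (boundary_rank i j k + rk_SKh m w i j k + boundary_rank (i + 1) j k)"
    using card_chains_kernel_image[of i j k] unfolding card_chains card_cycles card_boundaries power_add .
  then show ?thesis by simp
qed

lemma rk_SKh_neq_zero_graded: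
  assumes "rk_SKh m w i j k \<noteq> 0"
  obtains g where "g \<in> generators m w" "hom_deg w g = i" "q_deg m w g = j" "wind_deg m w g = k"
proof -
  have "graded_gens i j k \<noteq> {}" using rank_relation[of i j k] assms by auto
  then show ?thesis using that unfolding graded_gens_def by blast
qed

lemma hom_deg_range:
  assumes "g \<in> generators m w"
  shows "hom_deg w g \<in> {- int (n_neg w)..int (length w) - int (n_neg w)}"
proof -
  obtain R l where g: "g = (R, l)" by (cases g)
  then have "R \<subseteq> {..<length w}" using assms by (simp add: generators_iff)
  then have "card R \<le> length w" using card_mono[of "{..<length w}" R] by simp
  then show ?thesis by (simp add: g hom_deg_def)
qed

lemma boundary_rank_high:
  assumes "\<And>g. g \<in> generators m w \<Longrightarrow> hom_deg w g \<noteq> i"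
  shows "boundary_rank i j k = 0"
proof -
  have "graded_gens i j k = {}" using assms by (auto simp: graded_gens_def)
  then show ?thesis using rank_relation[of i j k] by simp
qed

lemma boundary_rank_low:
  assumes "\<And>g. g \<in> generators m w \<Longrightarrow> hom_deg w g \<noteq> i - 1"
  shows "boundary_rank i j k = 0"
proof -
  have "graded_gens (i - 1) j k = {}" using assms by (auto simp: graded_gens_def)
  then show ?thesis using rank_relation[of "i - 1" j k] by simp
qed

text \<open>The ranks of the boundaries enter twice with opposite signs, in degrees \<open>i\<close> and \<open>i - 1\<close>. At the
two ends of the range they vanish, because there is no generator to map from or to.\<close>
lemma alternating_rank_sum:
  defines "I \<equiv> {- int (n_neg w)..int (length w) - int (n_neg w)}"
  shows "(\<Sum>i\<in>I. parity_sign i * (of_nat (rk_SKh m w i j k) :: 'a::comm_ring_1))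
    = (\<Sum>i\<in>I. parity_sign i * of_nat (card (graded_gens i j k)))"
proof -
  let ?b = "\<lambda>i. of_nat (boundary_rank i j k) :: 'a"
  let ?J = "{- int (n_neg w)..int (length w) - int (n_neg w) + 1}"
  have low: "boundary_rank (- int (n_neg w)) j k = 0"
    using hom_deg_range by (intro boundary_rank_low) fastforce
  have high: "boundary_rank (int (length w) - int (n_neg w) + 1) j k = 0"
    using hom_deg_range by (intro boundary_rank_high) fastforce
  have "(\<Sum>i\<in>I. parity_sign i * ?b (i + 1)) = (\<Sum>i\<in>(\<lambda>i. i + 1) ` I. - parity_sign i * ?b i)"
    by (subst sum.reindex) (auto simp: parity_sign_even intro!: sum.cong)
  also have "\<dots> = (\<Sum>i\<in>?J. - parity_sign i * ?b i)"
  proof (rule sum.mono_neutral_left)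
    show "\<forall>i\<in>?J - (\<lambda>i. i + 1) ` I. - parity_sign i * ?b i = 0"
    proof
      fix i assume "i \<in> ?J - (\<lambda>i. i + 1) ` I"
      then have "i = - int (n_neg w)" by (auto simp: I_def)
      then show "- parity_sign i * ?b i = 0" using low by simp
    qed
  qed (auto simp: I_def)
  also have "\<dots> = (\<Sum>i\<in>I. - parity_sign i * ?b i)"
  proof (rule sum.mono_neutral_right)
    show "\<forall>i\<in>?J - I. - parity_sign i * ?b i = 0"
    proof
      fix i assume "i \<in> ?J - I"
      then have "i = int (length w) - int (n_neg w) + 1" unfolding I_def by auto
      then show "- parity_sign i * ?b i = 0" using high by simp
    qed
  qed (auto simp: I_def)
  finally have shift: "(\<Sum>i\<in>I. parity_sign i * ?b (i + 1)) = - (\<Sum>i\<in>I. parity_sign i * ?b i)"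
    by (simp add: sum_negf)
  have "(\<Sum>i\<in>I. parity_sign i * of_nat (card (graded_gens i j k)))
      = (\<Sum>i\<in>I. parity_sign i * (of_nat (rk_SKh m w i j k) :: 'a))
        + ((\<Sum>i\<in>I. parity_sign i * ?b i) + (\<Sum>i\<in>I. parity_sign i * ?b (i + 1)))"
    by (simp add: rank_relation distrib_left sum.distrib add.assoc)
  then show ?thesis by (simp add: shift)
qed

lemma q_poly_state_sum:
  "q_poly m w k = (\<Sum>g | g \<in> generators m w \<and> wind_deg m w g = k.
     parity_sign (hom_deg w g) * y_power (q_deg m w g))"
proof -
  let ?I = "{- int (n_neg w)..int (length w) - int (n_neg w)}"
  let ?J = "q_deg m w ` generators m w"
  let ?G = "{g. g \<in> generators m w \<and> wind_deg m w g = k}"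
  have finG: "finite ?G" using finite_generators by simp
  have "q_poly m w k = (\<Sum>(i, j)\<in>?I \<times> ?J. parity_sign i * y_power j * of_nat (rk_SKh m w i j k))"
    unfolding q_poly_def parity_sign_def
  proof (rule sum.mono_neutral_left)
    show "finite (?I \<times> ?J)" using finite_generators by simp
    show "{(i, j). rk_SKh m w i j k \<noteq> 0} \<subseteq> ?I \<times> ?J"
    proof
      fix x assume "x \<in> {(i, j). rk_SKh m w i j k \<noteq> 0}"
      then obtain i j where x: "x = (i, j)" and "rk_SKh m w i j k \<noteq> 0" by auto
      then obtain g where "g \<in> generators m w" "hom_deg w g = i" "q_deg m w g = j"
        using rk_SKh_neq_zero_graded by blast
      then show "x \<in> ?I \<times> ?J" using hom_deg_range[of g] x by auto
    qed
  qed auto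
  also have "\<dots> = (\<Sum>j\<in>?J. y_power j * (\<Sum>i\<in>?I. parity_sign i * of_nat (rk_SKh m w i j k)))"
    unfolding sum.cartesian_product[symmetric] sum_distrib_left
    by (subst sum.swap) (simp add: algebra_simps)
  also have "\<dots> = (\<Sum>j\<in>?J. y_power j * (\<Sum>i\<in>?I. parity_sign i * of_nat (card (graded_gens i j k))))"
    by (simp only: alternating_rank_sum)
  also have "\<dots> = (\<Sum>(i, j)\<in>?I \<times> ?J. parity_sign i * y_power j * of_nat (card (graded_gens i j k)))"
    unfolding sum.cartesian_product[symmetric] sum_distrib_left
    by (subst sum.swap) (simp add: algebra_simps)
  also have "\<dots> = (\<Sum>x\<in>?I \<times> ?J. \<Sum>g\<in>{g \<in> ?G. (hom_deg w g, q_deg m w g) = x}.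
      parity_sign (hom_deg w g) * y_power (q_deg m w g))"
  proof (rule sum.cong[OF HOL.refl], clarify)
    fix i j
    have "{g \<in> ?G. (hom_deg w g, q_deg m w g) = (i, j)} = graded_gens i j k"
      by (auto simp: graded_gens_def)
    moreover have "(\<Sum>g\<in>graded_gens i j k. parity_sign (hom_deg w g) * y_power (q_deg m w g))
      = (\<Sum>g\<in>graded_gens i j k. parity_sign i * y_power j)"
      by (rule sum.cong) (auto simp: graded_gens_def)
    ultimately show "parity_sign i * y_power j * of_nat (card (graded_gens i j k))
      = (\<Sum>g\<in>{g \<in> ?G. (hom_deg w g, q_deg m w g) = (i, j)}. parity_sign (hom_deg w g) * y_power (q_deg m w g))"
      by (simp add: mult.commute)
  qed
  also have "\<dots> = (\<Sum>g\<in>?G. parity_sign (hom_deg w g) * y_power (q_deg m w g))"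
    by (rule sum.group[OF finG]) (use finite_generators hom_deg_range in auto)
  finally show ?thesis .
qed

end

section \<open>The circles of one resolution\<close>

context braid_diagram begin

text \<open>A resolution is described by the set of its crossings that are not resolved along the orientation of
the braid. Between consecutive crossings of this kind all strands are vertical.\<close>
definition unoriented :: "nat set \<Rightarrow> nat set" where
  "unoriented R = {t. t < length w \<and> \<not> oriented_at w R t}"

abbreviation ix :: "nat \<Rightarrow> nat" where "ix t \<equiv> fst (w ! t)"

lemma ix_less: "t < length w \<Longrightarrow> Suc (ix t) < m"
  by (rule braid_words_nth[OF word])

lemma arc_conn: "(x, y) \<in> arcs m w R \<Longrightarrow> (x, y) \<in> cn R"
  unfolding conn_def by blast

lemma conn_closing: "p < m \<Longrightarrow> ((length w, p), (0, p)) \<in> cn R"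
  by (intro arc_conn arcs.closing)

lemma conn_straight:
  assumes "t < length w" "p < m" "t \<notin> unoriented R \<or> p \<noteq> ix t \<and> p \<noteq> Suc (ix t)"
  shows "((t, p), (Suc t, p)) \<in> cn R"
proof (rule arc_conn, cases "p = ix t \<or> p = Suc (ix t)")
  case True
  then have "oriented_at w R t" using assms by (auto simp: unoriented_def)
  then show "((t, p), (Suc t, p)) \<in> arcs m w R"
    using True assms(1) arcs.oriented_left[of t w R m] arcs.oriented_right[of t w R m] by auto
next
  case False
  then show "((t, p), (Suc t, p)) \<in> arcs m w R"
    using assms by (intro arcs.strand) auto
qed

lemma conn_cap: "t \<in> unoriented R \<Longrightarrow> ((t, ix t), (t, Suc (ix t))) \<in> cn R"
  by (intro arc_conn arcs.cap) (auto simp: unoriented_def)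

lemma conn_cup: "t \<in> unoriented R \<Longrightarrow> ((Suc t, ix t), (Suc t, Suc (ix t))) \<in> cn R"
  by (intro arc_conn arcs.cup) (auto simp: unoriented_def)

lemma conn_invariant:
  assumes "(x, y) \<in> cn R" and "\<And>x y. (x, y) \<in> arcs m w R \<Longrightarrow> f x = f y"
  shows "f x = f y"
  using assms(1) unfolding conn_def
proof (induction rule: rtrancl_induct)
  case (step y z)
  then have "f y = f z" using assms(2)[of y z] assms(2)[of z y] by auto
  then show ?case using step.IH by simp
qed simp

text \<open>The arcs in a form where crossings that respect the orientation do not differ from the absence of a
crossing.\<close>
lemma arc_invariant:
  assumes "(x, y) \<in> arcs m w R"
    and closing: "\<And>p. p < m \<Longrightarrow> f (length w, p) = f (0, p)"
    and straight: "\<And>t p. t < length w \<Longrightarrow> p < m \<Longrightarrow> t \<notin> unoriented R \<or> p \<noteq> ix t \<and> p \<noteq> Suc (ix t)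
      \<Longrightarrow> f (t, p) = f (Suc t, p)"
    and cap: "\<And>t. t \<in> unoriented R \<Longrightarrow> f (t, ix t) = f (t, Suc (ix t))"
    and cup: "\<And>t. t \<in> unoriented R \<Longrightarrow> f (Suc t, ix t) = f (Suc t, Suc (ix t))"
  shows "f x = f y"
proof -
  obtain t p s q where xy: "x = (t, p)" "y = (s, q)" by (cases x; cases y)
  from assms(1) have "f (t, p) = f (s, q)"
    unfolding xy
  proof cases
    case closing
    then show ?thesis using assms(2) by simp
  next
    case strand
    then show ?thesis using assms(3) by simp
  next
    case oriented_left
    then show ?thesis using assms(3)[of t p] ix_less[of t] by (simp add: unoriented_def)
  next
    case oriented_right
    then show ?thesis using assms(3)[of t p] ix_less[of t] by (simp add: unoriented_def)
  next
    case cap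
    then show ?thesis using assms(4)[of t] by (simp add: unoriented_def)
  next
    case (cup u)
    then show ?thesis using assms(5)[of u] by (simp add: unoriented_def)
  qed
  then show ?thesis by (simp add: xy)
qed

lemma finite_level: "C \<in> circ R \<Longrightarrow> finite {p. (t, p) \<in> C}"
  by (rule finite_subset[of _ "{..<m}"]) (use circle_subset in \<open>auto simp: points_def\<close>)

text \<open>At each level caps and cups remove or add two points of one circle, so nontriviality can be read off at
any level.\<close>
lemma level_parity:
  assumes C: "C \<in> circ R" and t: "t \<le> length w"
  shows "odd (card {p. (t, p) \<in> C}) \<longleftrightarrow> nontrivial C"
  using t
proof (induction t)
  case 0
  then show ?case by (simp add: nontrivial_def)
next
  case (Suc t)
  let ?L = "\<lambda>t. {p. (t, p) \<in> C}"
  have t: "t < length w" using Suc.prems by simp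
  have m: "p < m" if "(s, p) \<in> C" for s p
    using circle_subset[OF C] that by (auto simp: points_def)
  have straight: "(t, p) \<in> C \<longleftrightarrow> (Suc t, p) \<in> C"
    if "t \<notin> unoriented R \<or> p \<noteq> ix t \<and> p \<noteq> Suc (ix t)" for p
  proof (cases "p < m")
    case True
    then show ?thesis
      using conn_straight[OF t True that] circle_conn[OF C] conn_sym by blast
  qed (use m in blast)
  have "odd (card (?L (Suc t))) \<longleftrightarrow> odd (card (?L t))"
  proof (cases "t \<in> unoriented R")
    case False
    then have "?L (Suc t) = ?L t" using straight by blast
    then show ?thesis by simp
  next
    case True
    let ?X = "{ix t, Suc (ix t)}"
    have both: "(t, ix t) \<in> C \<longleftrightarrow> (t, Suc (ix t)) \<in> C" "(Suc t, ix t) \<in> C \<longleftrightarrow> (Suc t, Suc (ix t)) \<in> C"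
      using conn_cap[OF True] conn_cup[OF True] circle_conn[OF C] conn_sym by blast+
    have split: "card (?L s) = card (?L s - ?X) + card (?L s \<inter> ?X)" for s
      using card_Int_Diff[OF finite_level[OF C, of s], of ?X] by simp
    have "?L s \<inter> ?X = {} \<or> ?L s \<inter> ?X = ?X" if "s = t \<or> s = Suc t" for s
      using both that by auto
    then have "even (card (?L s \<inter> ?X))" if "s = t \<or> s = Suc t" for s
      using that by fastforce
    moreover have "?L (Suc t) - ?X = ?L t - ?X" using straight by blast
    ultimately show ?thesis unfolding split[of "Suc t"] split[of t] by simp
  qed
  then show ?case using Suc by simp
qed

text \<open>For a level \<open>t\<close>, \<open>below S t\<close> is the position of the last crossing of \<open>S\<close> below this level, and
\<open>above S t\<close> is the first crossing of \<open>S\<close> above it. Both are understood cyclically: if there is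
none, one continues from the other end of the word, hence the first element of the list in the
definition of \<open>below\<close>. The crossing at level \<open>t\<close> itself lies in the slab above the level.\<close>
definition turn_list :: "nat set \<Rightarrow> nat \<Rightarrow> nat list" where
  "turn_list S t = map ix (filter (\<lambda>s. s \<in> S) [0..<t])"

definition below :: "nat set \<Rightarrow> nat \<Rightarrow> nat" where
  "below S t = last (last (turn_list S (length w)) # turn_list S t)"

definition above :: "nat set \<Rightarrow> nat \<Rightarrow> nat" where
  "above S t = (if \<exists>s\<in>S. t \<le> s then Min {s \<in> S. t \<le> s} else Min S)"

lemma turn_list_Suc: "turn_list S (Suc t) = turn_list S t @ (if t \<in> S then [ix t] else [])"
  by (simp add: turn_list_def)

lemma below_Suc: "below S (Suc t) = (if t \<in> S then ix t else below S t)"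
  by (simp add: below_def turn_list_Suc)

context
  fixes S assumes S: "S \<subseteq> {..<length w}" "S \<noteq> {}"
begin

lemma finite_S: "finite S" using S finite_subset by blast

lemma below_closing: "below S (length w) = below S 0"
proof -
  have "turn_list S (length w) \<noteq> []" using S by (auto simp: turn_list_def filter_empty_conv)
  then show ?thesis by (simp add: below_def turn_list_def)
qed

lemma above_in: "above S t \<in> S"
proof (cases "\<exists>s\<in>S. t \<le> s")
  case True
  then have "Min {s \<in> S. t \<le> s} \<in> {s \<in> S. t \<le> s}" using finite_S by (intro Min_in) auto
  then show ?thesis using True by (simp add: above_def)
qed (use S finite_S in \<open>auto simp: above_def\<close>)

lemma above_self: "t \<in> S \<Longrightarrow> above S t = t"
  using finite_S by (auto simp: above_def intro!: Min_eqI)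

lemma above_Suc: "t \<notin> S \<Longrightarrow> above S (Suc t) = above S t"
proof -
  assume "t \<notin> S"
  then have "s \<in> S \<Longrightarrow> t \<le> s \<longleftrightarrow> Suc t \<le> s" for s by (cases "s = t") auto
  then show ?thesis unfolding above_def by (metis (no_types, lifting) Collect_cong)
qed

lemma above_closing: "above S (length w) = above S 0"
proof -
  have "\<not> (\<exists>s\<in>S. length w \<le> s)" using S by auto
  then show ?thesis using S by (auto simp: above_def)
qed

text \<open>A property of levels that holds just below every crossing of \<open>S\<close> and is inherited downwards between these
crossings holds everywhere. Since the levels form a cycle, one starts from any crossing of \<open>S\<close>, goes
down to level 0, through the closing arcs to the top, and down again.\<close>
lemma cyclic_down_induct:
  assumes "t \<le> length w" and start: "\<And>t. t \<in> S \<Longrightarrow> Q t"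
    and down: "\<And>t. t < length w \<Longrightarrow> t \<notin> S \<Longrightarrow> Q (Suc t) \<Longrightarrow> Q t" and close: "Q 0 \<Longrightarrow> Q (length w)"
  shows "Q t"
proof -
  have down': "Q t" if "Q u" "t \<le> u" "u \<le> length w" for t u
    using that(2,1,3)
  proof (induction t rule: inc_induct)
    case (step n)
    then show ?case using down[of n] start[of n] by (cases "n \<in> S") auto
  qed
  obtain s where "s \<in> S" using S by blast
  then have "Q 0" using down'[of s 0] start[of s] S by auto
  then show ?thesis using down'[of "length w" t] close assms(1) by blast
qed

lemma cyclic_up_induct:
  assumes "t \<le> length w" and start: "\<And>t. t \<in> S \<Longrightarrow> Q (Suc t)"
    and up: "\<And>t. t < length w \<Longrightarrow> t \<notin> S \<Longrightarrow> Q t \<Longrightarrow> Q (Suc t)" and close: "Q (length w) \<Longrightarrow> Q 0"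
  shows "Q t"
proof -
  have up': "Q u" if "Q t" "t \<le> u" "u \<le> length w" for t u
    using that(2,1,3)
  proof (induction u rule: dec_induct)
    case (step n)
    then show ?case using up[of n] start[of n] by (cases "n \<in> S") auto
  qed
  obtain s where s: "s \<in> S" using S by blast
  then have "Q (length w)" using up'[of "Suc s" "length w"] start[of s] S by (auto simp: Suc_le_eq)
  then show ?thesis using up'[of 0 t] close assms(1) by blast
qed

lemma below_less: "t \<le> length w \<Longrightarrow> Suc (below S t) < m"
  by (rule cyclic_up_induct) (use S ix_less below_closing in \<open>auto simp: below_Suc\<close>)

lemma below_above: "t \<le> length w \<Longrightarrow> below S (above S t) = below S t"
  by (rule cyclic_down_induct[where Q = "\<lambda>t. below S (above S t) = below S t"])
    (simp_all add: above_self above_Suc above_closing below_closing below_Suc)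

lemma above_less: "Suc (ix (above S t)) < m"
  using above_in[of t] S by (intro ix_less) auto

end

context
  fixes R assumes ne: "unoriented R \<noteq> {}"
begin

abbreviation "U \<equiv> unoriented R"

lemma unoriented_subset: "U \<subseteq> {..<length w}" by (auto simp: unoriented_def)

lemma conn_below: "t \<le> length w \<Longrightarrow> ((t, below U t), (t, Suc (below U t))) \<in> cn R"
proof (rule cyclic_up_induct[OF unoriented_subset ne, where Q = "\<lambda>t. ((t, below U t), (t, Suc (below U t))) \<in> cn R"])
  fix t assume "t \<in> U"
  then show "((Suc t, below U (Suc t)), (Suc t, Suc (below U (Suc t)))) \<in> cn R"
    using conn_cup by (simp add: below_Suc)
next
  fix t assume t: "t < length w" "t \<notin> U" and IH: "((t, below U t), (t, Suc (below U t))) \<in> cn R"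
  have "Suc (below U t) < m" using t below_less[OF unoriented_subset ne, of t] by simp
  then have up: "((t, below U t), (Suc t, below U t)) \<in> cn R" "((t, Suc (below U t)), (Suc t, Suc (below U t))) \<in> cn R"
    using t conn_straight by auto
  have "below U (Suc t) = below U t" using t(2) by (simp add: below_Suc)
  then show "((Suc t, below U (Suc t)), (Suc t, Suc (below U (Suc t)))) \<in> cn R"
    using conn_trans[OF conn_sym[OF up(1)] conn_trans[OF IH up(2)]] by simp
next
  assume IH: "((length w, below U (length w)), (length w, Suc (below U (length w)))) \<in> cn R"
  have "Suc (below U 0) < m" using below_less[OF unoriented_subset ne, of 0] by simp
  then have "((length w, below U 0), (0, below U 0)) \<in> cn R" "((length w, Suc (below U 0)), (0, Suc (below U 0))) \<in> cn R"
    using conn_closing by auto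
  then show "((0, below U 0), (0, Suc (below U 0))) \<in> cn R"
    using IH conn_sym conn_trans unfolding below_closing[OF unoriented_subset ne] by (metis (no_types))
qed

lemma conn_up_above:
  assumes "p = ix (above U t) \<or> p = Suc (ix (above U t))" "t \<le> length w"
  shows "((t, p), (above U t, p)) \<in> cn R"
proof -
  have "\<forall>p. p = ix (above U t) \<or> p = Suc (ix (above U t)) \<longrightarrow> ((t, p), (above U t, p)) \<in> cn R"
    using assms(2)
  proof (rule cyclic_down_induct[OF unoriented_subset ne, where Q = "\<lambda>t. \<forall>p. p = ix (above U t) \<or> p = Suc (ix (above U t)) \<longrightarrow> ((t, p), (above U t, p)) \<in> cn R"])
    fix t assume "t \<in> U"
    then show "\<forall>p. p = ix (above U t) \<or> p = Suc (ix (above U t)) \<longrightarrow> ((t, p), (above U t, p)) \<in> cn R"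
      by (simp add: above_self[OF unoriented_subset ne])
  next
    fix t assume t: "t < length w" "t \<notin> U"
      and IH: "\<forall>p. p = ix (above U (Suc t)) \<or> p = Suc (ix (above U (Suc t))) \<longrightarrow> ((Suc t, p), (above U (Suc t), p)) \<in> cn R"
    show "\<forall>p. p = ix (above U t) \<or> p = Suc (ix (above U t)) \<longrightarrow> ((t, p), (above U t, p)) \<in> cn R"
      using IH conn_straight[OF t(1)] t(2) above_less[OF unoriented_subset ne, of t]
      unfolding above_Suc[OF unoriented_subset ne t(2)] by (metis Suc_lessD conn_trans)
  next
    assume IH: "\<forall>p. p = ix (above U 0) \<or> p = Suc (ix (above U 0)) \<longrightarrow> ((0, p), (above U 0, p)) \<in> cn R"
    show "\<forall>p. p = ix (above U (length w)) \<or> p = Suc (ix (above U (length w))) \<longrightarrow> ((length w, p), (above U (length w), p)) \<in> cn R"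
      using IH conn_closing above_less[OF unoriented_subset ne, of 0]
      unfolding above_closing[OF unoriented_subset ne] by (metis Suc_lessD conn_trans)
  qed
  then show ?thesis using assms(1) by blast
qed

lemma conn_above:
  assumes "t \<le> length w"
  shows "((t, ix (above U t)), (t, Suc (ix (above U t)))) \<in> cn R"
  using conn_up_above[OF _ assms] conn_cap[OF above_in[OF unoriented_subset ne, of t]] conn_sym conn_trans
  by (metis (no_types))

text \<open>If two cyclically consecutive crossings are at distance at least 2, then some level meets two disjoint
pairs of connected points: the cup of the lower crossing and the cap of the upper one. A nontrivial
circle has an odd number of points at this level, so with the possible exception of one circle it has a
point outside the two pairs, and only \<open>m - 4\<close> such points exist.\<close>
lemma few_nontrivial:
  assumes t: "t \<in> U" and far: "Suc (ix t) < below U t \<or> Suc (below U t) < ix t"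
  shows "card {C \<in> circ R. nontrivial C} + 3 \<le> m"
proof -
  have tL: "t < length w" using t unoriented_subset by auto
  define a where "a = below U t"
  define b where "b = ix t"
  have lt: "Suc a < m" "Suc b < m"
    using below_less[OF unoriented_subset ne, of t] ix_less[OF tL] tL by (simp_all add: a_def b_def)
  have pa: "((t, a), (t, Suc a)) \<in> cn R" using conn_below[of t] tL by (simp add: a_def)
  have pb: "((t, b), (t, Suc b)) \<in> cn R" using conn_cap[OF t] by (simp add: b_def)
  let ?X = "{a, Suc a, b, Suc b}"
  have X: "card ?X = 4" "?X \<subseteq> {..<m}" using far lt by (auto simp: a_def b_def)
  let ?N = "{C \<in> circ R. nontrivial C} - {cn R `` {(t, a)}}"
  \<comment> \<open>A point of each remaining nontrivial circle outside the two pairs.\<close>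
  define f where "f C = (SOME p. (t, p) \<in> C \<and> p \<notin> ?X)" for C
  have f: "(t, f C) \<in> C \<and> f C \<notin> ?X" if "C \<in> ?N" for C
  proof -
    have C: "C \<in> circ R" "nontrivial C" "C \<noteq> cn R `` {(t, a)}" using that by auto
    have a_notin: "(t, a) \<notin> C" using C(1,3) circle_conn[OF C(1)] by blast
    then have "(t, Suc a) \<notin> C" using circle_conn[OF C(1)] pa conn_sym by blast
    moreover have "(t, b) \<in> C \<longleftrightarrow> (t, Suc b) \<in> C" using circle_conn[OF C(1)] pb conn_sym by blast
    ultimately have "\<exists>p. (t, p) \<in> C \<and> p \<notin> ?X"
    proof (rule_tac ccontr)
      assume not: "\<nexists>p. (t, p) \<in> C \<and> p \<notin> ?X"
      then have "{p. (t, p) \<in> C} = (if (t, b) \<in> C then {b, Suc b} else {})"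
        using a_notin \<open>(t, Suc a) \<notin> C\<close> \<open>(t, b) \<in> C \<longleftrightarrow> (t, Suc b) \<in> C\<close> by auto
      then have "even (card {p. (t, p) \<in> C})" by simp
      then show False using level_parity[OF C(1), of t] C(2) tL by simp
    qed
    then show ?thesis unfolding f_def by (rule someI_ex)
  qed
  have "inj_on f ?N"
  proof (rule inj_onI)
    fix C D assume CD: "C \<in> ?N" "D \<in> ?N" "f C = f D"
    then show "C = D" using f[OF CD(1)] f[OF CD(2)] circle_disjoint[of C R D "(t, f C)"] by simp
  qed
  moreover have "f ` ?N \<subseteq> {..<m} - ?X"
  proof
    fix p assume "p \<in> f ` ?N"
    then obtain C where C: "C \<in> ?N" "p = f C" by blast
    then have "(t, p) \<in> P" using f[OF C(1)] circle_subset[of C R] by auto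
    then show "p \<in> {..<m} - ?X" using f[OF C(1)] C(2) by (auto simp: points_def)
  qed
  ultimately have "card ?N \<le> card ({..<m} - ?X)" by (intro card_inj_on_le) auto
  also have "\<dots> = m - 4" using X by (subst card_Diff_subset) auto
  finally have "card ?N \<le> m - 4" .
  moreover have "4 \<le> m" using X card_mono[of "{..<m}" ?X] by simp
  moreover have "card {C \<in> circ R. nontrivial C} \<le> Suc (card ?N)"
    using diff_card_le_card_Diff[of "{cn R `` {(t, a)}}" "{C \<in> circ R. nontrivial C}"] by simp
  ultimately show ?thesis by simp
qed

definition skip :: "nat \<Rightarrow> nat \<Rightarrow> nat" where
  "skip i p = (if p < i then p else p - 2)"

text \<open>If consecutive crossings are at distance at most 1, the circles can be named explicitly. Let \<open>b\<close> be the
position of the next crossing above a level and \<open>a\<close> that of the last one below. If \<open>a = b\<close>, the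
two points of this pair lie on a trivial circle, which is named by the crossing above and reaches no
further. Otherwise three neighbouring points form a zigzag and count as one. The remaining points
are numbered from left to right, which gives the names of the \<open>m - 2\<close> nontrivial circles. Leaving out
the pair at \<open>b\<close> or the pair at \<open>a\<close> gives the same numbering.\<close>
definition ident :: "point \<Rightarrow> nat + nat" where
  "ident = (\<lambda>(t, p). let b = ix (above U t); a = below U t in
     if p \<noteq> b \<and> p \<noteq> Suc b then Inl (skip b p)
     else if p \<noteq> a \<and> p \<noteq> Suc a then Inl (skip a p)
     else if a = b then Inr (above U t) else Inl (min a b))"

text \<open>The strand of the nontrivial circle \<open>k\<close> that is not turned back by the next crossing above.\<close>
definition lift :: "nat \<Rightarrow> nat \<Rightarrow> nat" where
  "lift k t = (if k < ix (above U t) then k else k + 2)"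

context
  assumes near: "\<forall>t\<in>U. \<not> (Suc (ix t) < below U t \<or> Suc (below U t) < ix t)"
begin

lemma near_level:
  assumes "t \<le> length w"
  obtains "below U t = ix (above U t)" | "below U t = Suc (ix (above U t))" | "Suc (below U t) = ix (above U t)"
proof -
  have "above U t \<in> U" by (rule above_in[OF unoriented_subset ne])
  then have "\<not> (Suc (ix (above U t)) < below U t \<or> Suc (below U t) < ix (above U t))"
    using near below_above[OF unoriented_subset ne assms] by metis
  then show thesis using that by linarith
qed

lemma ident_below:
  assumes "t \<le> length w" "p \<noteq> below U t" "p \<noteq> Suc (below U t)"
  shows "ident (t, p) = Inl (skip (below U t) p)"
  using near_level[OF assms(1)] assms(2,3)
  by cases (auto simp: ident_def Let_def skip_def)

lemma ident_arc:
  assumes "(x, y) \<in> arcs m w R"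
  shows "ident x = ident y"
  using assms
proof (rule arc_invariant)
  fix p show "ident (length w, p) = ident (0, p)"
    by (simp only: ident_def prod.case above_closing[OF unoriented_subset ne] below_closing[OF unoriented_subset ne])
next
  fix t p assume t: "t < length w" and *: "t \<notin> U \<or> p \<noteq> ix t \<and> p \<noteq> Suc (ix t)"
  show "ident (t, p) = ident (Suc t, p)"
  proof (cases "t \<in> U")
    case False
    then show ?thesis by (simp add: ident_def Let_def above_Suc[OF unoriented_subset ne] below_Suc)
  next
    case True
    then have "ident (t, p) = Inl (skip (ix t) p)"
      using * by (simp add: ident_def above_self[OF unoriented_subset ne])
    moreover have "ident (Suc t, p) = Inl (skip (ix t) p)"
      using ident_below[of "Suc t" p] t * True by (simp add: below_Suc)
    ultimately show ?thesis by simp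
  qed
next
  fix t assume t: "t \<in> U"
  then have "t \<le> length w" using unoriented_subset by auto
  from near_level[OF this] show "ident (t, ix t) = ident (t, Suc (ix t))"
    by cases (auto simp: ident_def above_self[OF unoriented_subset ne t] skip_def Let_def)
next
  fix t assume t: "t \<in> U"
  then have "Suc t \<le> length w" using unoriented_subset by auto
  from near_level[OF this] show "ident (Suc t, ix t) = ident (Suc t, Suc (ix t))"
    using t by cases (auto simp: ident_def below_Suc skip_def Let_def)
qed

lemma ident_conn: "(x, y) \<in> cn R \<Longrightarrow> ident x = ident y"
  by (rule conn_invariant[OF _ ident_arc])

lemma ident_lift:
  "ident (t, lift k t) = Inl k"
  by (auto simp: ident_def lift_def skip_def Let_def)

text \<open>The other two points of a zigzag are joined to the third by the cup below and the cap above.\<close>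
lemma conn_lift_level:
  assumes t: "t \<le> length w" and "ident (t, p) = Inl k"
  shows "((t, p), (t, lift k t)) \<in> cn R"
proof -
  define a where "a = below U t"
  define b where "b = ix (above U t)"
  have a: "((t, a), (t, Suc a)) \<in> cn R" using conn_below[OF t] by (simp add: a_def)
  have b: "((t, b), (t, Suc b)) \<in> cn R" using conn_above[OF t] by (simp add: b_def)
  have id: "(if p \<noteq> b \<and> p \<noteq> Suc b then Inl (skip b p) else if p \<noteq> a \<and> p \<noteq> Suc a then Inl (skip a p)
     else if a = b then Inr (above U t) else Inl (min a b)) = Inl k"
    using assms(2) by (simp only: ident_def Let_def a_def b_def prod.case)
  have lift: "lift k t = (if k < b then k else k + 2)" by (simp add: lift_def b_def)
  show ?thesis
  proof (cases "p \<noteq> b \<and> p \<noteq> Suc b")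
    case True
    then have "lift k t = p" using id unfolding lift by (auto simp: skip_def split: if_splits)
    then show ?thesis by simp
  next
    case False
    from near_level[OF t] consider "a = b" | "a = Suc b" | "b = Suc a"
      unfolding a_def b_def by metis
    then show ?thesis
    proof cases
      case 1
      then show ?thesis using id False by (auto split: if_splits)
    next
      case 2
      then have "lift k t = Suc a" using id False unfolding lift by (auto simp: skip_def split: if_splits)
      then show ?thesis using a b False 2 conn_trans by (metis (no_types))
    next
      case 3
      then have "lift k t = a" using id False unfolding lift by (auto simp: skip_def split: if_splits)
      then show ?thesis using a b False 3 conn_trans conn_sym by (metis (no_types))
    qed
  qed
qed

lemma Inl_less:
  assumes "(t, p) \<in> P" "ident (t, p) = Inl k"
  shows "k + 2 < m"
proof -
  have t: "t \<le> length w" "p < m" using assms(1) by (auto simp: points_def)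
  have "Suc (below U t) < m" "Suc (ix (above U t)) < m"
    using below_less[OF unoriented_subset ne t(1)] above_less[OF unoriented_subset ne] by auto
  then show ?thesis
    using assms(2) t(2) near_level[OF t(1)]
    by (auto simp: ident_def skip_def Let_def split: if_splits)
qed

lemma lift_less: "k + 2 < m \<Longrightarrow> lift k t < m"
  by (simp add: lift_def)

lemma conn_lift_zero:
  assumes "k + 2 < m" "t \<le> length w"
  shows "((t, lift k t), (0, lift k 0)) \<in> cn R"
  using assms(2)
proof (induction t)
  case (Suc t)
  have t: "t < length w" using Suc.prems by simp
  have "t \<notin> U \<or> lift k t \<noteq> ix t \<and> lift k t \<noteq> Suc (ix t)"
    by (auto simp: lift_def above_self[OF unoriented_subset ne])
  then have up: "((t, lift k t), (Suc t, lift k t)) \<in> cn R"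
    by (rule conn_straight[OF t lift_less[OF assms(1)]])
  then have "ident (Suc t, lift k t) = Inl k"
    using ident_conn ident_lift by metis
  then have "((Suc t, lift k t), (Suc t, lift k (Suc t))) \<in> cn R"
    by (rule conn_lift_level[OF Suc.prems])
  then show ?case using up Suc.IH t conn_sym conn_trans by (metis (no_types) less_imp_le)
qed simp

lemma Inr_below:
  assumes "(t, p) \<in> P" "ident (t, p) = Inr s"
  shows "s \<in> U" "below U s = ix s" "above U t = s" "below U t = ix s" "p = ix s \<or> p = Suc (ix s)"
proof -
  have t: "t \<le> length w" using assms(1) by (auto simp: points_def)
  show s: "above U t = s" using assms(2) by (auto simp: ident_def Let_def split: if_splits)
  show "below U t = ix s" "p = ix s \<or> p = Suc (ix s)"
    using assms(2) by (auto simp: ident_def Let_def split: if_splits)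
  then show "below U s = ix s" using below_above[OF unoriented_subset ne t] s by simp
  show "s \<in> U" using above_in[OF unoriented_subset ne, of t] s by simp
qed

lemma ident_eq_conn:
  assumes "x \<in> P" "y \<in> P" "ident x = ident y"
  shows "(x, y) \<in> cn R"
proof (cases "ident x")
  case (Inl k)
  have "(z, (0, lift k 0)) \<in> cn R" if "z \<in> P" "ident z = Inl k" for z
  proof -
    obtain t p where z: "z = (t, p)" by (cases z)
    then have t: "t \<le> length w" using that(1) by (auto simp: points_def)
    have "k + 2 < m" using Inl_less that unfolding z by auto
    from conn_lift_zero[OF this t] conn_lift_level[OF t] that(2) show ?thesis
      unfolding z using conn_trans by blast
  qed
  then show ?thesis using assms Inl conn_sym conn_trans by metis
next
  case (Inr s)
  have "(z, (s, ix s)) \<in> cn R" if "z \<in> P" "ident z = Inr s" for z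
  proof -
    obtain t p where z: "z = (t, p)" by (cases z)
    then have t: "t \<le> length w" using that(1) by (auto simp: points_def)
    note s = Inr_below[OF that[unfolded z]]
    have "((t, p), (s, p)) \<in> cn R" using conn_up_above[of p t] t s by simp
    moreover have "((s, p), (s, ix s)) \<in> cn R"
      using s(5) conn_cap[OF s(1)] conn_sym by auto
    ultimately show ?thesis unfolding z using conn_trans by blast
  qed
  then show ?thesis using assms Inr conn_sym conn_trans by metis
qed

definition loops :: "nat set" where
  "loops = {s \<in> U. below U s = ix s}"

lemma ident_image: "ident ` P = Inl ` {k. k + 2 < m} \<union> Inr ` loops"
proof (intro equalityI subsetI)
  fix i assume "i \<in> ident ` P"
  then obtain t p where x: "(t, p) \<in> P" "i = ident (t, p)" by auto
  show "i \<in> Inl ` {k. k + 2 < m} \<union> Inr ` loops"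
  proof (cases i)
    case (Inl k)
    then show ?thesis using Inl_less[OF x(1), of k] x(2) by auto
  next
    case (Inr s)
    then show ?thesis using Inr_below(1,2)[OF x(1), of s] x(2) by (auto simp: loops_def)
  qed
next
  fix i assume "i \<in> Inl ` {k. k + 2 < m} \<union> Inr ` loops"
  then consider k where "i = Inl k" "k + 2 < m" | s where "i = Inr s" "s \<in> loops" by auto
  then show "i \<in> ident ` P"
  proof cases
    case 1
    then have "(0, lift k 0) \<in> P" using lift_less by (simp add: points_def)
    then show ?thesis using ident_lift[of 0 k] 1 by (metis image_eqI)
  next
    case 2
    then have s: "s \<in> U" "below U s = ix s" by (auto simp: loops_def)
    then have "ident (s, ix s) = Inr s" by (simp add: ident_def above_self[OF unoriented_subset ne] Let_def)
    moreover have "(s, ix s) \<in> P" using s(1) unoriented_subset ix_less[of s] by (auto simp: points_def)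
    ultimately show ?thesis using 2 by (metis image_eqI)
  qed
qed

definition circle_of :: "nat + nat \<Rightarrow> point set" where
  "circle_of i = {x \<in> P. ident x = i}"

lemma circle_of_ident:
  assumes "x \<in> P"
  shows "circle_of (ident x) = cn R `` {x}"
proof (intro equalityI subsetI)
  fix y assume "y \<in> circle_of (ident x)"
  then have "y \<in> P" "ident x = ident y" by (auto simp: circle_of_def)
  then show "y \<in> cn R `` {x}" using ident_eq_conn[OF assms] by blast
next
  fix y assume y: "y \<in> cn R `` {x}"
  then have "y \<in> P" using circle_subset[OF class_in_circles[OF assms]] by blast
  moreover have "ident x = ident y" using y by (intro ident_conn) blast
  ultimately show "y \<in> circle_of (ident x)" by (simp add: circle_of_def)
qed

lemma circles_eq_circle_of: "circ R = circle_of ` (ident ` P)"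
proof -
  have "circ R = (\<lambda>x. cn R `` {x}) ` P" unfolding circles_eq quotient_def by auto
  also have "\<dots> = (\<lambda>x. circle_of (ident x)) ` P"
    by (rule image_cong[OF HOL.refl]) (simp add: circle_of_ident)
  finally show ?thesis by (simp add: image_image)
qed

lemma inj_circle_of: "inj_on circle_of (ident ` P)"
  by (rule inj_onI) (auto simp: circle_of_def)

text \<open>A nontrivial circle meets level 0 once or, in a zigzag, three times.\<close>
lemma nontrivial_Inl: "k + 2 < m \<Longrightarrow> nontrivial (circle_of (Inl k))"
proof -
  assume k: "k + 2 < m"
  define a where "a = below U 0"
  define b where "b = ix (above U 0)"
  have ab: "Suc a < m" "Suc b < m"
    using below_less[OF unoriented_subset ne, of 0] above_less[OF unoriented_subset ne, of 0] by (auto simp: a_def b_def)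
  have id: "ident (0, p) = (if p \<noteq> b \<and> p \<noteq> Suc b then Inl (skip b p)
      else if p \<noteq> a \<and> p \<noteq> Suc a then Inl (skip a p)
      else if a = b then Inr (above U 0) else Inl (min a b))" for p
    by (simp add: ident_def Let_def a_def b_def)
  have lift: "lift k 0 = (if k < b then k else k + 2)" by (simp add: lift_def b_def)
  from near_level[of 0] have near: "a = b \<or> a = Suc b \<or> b = Suc a"
    unfolding a_def b_def by (metis le0)
  have "{p. (0, p) \<in> circle_of (Inl k)} = {p. p < m \<and> ident (0, p) = Inl k}"
    by (auto simp: circle_of_def points_def)
  also have "\<dots> = insert (lift k 0) (if a \<noteq> b \<and> k = min a b then {b, Suc b} else {})"
  proof (rule Set.set_eqI)
    fix p
    show "p \<in> {p. p < m \<and> ident (0, p) = Inl k} \<longleftrightarrow>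
      p \<in> insert (lift k 0) (if a \<noteq> b \<and> k = min a b then {b, Suc b} else {})"
    proof (cases "p = b \<or> p = Suc b")
      case False
      then have "ident (0, p) = Inl k \<longleftrightarrow> p = lift k 0"
        by (auto simp: id lift skip_def)
      then show ?thesis using False k by (auto simp: lift)
    next
      case True
      then have "p \<noteq> lift k 0" "p < m" using ab by (auto simp: lift)
      moreover have "ident (0, p) = Inl k \<longleftrightarrow> a \<noteq> b \<and> k = min a b"
        using near
      proof (elim disjE)
        assume "a = b"
        then show ?thesis using True by (auto simp: id)
      next
        assume "a = Suc b"
        then show ?thesis using True by (auto simp: id skip_def)
      next
        assume "b = Suc a"
        then show ?thesis using True by (auto simp: id skip_def)
      qed
      ultimately show ?thesis using True by auto
    qed
  qed
  also have "odd (card \<dots>)" unfolding lift by auto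
  finally show ?thesis by (simp add: nontrivial_def)
qed

lemma trivial_Inr: "\<not> nontrivial (circle_of (Inr s))"
proof -
  define b where "b = ix (above U 0)"
  have b: "Suc b < m" using above_less[OF unoriented_subset ne, of 0] by (auto simp: b_def)
  have "{p. (0, p) \<in> circle_of (Inr s)} = {p. p < m \<and> ident (0, p) = Inr s}"
    by (auto simp: circle_of_def points_def)
  also have "\<dots> = (if below U 0 = b \<and> above U 0 = s then {b, Suc b} else {})"
    using b by (auto simp: ident_def Let_def b_def split: if_splits)
  also have "even (card \<dots>)" by simp
  finally show ?thesis by (simp add: nontrivial_def)
qed

lemma card_nontrivial: "card {C \<in> circ R. nontrivial C} = m - 2"
  and card_trivial: "card {C \<in> circ R. \<not> nontrivial C} = card loops"
proof -
  have 1: "{C \<in> circ R. nontrivial C} = circle_of ` Inl ` {k. k + 2 < m}"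
    and 2: "{C \<in> circ R. \<not> nontrivial C} = circle_of ` Inr ` loops"
    unfolding circles_eq_circle_of ident_image image_Un using nontrivial_Inl trivial_Inr by auto
  have inj: "inj_on circle_of (Inl ` {k. k + 2 < m})" "inj_on circle_of (Inr ` loops)"
    using inj_circle_of unfolding ident_image by (auto intro: inj_on_subset)
  have "card {C \<in> circ R. nontrivial C} = card {k. k + 2 < m}"
    unfolding 1 card_image[OF inj(1)] by (simp add: card_image)
  also have "{k. k + 2 < m} = {..<m - 2}" by auto
  finally show "card {C \<in> circ R. nontrivial C} = m - 2" by simp
  show "card {C \<in> circ R. \<not> nontrivial C} = card loops"
    unfolding 2 card_image[OF inj(2)] by (simp add: card_image)
qed

end
end

text \<open>If all crossings respect the orientation, the circles are the strands of the trivial braid.\<close>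
lemma oriented_circles:
  assumes "unoriented R = {}"
  shows "card (circ R) = m" "\<And>C. C \<in> circ R \<Longrightarrow> nontrivial C"
proof -
  have const: "snd x = snd y" if "(x, y) \<in> cn R" for x y
    by (rule conn_invariant[OF that], erule arc_invariant) (use assms in auto)
  have down: "((t, p), (0, p)) \<in> cn R" if "p < m" "t \<le> length w" for t p
    using that(2)
  proof (induction t)
    case (Suc t)
    then show ?case
      using conn_straight[of t p R] that assms conn_sym conn_trans by (metis Suc_le_eq empty_iff less_imp_le)
  qed simp
  let ?col = "\<lambda>p. {..length w} \<times> {p}"
  have col: "cn R `` {(t, p)} = ?col p" if "(t, p) \<in> P" for t p
  proof (intro equalityI subsetI)
    fix y assume "y \<in> cn R `` {(t, p)}"
    then show "y \<in> ?col p"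
      using const circle_subset[OF class_in_circles[OF that]] by (fastforce simp: points_def)
  next
    fix y assume "y \<in> ?col p"
    then obtain s where y: "y = (s, p)" "s \<le> length w" by auto
    have "p < m" "t \<le> length w" using that by (auto simp: points_def)
    then show "y \<in> cn R `` {(t, p)}"
      unfolding y using conn_trans[OF down conn_sym[OF down]] y(2) by blast
  qed
  have circ: "circ R = ?col ` {..<m}"
  proof (intro equalityI subsetI)
    fix C assume "C \<in> circ R"
    then obtain x where "x \<in> P" "C = cn R `` {x}" unfolding circles_eq by (auto elim: quotientE)
    then show "C \<in> ?col ` {..<m}" using col by (cases x) (auto simp: points_def)
  next
    fix C assume "C \<in> ?col ` {..<m}"
    then obtain p where p: "p < m" "C = ?col p" by auto
    then have "(0, p) \<in> P" by (simp add: points_def)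
    from class_in_circles[OF this, of R] show "C \<in> circ R" using col[OF \<open>(0, p) \<in> P\<close>] p by simp
  qed
  have "inj_on ?col {..<m}" by (rule inj_onI) auto
  then show "card (circ R) = m" unfolding circ by (simp add: card_image)
  show "nontrivial C" if "C \<in> circ R" for C
    using that unfolding circ by (auto simp: nontrivial_def)
qed

end

section \<open>Burau operators\<close>

text \<open>The representation on the part of the \<open>m\<close>-th tensor power of a plane where exactly one factor is minus,
with \<open>z = y\<^bsup>-1\<^esup>\<close>; a vector records the coefficients by the position of the minus. The
Temperley-Lieb generators act by the rank one operators \<open>ket y i\<close> times \<open>bra z i\<close>. Vectors are
functions on all positions, so that one operator serves for every number of strands.\<close>
definition bra :: "'a::comm_ring_1 \<Rightarrow> nat \<Rightarrow> (nat \<Rightarrow> 'a) \<Rightarrow> 'a" where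
  "bra z i v = v i + z * v (Suc i)"

definition ket :: "'a::comm_ring_1 \<Rightarrow> nat \<Rightarrow> nat \<Rightarrow> 'a" where
  "ket y i = (\<lambda>p. if p = i then y else if p = Suc i then 1 else 0)"

definition cup_cap :: "'a::comm_ring_1 \<Rightarrow> 'a \<Rightarrow> nat \<Rightarrow> (nat \<Rightarrow> 'a) \<Rightarrow> nat \<Rightarrow> 'a" where
  "cup_cap y z i v = (\<lambda>p. bra z i v * ket y i p)"

text \<open>A positive crossing is \<open>y (1 - y U\<^sub>i)\<close> and a negative one is \<open>z (1 - z U\<^sub>i)\<close>, where
\<open>U\<^sub>i\<close> is the Temperley-Lieb generator. The coefficients are those that the two resolutions have in
the graded Euler characteristic.\<close>
definition burau_letter :: "'a::comm_ring_1 \<Rightarrow> 'a \<Rightarrow> nat \<times> bool \<Rightarrow> (nat \<Rightarrow> 'a) \<Rightarrow> nat \<Rightarrow> 'a" where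
  "burau_letter y z x v =
    (let s = (if snd x then y else z) in (\<lambda>p. s * v p - s\<^sup>2 * cup_cap y z (fst x) v p))"

definition burau :: "'a::comm_ring_1 \<Rightarrow> 'a \<Rightarrow> braid_word \<Rightarrow> (nat \<Rightarrow> 'a) \<Rightarrow> nat \<Rightarrow> 'a" where
  "burau y z w = foldr (burau_letter y z) w"

definition unit_vec :: "nat \<Rightarrow> nat \<Rightarrow> 'a::comm_ring_1" where
  "unit_vec p q = (if q = p then 1 else 0)"

definition op_trace :: "nat \<Rightarrow> ((nat \<Rightarrow> 'a::comm_ring_1) \<Rightarrow> nat \<Rightarrow> 'a) \<Rightarrow> 'a" where
  "op_trace m F = (\<Sum>p<m. F (unit_vec p) p)"

text \<open>The pairing of neighbouring rank one operators: a circle that closes up between two equal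
generators gives \<open>y + z\<close>, and a zigzag can be pulled straight.\<close>
definition loop_weight :: "'a::comm_ring_1 \<Rightarrow> 'a \<Rightarrow> nat \<Rightarrow> nat \<Rightarrow> 'a" where
  "loop_weight y z i j = (if i = j then y + z else if j = Suc i \<or> i = Suc j then 1 else 0)"

definition linear_op :: "((nat \<Rightarrow> 'a::comm_ring_1) \<Rightarrow> nat \<Rightarrow> 'a) \<Rightarrow> bool" where
  "linear_op F \<longleftrightarrow> (\<forall>a b u v. F (\<lambda>p. a * u p + b * v p) = (\<lambda>p. a * F u p + b * F v p))"

lemma linear_opD: "linear_op F \<Longrightarrow> F (\<lambda>p. a * u p + b * v p) p = a * F u p + b * F v p"
  by (simp add: linear_op_def)

lemma linear_op_comp: "linear_op F \<Longrightarrow> linear_op G \<Longrightarrow> linear_op (F \<circ> G)"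
  by (simp add: linear_op_def)

lemma bra_linear: "bra z i (\<lambda>p. a * u p + b * v p) = a * bra z i u + b * bra z i v"
  by (simp add: bra_def algebra_simps)

lemma linear_cup_cap: "linear_op (cup_cap y z i)"
  by (simp add: linear_op_def cup_cap_def bra_linear algebra_simps)

lemma linear_burau_letter: "linear_op (burau_letter y z x)"
  using linear_opD[OF linear_cup_cap[of y z "fst x"]]
  by (simp add: linear_op_def burau_letter_def Let_def fun_eq_iff algebra_simps)

lemma linear_foldr:
  assumes "\<And>x. linear_op (f x)"
  shows "linear_op (foldr f xs)"
proof (induction xs)
  case Nil
  then show ?case by (simp add: linear_op_def)
next
  case (Cons x xs)
  then show ?case using linear_op_comp[OF assms[of x] Cons] by (simp add: comp_def)
qed

lemma linear_burau: "linear_op (burau y z w)"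
  unfolding burau_def by (rule linear_foldr[OF linear_burau_letter])

lemma burau_append: "burau y z (u @ v) = burau y z u \<circ> burau y z v"
  by (simp add: burau_def fun_eq_iff)

fun chain_weight :: "'a::comm_ring_1 \<Rightarrow> 'a \<Rightarrow> nat \<Rightarrow> nat list \<Rightarrow> 'a" where
  "chain_weight y z i [] = 1"
| "chain_weight y z i (j # js) = loop_weight y z i j * chain_weight y z j js"

lemma chain_weight_snoc:
  "chain_weight y z i (js @ [k]) = chain_weight y z i js * loop_weight y z (last (i # js)) k"
  by (induction js arbitrary: i) (simp_all add: mult.assoc)

lemma op_trace_id: "op_trace m (\<lambda>v. v) = of_nat m"
  by (simp add: op_trace_def unit_vec_def)

context
  fixes y z :: "'a::comm_ring_1"
  assumes yz: "y * z = 1"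
begin

lemma bra_ket: "bra z i (ket y j) = loop_weight y z i j"
  using yz by (auto simp: bra_def ket_def loop_weight_def mult.commute)

text \<open>All vectors that occur in the braid relations are combinations of one vector and of kets, so the relations
reduce to identities between three coefficients.\<close>
lemma burau_letter_comb:
  "burau_letter y z x (\<lambda>p. a * v p + b * ket y i p + c * ket y j p) =
    (let s = (if snd x then y else z); k = fst x in
     (\<lambda>p. s * (a * v p + b * ket y i p + c * ket y j p)
       - s\<^sup>2 * (a * bra z k v + b * loop_weight y z k i + c * loop_weight y z k j) * ket y k p))"
proof -
  have "bra z k (\<lambda>p. a * v p + b * ket y i p + c * ket y j p)
      = a * bra z k v + b * loop_weight y z k i + c * loop_weight y z k j" for k
    by (simp add: bra_ket[symmetric]) (simp add: bra_def algebra_simps)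
  then show ?thesis
    by (simp add: burau_letter_def cup_cap_def Let_def algebra_simps)
qed

lemma burau_cancel: "burau y z [(i, b), (i, \<not> b)] v = v"
proof -
  have "burau_letter y z (i, b) (burau_letter y z (i, \<not> b) v) = v"
  proof
    fix p
    define s where "s = (if b then y else z)"
    define r where "r = (if b then z else y)"
    have sr: "s * r = 1" "r + s = y + z"
      using yz by (auto simp: s_def r_def mult.commute add.commute)
    define B where "B = bra z i v"
    define k where "k = ket y i p"
    have inner: "burau_letter y z (i, \<not> b) v = (\<lambda>p. r * v p + (- r\<^sup>2 * B) * ket y i p + 0 * ket y i p)"
      by (auto simp: burau_letter_def cup_cap_def B_def r_def mult.assoc)
    have outer: "(if snd (i, b) then y else z) = s" by (simp add: s_def)
    have "burau_letter y z (i, b) (burau_letter y z (i, \<not> b) v) p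
      = s * (r * v p - r\<^sup>2 * B * k) - s\<^sup>2 * (r * B - r\<^sup>2 * B * (r + s)) * k"
      unfolding inner burau_letter_comb Let_def outer by (simp add: loop_weight_def B_def k_def sr)
    also have "\<dots> = (s * r) * v p - (s * r) * (r * B * k) - (s * r) * (s * B * k)
        + (s * r) * ((s * r) * ((r + s) * B * k))"
      by (simp add: algebra_simps power2_eq_square)
    also have "\<dots> = v p" unfolding sr(1) by (simp add: algebra_simps)
    finally show "burau_letter y z (i, b) (burau_letter y z (i, \<not> b) v) p = v p" .
  qed
  then show ?thesis by (simp add: burau_def)
qed

lemma burau_far:
  assumes "Suc i < j"
  shows "burau y z [(i, True), (j, True)] v = burau y z [(j, True), (i, True)] v"
proof
  fix p
  have c: "loop_weight y z i j = 0" "loop_weight y z j i = 0" using assms by (auto simp: loop_weight_def)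
  have 1: "burau_letter y z (k, True) v = (\<lambda>p. y * v p + (- y\<^sup>2 * bra z k v) * ket y k p + 0 * ket y k p)" for k
    by (simp add: burau_letter_def cup_cap_def mult.assoc)
  have 2: "burau_letter y z (k, True) (burau_letter y z (l, True) v) p
      = y * (y * v p - y\<^sup>2 * bra z l v * ket y l p) - y\<^sup>2 * (y * bra z k v) * ket y k p"
    if "loop_weight y z k l = 0" for k l
    unfolding 1[of l] burau_letter_comb by (simp add: that Let_def)
  show "burau y z [(i, True), (j, True)] v p = burau y z [(j, True), (i, True)] v p"
    by (simp add: burau_def 2 c) (simp add: algebra_simps)
qed

lemma burau_braid:
  "burau y z [(i, True), (Suc i, True), (i, True)] v = burau y z [(Suc i, True), (i, True), (Suc i, True)] v"
proof -
  \<comment> \<open>The result is symmetric in \<open>i\<close> and \<open>j\<close>.\<close>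
  have expand: "burau_letter y z (i, True) (burau_letter y z (j, True) (burau_letter y z (i, True) v))
    = (\<lambda>p. y ^ 3 * v p + (y ^ 5 * bra z j v - y ^ 4 * bra z i v) * ket y i p
        + (y ^ 5 * bra z i v - y ^ 4 * bra z j v) * ket y j p)"
    if c: "loop_weight y z i j = 1" "loop_weight y z j i = 1" "loop_weight y z i i = y + z" for i j
  proof
    fix p
    define A where "A = bra z i v"
    define B where "B = bra z j v"
    have 1: "burau_letter y z (i, True) v = (\<lambda>p. y * v p + (- y\<^sup>2 * A) * ket y i p + 0 * ket y j p)"
      by (simp add: burau_letter_def cup_cap_def A_def mult.assoc)
    have 2: "burau_letter y z (j, True) (burau_letter y z (i, True) v)
      = (\<lambda>p. y\<^sup>2 * v p + (- (y ^ 3) * A) * ket y i p + (y ^ 4 * A - y ^ 3 * B) * ket y j p)"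
      unfolding 1 burau_letter_comb by (simp add: c B_def[symmetric] Let_def algebra_simps eval_nat_numeral)
    have "burau_letter y z (i, True) (burau_letter y z (j, True) (burau_letter y z (i, True) v)) p
      = y * (y\<^sup>2 * v p + (- (y ^ 3) * A) * ket y i p + (y ^ 4 * A - y ^ 3 * B) * ket y j p)
        - y\<^sup>2 * (y\<^sup>2 * A - y ^ 3 * A * (y + z) + (y ^ 4 * A - y ^ 3 * B)) * ket y i p"
      unfolding 2 burau_letter_comb by (simp add: c A_def[symmetric] Let_def)
    also have "\<dots> = y ^ 3 * v p + (y ^ 5 * B - y ^ 4 * A) * ket y i p + (y ^ 5 * A - y ^ 4 * B) * ket y j p
        + (y * z - 1) * y ^ 4 * A * ket y i p"
      by (simp add: algebra_simps eval_nat_numeral)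
    finally show "burau_letter y z (i, True) (burau_letter y z (j, True) (burau_letter y z (i, True) v)) p
      = y ^ 3 * v p + (y ^ 5 * bra z j v - y ^ 4 * bra z i v) * ket y i p
        + (y ^ 5 * bra z i v - y ^ 4 * bra z j v) * ket y j p"
      by (simp add: yz A_def B_def)
  qed
  show ?thesis
    using expand[of i "Suc i"] expand[of "Suc i" i]
    by (simp add: burau_def loop_weight_def add.commute add.left_commute)
qed

lemma burau_equiv: "braid_equiv m u v \<Longrightarrow> burau y z u = burau y z v"
proof (induction rule: braid_equiv.induct)
  case (append u u' v v')
  then show ?case by (simp add: burau_append)
next
  case (cancel i b)
  then show ?case using burau_cancel[of i b] by (auto simp: burau_def)
next
  case (far i j)
  then show ?case using burau_far by blast
next
  case (braid i)
  then show ?case using burau_braid by blast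
qed simp_all

lemma bra_cup_caps:
  "bra z i (foldr (cup_cap y z) js v) = chain_weight y z i js * bra z (last (i # js)) v"
proof (induction js arbitrary: i)
  case (Cons j js)
  have "bra z i (cup_cap y z j u) = loop_weight y z i j * bra z j u" for u
    unfolding bra_ket[symmetric] by (simp add: bra_def cup_cap_def algebra_simps)
  then show ?case by (simp add: Cons mult.assoc)
qed simp

lemma sum_two_points:
  assumes "Suc i < m"
  shows "(\<Sum>p<m. f p * ket y i p) = f i * y + f (Suc i)"
proof -
  have "(\<Sum>p<m. f p * ket y i p) = (\<Sum>p\<in>{i, Suc i}. f p * ket y i p)"
    by (rule sum.mono_neutral_right) (use assms in \<open>auto simp: ket_def\<close>)
  then show ?thesis by (simp add: ket_def)
qed

text \<open>The trace of a product of rank one operators is the cyclic product of the pairings of neighbours; the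
first argument of \<open>chain_weight\<close> closes the cycle.\<close>
lemma op_trace_cup_caps:
  assumes "Suc j < m"
  shows "op_trace m (foldr (cup_cap y z) (j # js)) = chain_weight y z (last (j # js)) (j # js)"
proof -
  have "op_trace m (foldr (cup_cap y z) (j # js))
      = (\<Sum>p<m. (chain_weight y z j js * bra z (last (j # js)) (unit_vec p)) * ket y j p)"
    by (simp add: op_trace_def cup_cap_def[of y z j] bra_cup_caps)
  also have "\<dots> = chain_weight y z j js * bra z (last (j # js)) (ket y j)"
    by (subst sum_two_points[OF assms]) (simp add: bra_def unit_vec_def ket_def algebra_simps)
  finally show ?thesis by (simp add: bra_ket mult.commute)
qed

end

definition state_weight :: "'a::comm_ring_1 \<Rightarrow> 'a \<Rightarrow> braid_word \<Rightarrow> nat set \<Rightarrow> 'a" where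
  "state_weight y z w S = (\<Prod>t<length w. let s = (if snd (w ! t) then y else z) in if t \<in> S then - s\<^sup>2 else s)"

definition turn_indices :: "braid_word \<Rightarrow> nat set \<Rightarrow> nat list" where
  "turn_indices w S = map (\<lambda>t. fst (w ! t)) (filter (\<lambda>t. t \<in> S) [0..<length w])"

lemma sum_Pow_Suc:
  fixes f :: "nat set \<Rightarrow> 'b::comm_monoid_add"
  shows "(\<Sum>S\<in>Pow {..<Suc n}. f S) = (\<Sum>S\<in>Pow {..<n}. f S + f (insert n S))"
proof -
  have "Pow {..<Suc n} = Pow {..<n} \<union> insert n ` Pow {..<n}"
    by (simp add: lessThan_Suc Pow_insert)
  moreover have "Pow {..<n} \<inter> insert n ` Pow {..<n} = {}" by auto
  moreover have "inj_on (insert n) (Pow {..<n})" 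
    by (rule inj_onI) (metis PowD insert_ident lessThan_iff less_irrefl subsetD)
  ultimately show ?thesis by (simp add: sum.union_disjoint sum.reindex sum.distrib)
qed

text \<open>Expanding the product of the letters gives one term for each set \<open>S\<close> of crossings where the
Temperley-Lieb generator is chosen.\<close>
lemma burau_state_sum:
  "burau y z w v p = (\<Sum>S\<in>Pow {..<length w}. state_weight y z w S * foldr (cup_cap y z) (turn_indices w S) v p)"
proof (induction w arbitrary: v rule: rev_induct)
  case Nil
  then show ?case by (simp add: burau_def state_weight_def turn_indices_def)
next
  case (snoc x w)
  define s where "s = (if snd x then y else z)"
  let ?F = "\<lambda>S. foldr (cup_cap y z) (turn_indices w S)"
  have in_S: "t \<in> insert (length w) S \<longleftrightarrow> t \<in> S" if "t < length w" for t S using that by auto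
  have w: "state_weight y z (w @ [x]) S = state_weight y z w S * s"
    "state_weight y z (w @ [x]) (insert (length w) S) = state_weight y z w S * (- s\<^sup>2)"
    if "S \<subseteq> {..<length w}" for S
    using that by (auto simp: state_weight_def nth_append s_def Let_def intro!: arg_cong2[where f = "(*)"] prod.cong)
  have i: "turn_indices (w @ [x]) S = turn_indices w S"
    "turn_indices (w @ [x]) (insert (length w) S) = turn_indices w S @ [fst x]"
    if "S \<subseteq> {..<length w}" for S
    using that by (auto simp: turn_indices_def nth_append intro!: map_cong filter_cong)
  have "burau y z (w @ [x]) v p = burau y z w (\<lambda>p. s * v p + (- s\<^sup>2) * cup_cap y z (fst x) v p) p"
    by (simp add: burau_def burau_letter_def s_def)
  also have "\<dots> = (\<Sum>S\<in>Pow {..<length w}. state_weight y z w S *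
      ?F S (\<lambda>p. s * v p + (- s\<^sup>2) * cup_cap y z (fst x) v p) p)"
    by (rule snoc)
  also have "\<dots> = (\<Sum>S\<in>Pow {..<length w}. state_weight y z w S *
      (s * ?F S v p + (- s\<^sup>2) * ?F S (cup_cap y z (fst x) v) p))"
    by (simp only: linear_opD[OF linear_foldr[OF linear_cup_cap]])
  also have "\<dots> = (\<Sum>S\<in>Pow {..<length w}.
      state_weight y z (w @ [x]) S * foldr (cup_cap y z) (turn_indices (w @ [x]) S) v p +
      state_weight y z (w @ [x]) (insert (length w) S)
        * foldr (cup_cap y z) (turn_indices (w @ [x]) (insert (length w) S)) v p)"
    by (rule sum.cong[OF HOL.refl]) (simp add: w i algebra_simps)
  also have "\<dots> = (\<Sum>S\<in>Pow {..<length (w @ [x])}.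
      state_weight y z (w @ [x]) S * foldr (cup_cap y z) (turn_indices (w @ [x]) S) v p)"
    by (simp add: sum_Pow_Suc)
  finally show ?case .
qed

lemma op_trace_burau:
  "op_trace m (burau y z w)
    = (\<Sum>S\<in>Pow {..<length w}. state_weight y z w S * op_trace m (foldr (cup_cap y z) (turn_indices w S)))"
  unfolding op_trace_def burau_state_sum sum_distrib_left by (rule sum.swap)

lemma linear_op_expand:
  assumes F: "linear_op F" and v: "\<And>p. m \<le> p \<Longrightarrow> v p = 0"
  shows "F v p = (\<Sum>q<m. v q * F (unit_vec q) p)"
proof -
  have zero: "F (\<lambda>p. 0) = (\<lambda>p. 0)"
    using F[unfolded linear_op_def, rule_format, of 0 "\<lambda>_. 0" 0 "\<lambda>_. 0"] by simp
  have sum: "F (\<lambda>p. \<Sum>q<n. v q * unit_vec q p) p = (\<Sum>q<n. v q * F (unit_vec q) p)" for n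
  proof (induction n)
    case (Suc n)
    then show ?case
      using linear_opD[OF F, of 1 "\<lambda>p. \<Sum>q<n. v q * unit_vec q p" "v n" "unit_vec n" p] by simp
  qed (simp add: zero)
  have v_eq: "v = (\<lambda>p. \<Sum>q<m. v q * unit_vec q p)"
  proof
    fix p
    have "(\<Sum>q<m. v q * unit_vec q p) = (\<Sum>q<m. if q = p then v q else 0)"
      by (rule sum.cong) (auto simp: unit_vec_def)
    then show "v p = (\<Sum>q<m. v q * unit_vec q p)" using v[of p] by (simp add: not_less)
  qed
  have "F v p = F (\<lambda>p. \<Sum>q<m. v q * unit_vec q p) p"
    by (rule arg_cong[OF v_eq, of "\<lambda>v. F v p"])
  then show ?thesis unfolding sum .
qed

lemma burau_support:
  assumes "w \<in> braid_words m" "\<And>p. m \<le> p \<Longrightarrow> v p = 0" "m \<le> p"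
  shows "burau y z w v p = 0"
  using assms
proof (induction w arbitrary: p)
  case Nil
  then show ?case by (simp add: burau_def)
next
  case (Cons x w)
  then have "Suc (fst x) < m" "w \<in> braid_words m" by (cases x; auto simp: braid_words_def)+
  moreover from this have "burau y z w v p = 0" using Cons by simp
  ultimately show ?case using Cons.prems
    by (simp add: burau_def burau_letter_def Let_def cup_cap_def ket_def)
qed

lemma sum_symmetric_even:
  fixes f :: "nat \<Rightarrow> nat \<Rightarrow> 'a::comm_ring_1"
  assumes "\<And>p q. f p q = f q p"
  shows "2 dvd (\<Sum>p<m. \<Sum>q<m. f p q) - (\<Sum>p<m. f p p)"
proof (induction m)
  case (Suc m)
  have "(\<Sum>p<Suc m. \<Sum>q<Suc m. f p q) - (\<Sum>p<Suc m. f p p)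
      = ((\<Sum>p<m. \<Sum>q<m. f p q) - (\<Sum>p<m. f p p)) + 2 * (\<Sum>p<m. f p m)"
    using assms by (simp add: sum.distrib)
  then show ?case using Suc by simp
qed simp

text \<open>For the matrix \<open>M\<close> of the operator, both \<open>M\<^sub>p\<^sub>q M\<^sub>q\<^sub>p\<close> and \<open>M\<^sub>p\<^sub>p M\<^sub>q\<^sub>q\<close> are symmetric in
\<open>p\<close> and \<open>q\<close>, so modulo 2 only the diagonal terms remain in the sums, and these are the same.\<close>
lemma op_trace_square:
  assumes u: "u \<in> braid_words m"
  shows "2 dvd op_trace m (burau y z (u @ u)) - (op_trace m (burau y z u))\<^sup>2"
proof -
  let ?M = "\<lambda>p q. burau y z u (unit_vec q) p"
  have "op_trace m (burau y z (u @ u)) = (\<Sum>p<m. \<Sum>q<m. ?M q p * ?M p q)"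
    unfolding op_trace_def burau_append comp_def
  proof (rule sum.cong[OF HOL.refl])
    fix p assume p: "p \<in> {..<m}"
    have "burau y z u (unit_vec p) q = 0" if "m \<le> q" for q
      using burau_support[OF u _ that, of "unit_vec p"] p by (simp add: unit_vec_def)
    then show "burau y z u (burau y z u (unit_vec p)) p = (\<Sum>q<m. ?M q p * ?M p q)"
      by (rule linear_op_expand[OF linear_burau])
  qed
  moreover have h1: "2 dvd (\<Sum>p<m. \<Sum>q<m. ?M q p * ?M p q) - (\<Sum>p<m. ?M p p * ?M p p)"
    by (rule sum_symmetric_even) (simp add: mult.commute)
  moreover have "(op_trace m (burau y z u))\<^sup>2 = (\<Sum>p<m. \<Sum>q<m. ?M p p * ?M q q)"
    by (simp add: op_trace_def power2_eq_square sum_product)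
  moreover have h2: "2 dvd (\<Sum>p<m. \<Sum>q<m. ?M p p * ?M q q) - (\<Sum>p<m. ?M p p * ?M p p)"
    by (rule sum_symmetric_even) (simp add: mult.commute)
  ultimately show ?thesis using dvd_diff[OF h1 h2] by simp
qed

section \<open>The state sum is a trace\<close>

lemma y_power_add: "y_power (i + j) = y_power i * y_power j"
  by (simp add: y_power_def mult_single)

lemma y_power_zero [simp]: "y_power 0 = 1"
  by (simp add: y_power_def)

lemma y_power_of_nat: "y_power (int n) = y_power 1 ^ n" "y_power (- int n) = y_power (- 1) ^ n"
proof -
  show "y_power (int n) = y_power 1 ^ n"
    by (induction n) (simp_all add: y_power_add)
  show "y_power (- int n) = y_power (- 1) ^ n"
  proof (induction n)
    case (Suc n)
    have "- int (Suc n) = - 1 + - int n" by simp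
    then show ?case using Suc by (simp only: y_power_add power_Suc)
  qed simp
qed

lemma y_power_sum: "finite A \<Longrightarrow> y_power (\<Sum>x\<in>A. f x) = (\<Prod>x\<in>A. y_power (f x))"
  by (induction A rule: finite_induct) (simp_all add: y_power_add)

abbreviation "yy \<equiv> y_power 1"
abbreviation "zz \<equiv> y_power (- 1)"

lemma yz_one: "yy * zz = 1"
  using y_power_add[of 1 "- 1"] by simp

lemma state_weight_prod:
  "state_weight y z w {t. t < length w \<and> \<not> oriented_at w R t}
    = (\<Prod>t<length w. if snd (w ! t) then (if t \<in> R then - y\<^sup>2 else y) else (if t \<in> R then z else - z\<^sup>2))"
  unfolding state_weight_def by (rule prod.cong) (auto simp: Let_def oriented_at_def)

lemma parity_sign_add: "parity_sign (i + j) = parity_sign i * (parity_sign j :: 'a::comm_ring_1)"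
  by (auto simp: parity_sign_even)

text \<open>The coefficients in the Burau operators are chosen such that each crossing accounts for its share in the sign
and in the shift of the quantum grading.\<close>
lemma state_weight_eq:
  assumes R: "R \<subseteq> {..<length w}"
  shows "state_weight yy zz w {t. t < length w \<and> \<not> oriented_at w R t}
    = parity_sign (int (card R) - int (n_neg w)) * y_power (int (card R) + int (n_pos w) - 2 * int (n_neg w))"
proof -
  \<comment> \<open>The contributions of crossing \<open>t\<close> to the homological degree and to the shift of the quantum degree.\<close>
  let ?e = "\<lambda>t. (if t \<in> R then 1 else 0) - (if snd (w ! t) then 0 else 1 :: int)"
  let ?d = "\<lambda>t. (if t \<in> R then 1 else 0) + (if snd (w ! t) then 1 else - 2 :: int)"
  have y2: "y_power 2 = yy\<^sup>2" "y_power (- 2) = zz\<^sup>2"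
    using y_power_of_nat[of 2] by simp_all
  have "state_weight yy zz w {t. t < length w \<and> \<not> oriented_at w R t}
      = (\<Prod>t<length w. parity_sign (?e t) * y_power (?d t))"
    unfolding state_weight_prod by (rule prod.cong) (auto simp: parity_sign_even y2)
  also have "\<dots> = parity_sign (\<Sum>t<length w. ?e t) * y_power (\<Sum>t<length w. ?d t)"
  proof -
    have "parity_sign (\<Sum>t<n. f t) = (\<Prod>t<n. parity_sign (f t) :: int \<Rightarrow>\<^sub>0 int)" for n and f :: "nat \<Rightarrow> int"
      by (induction n) (simp_all add: parity_sign_add parity_sign_def[of 0])
    from this[of ?e "length w"] show ?thesis
      by (simp only: prod.distrib y_power_sum finite_lessThan)
  qed
  also have "(\<Sum>t<length w. ?e t) = int (card R) - int (n_neg w)"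
  proof -
    have "(\<Sum>t<length w. if t \<in> R then 1 else 0 :: int) = int (card R)"
      using R by (simp add: sum.If_cases Int_absorb1)
    moreover have "(\<Sum>t<length w. if snd (w ! t) then 0 else 1 :: int) = int (n_neg w)"
      by (simp add: n_neg_def length_filter_conv_card sum.If_cases Int_def)
    ultimately show ?thesis by (simp add: sum_subtractf)
  qed
  also have "(\<Sum>t<length w. ?d t) = int (card R) + int (n_pos w) - 2 * int (n_neg w)"
  proof -
    have "(\<Sum>t<length w. if t \<in> R then 1 else 0 :: int) = int (card R)"
      using R by (simp add: sum.If_cases Int_absorb1)
    moreover have "(\<Sum>t<length w. if snd (w ! t) then 1 else - 2 :: int) = int (n_pos w) - 2 * int (n_neg w)"
      by (simp add: n_neg_def n_pos_def length_filter_conv_card sum.If_cases Int_def)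
    ultimately show ?thesis by (simp add: sum.distrib)
  qed
  finally show ?thesis .
qed

lemma sum_labels_prod:
  fixes f :: "'c \<Rightarrow> label \<Rightarrow> 'a::comm_ring_1"
  assumes "finite A"
  shows "(\<Sum>l\<in>A \<rightarrow>\<^sub>E UNIV. \<Prod>C\<in>A. f C (l C)) = (\<Prod>C\<in>A. f C Vplus + f C Vminus)"
proof -
  have labels: "(UNIV :: label set) = {Vplus, Vminus}" by (auto intro: label.exhaust)
  have "(\<Prod>C\<in>A. f C Vplus + f C Vminus) = (\<Prod>C\<in>A. \<Sum>v\<in>UNIV. f C v)" unfolding labels by simp
  also have "\<dots> = (\<Sum>l\<in>A \<rightarrow>\<^sub>E UNIV. \<Prod>C\<in>A. f C (l C))"
    by (rule prod_sum_PiE) (simp_all add: assms, simp add: labels)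
  finally show ?thesis by simp
qed

context braid_diagram begin

text \<open>The labellings in winding number grading \<open>m - 2\<close>. The sum \<open>state R\<close> leaves out sign and shift, which depend
on \<open>R\<close> only.\<close>
definition top_labels :: "nat set \<Rightarrow> (point set \<Rightarrow> label) set" where
  "top_labels R = {l \<in> circ R \<rightarrow>\<^sub>E UNIV. wind_deg m w (R, l) = int m - 2}"

definition state :: "nat set \<Rightarrow> int \<Rightarrow>\<^sub>0 int" where
  "state R = (\<Sum>l\<in>top_labels R. y_power (\<Sum>C\<in>circ R. sign_of (l C)))"

lemma finite_labellings: "finite (circ R \<rightarrow>\<^sub>E (UNIV :: label set))"
  by (intro finite_PiE finite_circles finite_labels)

lemma sum_sign_minus:
  assumes "finite A"
  shows "(\<Sum>C\<in>A. sign_of (l C)) = int (card A) - 2 * int (card {C \<in> A. l C = Vminus})"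
proof -
  have "sign_of v = 1 - 2 * (if v = Vminus then 1 else 0)" for v by (cases v) simp_all
  then have "(\<Sum>C\<in>A. sign_of (l C)) = int (card A) - 2 * (\<Sum>C\<in>A. if l C = Vminus then 1 else 0)"
    by (simp add: sum_subtractf sum_distrib_left)
  then show ?thesis using assms by (simp add: sum.If_cases Int_def)
qed

text \<open>All \<open>m\<close> circles are nontrivial and exactly one of them is labelled minus.\<close>
lemma state_oriented:
  assumes "unoriented R = {}"
  shows "state R = y_power (int m - 2) * of_nat m"
proof -
  note circ = oriented_circles[OF assms]
  have wind: "wind_deg m w (R, l) = (\<Sum>C\<in>circ R. sign_of (l C))" for l
    unfolding wind_deg_sum by (rule sum.cong) (simp_all add: circ(2))
  have top: "l \<in> top_labels R \<longleftrightarrow> l \<in> circ R \<rightarrow>\<^sub>E UNIV \<and> card {C \<in> circ R. l C = Vminus} = 1" for l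
    using circ(1) by (auto simp: top_labels_def wind sum_sign_minus finite_circles)
  let ?l = "\<lambda>D. \<lambda>C\<in>circ R. if C = D then Vminus else Vplus"
  have "top_labels R = ?l ` circ R"
  proof (intro equalityI subsetI)
    fix l assume "l \<in> top_labels R"
    then have l: "l \<in> circ R \<rightarrow>\<^sub>E UNIV" and "card {C \<in> circ R. l C = Vminus} = 1" using top by blast+
    then obtain D where D: "{C \<in> circ R. l C = Vminus} = {D}" by (auto simp: card_1_singleton_iff)
    have "l = ?l D"
    proof (rule PiE_ext[OF l])
      fix C assume C: "C \<in> circ R"
      then have "l C = Vminus \<longleftrightarrow> C = D" using D by blast
      then show "l C = ?l D C" using C by (cases "l C") auto
    qed auto
    then show "l \<in> ?l ` circ R" using D by blast
  next
    fix l assume "l \<in> ?l ` circ R"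
    then obtain D where D: "D \<in> circ R" "l = ?l D" by blast
    then have "{C \<in> circ R. l C = Vminus} = {D}" by auto
    then show "l \<in> top_labels R" using D unfolding top by auto
  qed
  moreover have "inj_on ?l (circ R)"
  proof (rule inj_onI)
    fix C D assume C: "C \<in> circ R" and eq: "?l C = ?l D"
    have "?l C C = ?l D C" by (rule fun_cong[OF eq])
    then show "C = D" using C by (simp split: if_splits)
  qed
  ultimately have "card (top_labels R) = m" by (simp add: card_image circ(1))
  moreover have "state R = (\<Sum>l\<in>top_labels R. y_power (int m - 2))"
    unfolding state_def by (rule sum.cong) (auto simp: top_labels_def wind[symmetric])
  ultimately show ?thesis by (simp add: mult.commute)
qed

lemma wind_deg_le: "wind_deg m w (R, l) \<le> int (card {C \<in> circ R. nontrivial C})"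
proof -
  have "wind_deg m w (R, l) \<le> (\<Sum>C\<in>circ R. if nontrivial C then 1 else 0)"
    unfolding wind_deg_sum
  proof (rule sum_mono)
    fix C show "(if nontrivial C then sign_of (l C) else 0) \<le> (if nontrivial C then 1 else 0)"
      by (cases "l C") simp_all
  qed
  then show ?thesis by (simp add: sum.If_cases finite_circles Int_def)
qed

lemma state_far:
  assumes "unoriented R \<noteq> {}" "t \<in> unoriented R"
    and "Suc (ix t) < below (unoriented R) t \<or> Suc (below (unoriented R) t) < ix t"
  shows "state R = 0"
proof -
  have "card {C \<in> circ R. nontrivial C} + 3 \<le> m" by (rule few_nontrivial[OF assms])
  then have "wind_deg m w (R, l) \<noteq> int m - 2" for l
    using wind_deg_le[of R l] by linarith
  then have "top_labels R = {}" by (simp add: top_labels_def)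
  then show ?thesis by (simp add: state_def)
qed

text \<open>All \<open>m - 2\<close> nontrivial circles are labelled plus, while the trivial circles are labelled freely.\<close>
lemma state_near:
  assumes ne: "unoriented R \<noteq> {}"
    and near: "\<forall>t\<in>unoriented R. \<not> (Suc (ix t) < below (unoriented R) t \<or> Suc (below (unoriented R) t) < ix t)"
  shows "state R = y_power (int m - 2) * (yy + zz) ^ card {s \<in> unoriented R. below (unoriented R) s = ix s}"
proof -
  let ?O = "{C \<in> circ R. nontrivial C}" and ?E = "{C \<in> circ R. \<not> nontrivial C}"
  have "m \<ge> 2"
  proof -
    obtain t where "t \<in> unoriented R" using ne by blast
    then show ?thesis using ix_less[of t] by (auto simp: unoriented_def)
  qed
  then have cardO: "int (card ?O) = int m - 2" using card_nontrivial[OF ne near] by simp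
  have cardE: "card ?E = card {s \<in> unoriented R. below (unoriented R) s = ix s}"
    using card_trivial[OF ne near] unfolding loops_def[OF ne near] .
  have finO: "finite ?O" using finite_circles by simp
  have "wind_deg m w (R, l) = (\<Sum>C\<in>?O. sign_of (l C))" for l
    unfolding wind_deg_sum by (rule sum.inter_filter[OF finite_circles, symmetric])
  then have wind: "wind_deg m w (R, l) = int m - 2 \<longleftrightarrow> (\<forall>C\<in>?O. l C = Vplus)" for l
  proof -
    have "wind_deg m w (R, l) = int m - 2 \<longleftrightarrow> card {C \<in> ?O. l C = Vminus} = 0"
      using \<open>\<And>l. wind_deg m w (R, l) = _\<close> cardO finO by (simp add: sum_sign_minus)
    also have "\<dots> \<longleftrightarrow> {C \<in> ?O. l C = Vminus} = {}" 
      using finite_circles by (intro card_0_eq) simp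
    also have "\<dots> \<longleftrightarrow> (\<forall>C\<in>?O. l C = Vplus)" by (auto; metis label.exhaust)
    finally show ?thesis .
  qed
  \<comment> \<open>The value 0 removes the labellings with a minus on a nontrivial circle.\<close>
  let ?f = "\<lambda>C v. if nontrivial C \<and> v = Vminus then 0 else y_power (sign_of v)"
  have "state R = (\<Sum>l\<in>circ R \<rightarrow>\<^sub>E UNIV. \<Prod>C\<in>circ R. ?f C (l C))"
    unfolding state_def
  proof (rule sum.mono_neutral_cong_left[OF finite_labellings])
    show "\<forall>l\<in>(circ R \<rightarrow>\<^sub>E UNIV) - top_labels R. (\<Prod>C\<in>circ R. ?f C (l C)) = 0"
    proof
      fix l assume "l \<in> (circ R \<rightarrow>\<^sub>E UNIV) - top_labels R"
      then obtain C where "C \<in> circ R" "nontrivial C" "l C = Vminus"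
        unfolding top_labels_def wind by (auto; metis label.exhaust)
      then show "(\<Prod>C\<in>circ R. ?f C (l C)) = 0"
        using finite_circles by (intro prod_zero) auto
    qed
    fix l assume "l \<in> top_labels R"
    then have "\<forall>C\<in>?O. l C = Vplus" unfolding top_labels_def wind by blast
    then show "y_power (\<Sum>C\<in>circ R. sign_of (l C)) = (\<Prod>C\<in>circ R. ?f C (l C))"
      unfolding y_power_sum[OF finite_circles] by (intro prod.cong) auto
  qed (auto simp: top_labels_def)
  also have "\<dots> = (\<Prod>C\<in>circ R. ?f C Vplus + ?f C Vminus)"
    by (rule sum_labels_prod[OF finite_circles])
  also have "\<dots> = (\<Prod>C\<in>circ R. if nontrivial C then yy else yy + zz)"
    by (rule prod.cong) auto
  also have "\<dots> = yy ^ card ?O * (yy + zz) ^ card ?E"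
    by (simp add: prod.If_cases finite_circles Int_def)
  also have "yy ^ card ?O = y_power (int m - 2)"
    unfolding cardO[symmetric] y_power_of_nat ..
  finally show ?thesis unfolding cardE .
qed

lemma chain_weight_turn_list:
  assumes "t \<le> length w"
  shows "chain_weight y z (last (turn_list S (length w))) (turn_list S t)
    = (\<Prod>s\<in>{s \<in> S. s < t}. loop_weight y z (below S s) (ix s))"
  using assms
proof (induction t)
  case 0
  then show ?case by (simp add: turn_list_def)
next
  case (Suc t)
  have "{s \<in> S. s < Suc t} = (if t \<in> S then insert t {s \<in> S. s < t} else {s \<in> S. s < t})"
    by (auto simp: less_Suc_eq)
  then show ?case
    using Suc by (simp add: turn_list_Suc chain_weight_snoc below_def mult.commute)
qed

text \<open>Three cases, as for the circles: no Temperley-Lieb generator, a pair of consecutive generators at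
distance at least 2, where the trace vanishes as there are no labellings, and no such pair.\<close>
lemma op_trace_state:
  "y_power (int m - 2) * op_trace m (foldr (cup_cap yy zz) (turn_indices w (unoriented R))) = state R"
proof -
  let ?U = "unoriented R"
  have list: "turn_indices w ?U = turn_list ?U (length w)"
    by (simp add: turn_indices_def turn_list_def)
  show ?thesis
  proof (cases "?U = {}")
    case True
    then have "turn_indices w ?U = []" by (simp add: turn_indices_def)
    then show ?thesis using state_oriented[OF True] op_trace_id[of m, where 'a = "int \<Rightarrow>\<^sub>0 int"] by (simp add: id_def)
  next
    case False
    have U: "{s \<in> ?U. s < length w} = ?U" by (auto simp: unoriented_def)
    have fin: "finite ?U" by (rule finite_subset[of _ "{..<length w}"]) (auto simp: unoriented_def)
    have "turn_list ?U (length w) \<noteq> []"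
      using False by (auto simp: turn_list_def filter_empty_conv unoriented_def)
    then obtain j js where js: "turn_list ?U (length w) = j # js" by (cases "turn_list ?U (length w)") auto
    then have "j \<in> set (turn_list ?U (length w))" by simp
    then have "j \<in> ix ` {..<length w}" by (auto simp: turn_list_def)
    then have "Suc j < m" using ix_less by auto
    then have tr: "op_trace m (foldr (cup_cap yy zz) (turn_indices w ?U))
        = (\<Prod>s\<in>?U. loop_weight yy zz (below ?U s) (ix s))"
      using op_trace_cup_caps[OF yz_one, of j m js] chain_weight_turn_list[of "length w" yy zz ?U]
      unfolding list js U by simp
    show ?thesis
    proof (cases "\<exists>t\<in>?U. Suc (ix t) < below ?U t \<or> Suc (below ?U t) < ix t")
      case True
      then obtain t where t: "t \<in> ?U" "Suc (ix t) < below ?U t \<or> Suc (below ?U t) < ix t" by blast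
      then have "loop_weight yy zz (below ?U t) (ix t) = 0" by (auto simp: loop_weight_def)
      then have "(\<Prod>s\<in>?U. loop_weight yy zz (below ?U s) (ix s)) = 0"
        using t fin by (intro prod_zero) auto
      then show ?thesis using state_far[OF False t] tr by simp
    next
      case near: False
      have "(\<Prod>s\<in>?U. loop_weight yy zz (below ?U s) (ix s)) = (\<Prod>s\<in>?U. if below ?U s = ix s then yy + zz else 1)"
        by (rule prod.cong) (use near in \<open>auto simp: loop_weight_def\<close>)
      also have "\<dots> = (yy + zz) ^ card {s \<in> ?U. below ?U s = ix s}"
        using fin by (simp add: prod.If_cases Int_def)
      finally show ?thesis using state_near[OF False] near tr by auto
    qed
  qed
qed

text \<open>Passing from a set of 1-resolved crossings to the set of crossings that are not resolved along the
orientation is an involution, namely the symmetric difference with the set of negative crossings. It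
identifies the terms of the two sums.\<close>
lemma q_poly_burau: "q_poly m w (int m - 2) = y_power (int m - 2) * op_trace m (burau yy zz w)"
proof -
  let ?toggle = "\<lambda>S. {t. t < length w \<and> \<not> oriented_at w S t}"
  have gens: "{g. g \<in> generators m w \<and> wind_deg m w g = int m - 2} = (SIGMA R : Pow {..<length w}. top_labels R)"
    by (auto simp: generators_iff top_labels_def)
  have "q_poly m w (int m - 2) = (\<Sum>R\<in>Pow {..<length w}. \<Sum>l\<in>top_labels R.
      parity_sign (hom_deg w (R, l)) * y_power (q_deg m w (R, l)))"
    unfolding q_poly_state_sum gens
    by (subst sum.Sigma) (auto simp: top_labels_def finite_labellings)
  also have "\<dots> = (\<Sum>R\<in>Pow {..<length w}. state_weight yy zz w (unoriented R) * state R)"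
  proof (rule sum.cong[OF HOL.refl])
    fix R assume "R \<in> Pow {..<length w}"
    then have R: "R \<subseteq> {..<length w}" by blast
    have "y_power (q_deg m w (R, l)) = y_power (int (card R) + int (n_pos w) - 2 * int (n_neg w))
        * y_power (\<Sum>C\<in>circ R. sign_of (l C))" for l
      unfolding q_deg_sum y_power_add[symmetric] by (simp add: algebra_simps)
    then show "(\<Sum>l\<in>top_labels R. parity_sign (hom_deg w (R, l)) * y_power (q_deg m w (R, l)))
        = state_weight yy zz w (unoriented R) * state R"
      unfolding unoriented_def state_weight_eq[OF R] state_def sum_distrib_left
      by (simp add: hom_deg_def mult.assoc)
  qed
  also have "\<dots> = y_power (int m - 2) * (\<Sum>R\<in>Pow {..<length w}. state_weight yy zz w (unoriented R)
      * op_trace m (foldr (cup_cap yy zz) (turn_indices w (unoriented R))))"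
    unfolding op_trace_state[symmetric] sum_distrib_left by (simp add: algebra_simps)
  also have "(\<Sum>R\<in>Pow {..<length w}. state_weight yy zz w (unoriented R)
      * op_trace m (foldr (cup_cap yy zz) (turn_indices w (unoriented R)))) = op_trace m (burau yy zz w)"
    unfolding op_trace_burau
    by (rule sum.reindex_bij_witness[of _ unoriented unoriented])
      (auto simp: unoriented_def oriented_at_def)
  finally show ?thesis .
qed

end

section \<open>The square of a braid\<close>
lemma braid_equiv_words: "braid_equiv m u v \<Longrightarrow> u \<in> braid_words m \<and> v \<in> braid_words m"
  by (induction rule: braid_equiv.induct) (auto simp: braid_words_def)

text \<open>Powers in the braid group start with the neutral element, which is the class of the empty word.\<close>
lemma braid_square_equiv:
  assumes "\<sigma> \<in> carrier (braid_group m)" "u \<in> \<sigma>" "v \<in> \<sigma> [^]\<^bsub>braid_group m\<^esub> (2::nat)"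
  shows "braid_equiv m (u @ u) v"
proof -
  obtain u0 where \<sigma>: "\<sigma> = braid_rel m `` {u0}"
    using assms(1) by (auto simp: braid_group_def elim!: quotientE)
  have in_\<sigma>: "x \<in> \<sigma> \<Longrightarrow> braid_equiv m u x" for x
    using assms(2) unfolding \<sigma> braid_rel_def by (auto intro: braid_equiv.trans braid_equiv.sym)
  have "\<sigma> [^]\<^bsub>braid_group m\<^esub> (2::nat)
      = (\<one>\<^bsub>braid_group m\<^esub> \<otimes>\<^bsub>braid_group m\<^esub> \<sigma>) \<otimes>\<^bsub>braid_group m\<^esub> \<sigma>"
    by (simp add: nat_pow_def numeral_2_eq_2)
  then obtain e x y where e: "braid_equiv m [] e" "x \<in> \<sigma>" "y \<in> \<sigma>"
      and v: "\<exists>a. braid_equiv m (e @ x) a \<and> braid_equiv m (a @ y) v"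
    using assms(3) unfolding braid_group_def braid_rel_def by auto
  then obtain a where a: "braid_equiv m (e @ x) a" "braid_equiv m (a @ y) v" by blast
  have "braid_equiv m ([] @ u) (e @ x)" using e in_\<sigma> by (blast intro: braid_equiv.append)
  then have "braid_equiv m u a" using a(1) braid_equiv.trans by auto
  then have "braid_equiv m (u @ u) (a @ y)" using e(3) in_\<sigma> by (blast intro: braid_equiv.append)
  then show ?thesis using a(2) by (rule braid_equiv.trans)
qed

theorem proposition6p1:
  fixes n :: nat and \<sigma> :: "braid_word set" and u v :: braid_word
  assumes "\<sigma> \<in> carrier (braid_group (n + 1))"
    and "u \<in> \<sigma>"
    and "v \<in> \<sigma> [^]\<^bsub>braid_group (n + 1)\<^esub> (2::nat)"
  shows "2 dvd (y_power (int n - 1) * q_poly (n + 1) v (int n - 1)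
    - (q_poly (n + 1) u (int n - 1))\<^sup>2)"
proof -
  let ?T = "\<lambda>w. op_trace (n + 1) (burau yy zz w)"
  have equiv: "braid_equiv (n + 1) (u @ u) v" by (rule braid_square_equiv[OF assms])
  then have words: "u \<in> braid_words (n + 1)" "v \<in> braid_words (n + 1)"
    using braid_equiv_words[OF equiv] by (auto simp: braid_words_def)
  have q: "q_poly (n + 1) w (int n - 1) = y_power (int n - 1) * ?T w" if "w \<in> braid_words (n + 1)" for w
  proof -
    interpret braid_diagram "n + 1" w by standard (rule that)
    show ?thesis using q_poly_burau by simp
  qed
  have T: "?T v = ?T (u @ u)" using burau_equiv[OF yz_one equiv] by simp
  have "y_power (int n - 1) * q_poly (n + 1) v (int n - 1) - (q_poly (n + 1) u (int n - 1))\<^sup>2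
      = (y_power (int n - 1))\<^sup>2 * (?T (u @ u) - (?T u)\<^sup>2)"
    unfolding q[OF words(1)] q[OF words(2)] T by (simp add: algebra_simps power2_eq_square)
  then show ?thesis using op_trace_square[OF words(1), of yy zz] by simp
qed

end
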